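(* For every $\varepsilon>0$ there is a constant $C_\varepsilon$ such that the following holds. Let $k$ be a positive even integer and let $f$ be a holomorphic Hecke eigenform (cusp form) of weight $k$ for $SL(2,\mathbb{Z})$ with Fourier expansion $$f(z)=\sum_{n=1}^\infty \lambda_f(n)\,n^{\frac{k-1}{2}}e(nz)\qquad(\operatorname{Im} z>0),$$ normalized so that $\lambda_f(1)=1$. Then for every real number $\alpha$ and every $N\ge 1$, $$\Big|\sum_{n\le N}\lambda_f(n)e(\alpha n)\Big|\le C_\varepsilon\, N^{1/2+\varepsilon}\,\mathfrak{q}_f^{1/4+\varepsilon},$$ where $\mathfrak{q}_f$ is the analytic conductor of $f$.
   Context: $e(z)=e^{2\pi i z}$. The analytic conductor $\mathfrak{q}_f$ of $f$ satisfies $\mathfrak{q}_f\asymp k^2$ (so the bound may equivalently be read with $\mathfrak{q}_f$ replaced by $k^2$, up to the constant). The implied constant depends only on $\varepsilon$; in particular it is uniform in $\alpha$, $N$, $k$ and $f$. *)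

theory Defs
  imports "HOL-Complex_Analysis.Complex_Analysis"
begin

definition upper_half_plane :: "complex set" where
  "upper_half_plane = {z. Im z > 0}"

definition e :: "complex \<Rightarrow> complex" where
  "e z = exp (2 * of_real pi * \<i> * z)"

text \<open>Only the values of a form on the upper half plane matter; no condition is imposed
  on \<open>f z\<close> for \<open>Im z \<le> 0\<close>, because functions are total.\<close>

definition weakly_modular :: "nat \<Rightarrow> (complex \<Rightarrow> complex) \<Rightarrow> bool" where
  "weakly_modular k f \<longleftrightarrow>
     (\<forall>a b c d :: int. a * d - b * c = 1 \<longrightarrow>
       (\<forall>z\<in>upper_half_plane.
         f ((of_int a * z + of_int b) / (of_int c * z + of_int d)) =
           (of_int c * z + of_int d) ^ k * f z))"

text \<open>The last conjunct says that \<open>f\<close> is holomorphic at the cusp and vanishes there: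
  its expansion in powers of \<open>e z\<close> has no constant term.\<close>

definition cusp_form :: "nat \<Rightarrow> (complex \<Rightarrow> complex) \<Rightarrow> bool" where
  "cusp_form k f \<longleftrightarrow>
     f holomorphic_on upper_half_plane \<and>
     weakly_modular k f \<and>
     (\<exists>a :: nat \<Rightarrow> complex. a 0 = 0 \<and>
        (\<forall>z\<in>upper_half_plane. (\<lambda>n. a n * e (of_nat n * z)) sums f z))"

text \<open>The operator \<open>T\<^sub>n f(z) = n\<^sup>k\<^sup>-\<^sup>1 \<Sum>\<^sub>a\<^sub>d\<^sub>=\<^sub>n d\<^sup>-\<^sup>k \<Sum>\<^sub>0\<^sub>\<le>\<^sub>b\<^sub><\<^sub>d f((a z + b) / d)\<close>, where \<open>a = n / d\<close>.\<close>

definition hecke_operator ::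
    "nat \<Rightarrow> nat \<Rightarrow> (complex \<Rightarrow> complex) \<Rightarrow> complex \<Rightarrow> complex" where
  "hecke_operator k n f z =
     of_nat n ^ (k - 1) *
       (\<Sum>d | d dvd n. (\<Sum>b<d. f ((of_nat (n div d) * z + of_nat b) / of_nat d)) / of_nat d ^ k)"

definition hecke_eigenform :: "nat \<Rightarrow> (complex \<Rightarrow> complex) \<Rightarrow> bool" where
  "hecke_eigenform k f \<longleftrightarrow>
     cusp_form k f \<and>
     (\<exists>z\<in>upper_half_plane. f z \<noteq> 0) \<and>
     (\<forall>n\<ge>1. \<exists>\<mu> :: complex. \<forall>z\<in>upper_half_plane. hecke_operator k n f z = \<mu> * f z)"

text \<open>The analytic conductor (at \<open>s = 0\<close>, in the convention of Iwaniec and Kowalski) of an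
  \<open>L\<close>-function of conductor \<open>q\<close> with gamma factor
  \<open>\<Prod>\<^sub>j pi powr (- s / 2) * Gamma ((s + \<kappa>\<^sub>j) / 2)\<close>.\<close>

definition analytic_conductor :: "nat \<Rightarrow> complex list \<Rightarrow> real" where
  "analytic_conductor q \<kappa>s = real q * (\<Prod>\<kappa>\<leftarrow>\<kappa>s. norm \<kappa> + 3)"

text \<open>The \<open>L\<close>-function of an eigenform of weight \<open>k\<close> and level 1, normalized to have
  functional equation \<open>s \<leftrightarrow> 1 - s\<close>, has conductor 1 and the gamma factor with
  parameters \<open>(k - 1) / 2\<close> and \<open>(k + 1) / 2\<close>. In particular the analytic conductor of an
  eigenform depends only on its weight.\<close>

definition eigenform_conductor :: "nat \<Rightarrow> real" where
  "eigenform_conductor k =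
     analytic_conductor 1 [(of_nat k - 1) / 2, (of_nat k + 1) / 2]"

lemma eigenform_conductor_eq:
  assumes "k \<ge> 1"
  shows "eigenform_conductor k = (real k + 5) * (real k + 7) / 4"
proof -
  have "norm ((of_nat k - 1) / 2 :: complex) = (real k - 1) / 2"
    using assms norm_of_real[of "(real k - 1) / 2", where 'a = complex] by simp
  moreover have "norm ((of_nat k + 1) / 2 :: complex) = (real k + 1) / 2"
    using norm_of_real[of "(real k + 1) / 2", where 'a = complex] by simp
  ultimately have "eigenform_conductor k = ((real k - 1) / 2 + 3) * ((real k + 1) / 2 + 3)"
    unfolding eigenform_conductor_def analytic_conductor_def by (simp del: norm_divide)
  then show ?thesis
    by (simp add: field_simps)
qed

lemma eigenform_conductor_bounds:
  assumes "k \<ge> 1"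
  shows "real k ^ 2 / 4 \<le> eigenform_conductor k" "eigenform_conductor k \<le> 12 * real k ^ 2"
proof -
  have eq: "eigenform_conductor k = (x ^ 2 + 12 * x + 35) / 4"
    and sq: "x \<le> x ^ 2" and x: "1 \<le> x" if "x = real k" for x
    using assms that eigenform_conductor_eq[OF assms]
    by (simp_all add: power2_eq_square algebra_simps)
  have "(x ^ 2 :: real) / 4 \<le> (x ^ 2 + 12 * x + 35) / 4"
    "(x ^ 2 + 12 * x + 35) / 4 \<le> 12 * x ^ 2" if "x \<le> x ^ 2" "1 \<le> x" for x
    using that by simp_all
  from this[OF sq x] show "real k ^ 2 / 4 \<le> eigenform_conductor k"
    "eigenform_conductor k \<le> 12 * real k ^ 2"
    by (simp_all add: eq[OF refl])
qed

end

theory Submission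
  imports Defs
begin

text \<open>Put \<open>F z = (Im z)\<^sup>k\<^sup>/\<^sup>2 \<bar>f z\<bar>\<close>, a function invariant under \<open>SL(2,Z)\<close>, and let
  \<open>D(\<delta>) = \<Sum> \<bar>lam n\<bar>\<^sup>2 n\<^sup>-\<^sup>1\<^sup>-\<^sup>\<delta>\<close>. Parseval on horocycles bounds \<open>D(\<delta>)\<close> by \<open>sup F\<^sup>2\<close>, and
  Cauchy--Schwarz at height \<open>Im z \<ge> 1/5\<close> bounds \<open>sup F\<^sup>2\<close> by \<open>D(1)\<close>, both up to powers of \<open>k\<close>. The Hecke
  relations give \<open>D(4\<delta>)\<^sup>2 \<le> C D(\<delta>)\<close> (Iwaniec's device), so that \<open>D(\<delta>) \<le> C k\<^sup>\<epsilon>\<close> without Deligne's theorem.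

  For the twisted sum write \<open>lam n\<close> as a Mellin integral of \<open>f\<close> along the vertical line over \<open>\<alpha>\<close>,
  cut off at height \<open>Y\<close> of order \<open>k / N\<close>; the cutoff is undone by Abel summation and the condition
  \<open>n \<le> N\<close> costs the \<open>L\<^sup>1\<close> norm of a Dirichlet kernel. It remains to bound \<open>F\<close> in \<open>L\<^sup>2\<close> on vertical
  geodesic segments of bounded length. By the mean value property the integral of \<open>F\<^sup>2\<close> over the segment is at
  most \<open>\<surd>k\<close> times its mass on a surrounding tube, because \<open>F\<close> varies on the scale \<open>1/\<surd>k\<close>.
  A Moebius map moves the tube to height at least \<open>1/5\<close>, where Parseval bounds that mass by \<open>D(\<delta>)\<close>.\<close>

subsection \<open>Divisor sums and Hecke multiplicativity\<close>

text \<open>With \<open>s = (k - 1) / 2\<close> the Mellin integrand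
  \<open>y^(s-1) \<bar>f\<bar>\<close> is \<open>F y^(-3/2)\<close>, which a bound for
  \<open>F\<close> in mean controls at infinity but not near 0. This forces the cutoff
  \<open>Y\<close>; it costs \<open>Y^(-1/2)\<close>, of order \<open>sqrt (N / k)\<close>, and
  gives \<open>lam n\<close> an incomplete Gamma weight, comparable to the complete one as long as
  \<open>n Y\<close> is at most a small multiple of \<open>k\<close>.

  Used at a point, the mean value inequality on a square of relative size \<open>1 / sqrt k\<close>
  loses a factor \<open>k\<close> in \<open>F^2\<close>. Along a segment it loses only
  \<open>sqrt k\<close>, because a point of the tube lies in the squares belonging to a short
  stretch of the segment only.

  The exponent of \<open>k\<close> is the sum of 1/4 (the square root of this loss), 3/4 (comparison
  of \<open>sqrt (Gamma k)\<close>, the size of \<open>f\<close> in mean square, with the Mellin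
  weight \<open>Gamma s\<close>) and -1/2 (the cutoff). The total 1/2 is the exponent 1/4 of the
  conductor.\<close>

lemma card_divisors_prime_power_mult:
  fixes p m a :: nat
  assumes "prime p" "m > 0"
  shows "card {d. d dvd p ^ a * m} \<le> Suc a * card {d. d dvd m}"
proof -
  have "{d. d dvd p ^ a * m} \<subseteq> (\<lambda>(i, e). p ^ i * e) ` ({..a} \<times> {d. d dvd m})"
  proof
    fix d assume "d \<in> {d. d dvd p ^ a * m}"
    then obtain b c where bc: "d = b * c" "b dvd p ^ a" "c dvd m"
      using division_decomp[of d "p ^ a" m] by auto
    then obtain i where "i \<le> a" "b = p ^ i"
      using divides_primepow_nat[OF assms(1)] by blast
    with bc show "d \<in> (\<lambda>(i, e). p ^ i * e) ` ({..a} \<times> {d. d dvd m})"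
      by (auto intro!: image_eqI[of _ _ "(i, c)"])
  qed
  then have "card {d. d dvd p ^ a * m} \<le> card ({..a} \<times> {d. d dvd m})"
    using assms by (intro surj_card_le) auto
  then show ?thesis by (simp add: card_cartesian_product)
qed

text \<open>Prime powers are split off one at a time. A prime \<open>p\<close> with
  \<open>p^\<delta> \<ge> 2\<close> costs nothing, since \<open>a + 1 \<le> 2^a\<close>. The
  finitely many smaller primes cost a constant \<open>K\<close> each, which comes from
  \<open>1 + x \<le> exp x\<close> at \<open>x = \<delta> a ln 2\<close>.\<close>

lemma divisor_bound:
  fixes \<delta> :: real
  assumes "\<delta> > 0"
  shows "\<exists>C>0. \<forall>n::nat. n > 0 \<longrightarrow> real (card {d. d dvd n}) \<le> C * real n powr \<delta>"
proof -
  define K where "K = 1 + 1 / (\<delta> * ln 2)"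
  define P where "P = nat \<lceil>2 powr (1 / \<delta>)\<rceil>"
  have K1: "K \<ge> 1" using assms by (simp add: K_def)
  have small: "real (Suc a) \<le> K * real p powr (\<delta> * real a)" if "p \<ge> 2" for a p :: nat
  proof -
    have "1 + \<delta> * real a * ln 2 \<le> exp (\<delta> * real a * ln 2)" by (rule exp_ge_add_one_self)
    also have "\<dots> = 2 powr (\<delta> * real a)" by (simp add: powr_def mult_ac)
    also have "\<dots> \<le> real p powr (\<delta> * real a)" using that assms by (intro powr_mono2) auto
    finally have 1: "1 + \<delta> * real a * ln 2 \<le> real p powr (\<delta> * real a)" .
    have "real (Suc a) \<le> K * (1 + \<delta> * real a * ln 2)"
      using assms by (simp add: K_def field_simps)
    also have "\<dots> \<le> K * real p powr (\<delta> * real a)" using 1 K1 by (intro mult_left_mono) auto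
    finally show ?thesis .
  qed
  have large: "real (Suc a) \<le> real p powr (\<delta> * real a)" if "p \<ge> P" for a p :: nat
  proof -
    have "2 powr (1 / \<delta>) \<le> real p" using that unfolding P_def by linarith
    then have "(2 powr (1 / \<delta>)) powr (\<delta> * real a) \<le> real p powr (\<delta> * real a)"
      using assms by (intro powr_mono2) auto
    then have "2 ^ a \<le> real p powr (\<delta> * real a)"
      using assms by (simp add: powr_powr powr_realpow)
    moreover have "real (Suc a) \<le> 2 ^ a"
      by (metis Suc_leI less_exp of_nat_le_iff of_nat_numeral of_nat_power)
    ultimately show ?thesis by linarith
  qed
  \<comment> \<open>The weight counts the small primes dividing \<open>m\<close>, so that splitting
    off one prime power reproduces it exactly; there are at most \<open>P\<close> such
    primes.\<close>
  let ?w = "\<lambda>m. K ^ card {q \<in> prime_factors m. q < P}"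
  have main: "real (card {d. d dvd n}) \<le> ?w n * real n powr \<delta>"
    if "n > 0" for n :: nat
    using that
  proof (induction n rule: less_induct)
    case (less n)
    show ?case
    proof (cases "n = 1")
      case True
      then show ?thesis by simp
    next
      case False
      then obtain p where p: "prime p" "p dvd n" using prime_factor_nat by blast
      define a where "a = multiplicity p n"
      obtain m where m: "n = p ^ a * m" "\<not> p dvd m"
        using multiplicity_decompose'[of n p] less.prems p(1) unfolding a_def
        by (metis not_prime_unit not_gr_zero)
      have a0: "a > 0" using p less.prems unfolding a_def
        by (simp add: prime_multiplicity_gt_zero_iff)
      have m0: "m > 0" using m less.prems by (auto intro: Nat.gr0I)
      have p2: "p \<ge> 2" using p prime_ge_2_nat by blast
      have "p ^ a > 1" using p2 a0 one_less_power[of p a] by simp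
      then have mn: "m < n" using m m0 by simp
      have pf: "prime_factors n = insert p (prime_factors m)"
        using m m0 p a0 less.prems
        by (auto simp: in_prime_factors_iff prime_dvd_mult_iff prime_dvd_power_iff
              dest: prime_dvd_power primes_dvd_imp_eq simp: primes_dvd_imp_eq)
      have pnot: "p \<notin> prime_factors m" using m by auto
      have IH: "real (card {d. d dvd m}) \<le> ?w m * real m powr \<delta>"
        using less.IH[OF mn m0] .
      have n_eq: "real n powr \<delta> = real p powr (\<delta> * real a) * real m powr \<delta>"
      proof -
        have "real n = real p powr real a * real m" using m p2 by (simp add: powr_realpow)
        then show ?thesis by (simp add: powr_mult powr_powr mult_ac)
      qed
      have "real (card {d. d dvd n}) \<le> real (Suc a) * real (card {d. d dvd m})"
        using card_divisors_prime_power_mult[OF p(1) m0, of a] m(1)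
        by (metis of_nat_le_iff of_nat_mult)
      also have "\<dots> \<le> real (Suc a) * (?w m * real m powr \<delta>)"
        using IH by (intro mult_left_mono) auto
      also have "\<dots> \<le> ?w n * real n powr \<delta>"
      proof (cases "p < P")
        case True
        then have "{q \<in> prime_factors n. q < P} = insert p {q \<in> prime_factors m. q < P}"
          using pf by auto
        then have c: "card {q \<in> prime_factors n. q < P} = Suc (card {q \<in> prime_factors m. q < P})"
          using pnot by simp
        have "real (Suc a) * (?w m * real m powr \<delta>)
            \<le> (K * real p powr (\<delta> * real a)) * (?w m * real m powr \<delta>)"
          using small[OF p2] K1 by (intro mult_right_mono) auto
        also have "\<dots> = ?w n * real n powr \<delta>"
          unfolding c n_eq by simp
        finally show ?thesis .
      next
        case False
        then have "{q \<in> prime_factors n. q < P} = {q \<in> prime_factors m. q < P}"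
          using pf by auto
        then have c: "card {q \<in> prime_factors n. q < P} = card {q \<in> prime_factors m. q < P}"
          by simp
        have "real (Suc a) * (?w m * real m powr \<delta>)
            \<le> real p powr (\<delta> * real a) * (?w m * real m powr \<delta>)"
          using large[of p a] K1 False by (intro mult_right_mono) auto
        also have "\<dots> = ?w n * real n powr \<delta>"
          unfolding c n_eq by simp
        finally show ?thesis .
      qed
      finally show ?thesis .
    qed
  qed
  have "real (card {d. d dvd n}) \<le> K ^ P * real n powr \<delta>" if "n > 0" for n :: nat
  proof -
    have "card {p \<in> prime_factors n. p < P} \<le> card {..<P}" by (intro card_mono) auto
    then have "?w n \<le> K ^ P" using K1 by (intro power_increasing) auto
    then show ?thesis using main[OF that] by (smt (verit) mult_right_mono powr_ge_zero)
  qed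
  then show ?thesis using K1 by (intro exI[of _ "K ^ P"]) auto
qed

text \<open>The Hecke relations of level 1 in the normalization in which the weight \<open>k\<close>
  does not appear, so that consequences of them are automatically uniform in
  \<open>k\<close>.\<close>

definition hecke_multiplicative :: "(nat \<Rightarrow> complex) \<Rightarrow> bool" where
  "hecke_multiplicative lam \<longleftrightarrow>
     (\<forall>m>0. \<forall>n>0. lam m * lam n = (\<Sum>g | g dvd gcd m n. lam (m * n div g\<^sup>2)))"

lemma sum_inverse_squares_le: "(\<Sum>n=1..X. 1 / (real n)\<^sup>2) \<le> 2"
proof -
  have "(\<Sum>n=1..Suc X. 1 / (real n)\<^sup>2) \<le> 2 - 1 / real (Suc X)" for X
  proof (induction X)
    case (Suc X)
    have "1 / (x + 1)\<^sup>2 \<le> 1 / x - 1 / (x + 1)" if "x > 0" for x :: real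
      using that by (simp add: divide_simps power2_eq_square)
    from this[of "real (Suc X)"]
    have "1 / (real (Suc (Suc X)))\<^sup>2 \<le> 1 / real (Suc X) - 1 / real (Suc (Suc X))"
      by (simp add: add_ac)
    then show ?case using Suc by simp
  qed simp
  from this[of "X - 1"] show ?thesis
    by (cases X) (auto intro: order_trans)
qed

lemma hecke_mult_norm_sq:
  assumes "hecke_multiplicative lam" "m > 0" "n > 0"
  shows "(norm (lam m))\<^sup>2 * (norm (lam n))\<^sup>2 \<le>
    real (card {g. g dvd gcd m n}) * (\<Sum>g | g dvd gcd m n. (norm (lam (m * n div g\<^sup>2)))\<^sup>2)"
proof -
  let ?A = "{g. g dvd gcd m n}"
  have "(norm (lam m))\<^sup>2 * (norm (lam n))\<^sup>2 = (norm (\<Sum>g\<in>?A. lam (m * n div g\<^sup>2)))\<^sup>2"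
    using assms unfolding hecke_multiplicative_def
    by (metis norm_mult power_mult_distrib)
  also have "\<dots> \<le> (\<Sum>g\<in>?A. 1 * norm (lam (m * n div g\<^sup>2)))\<^sup>2"
    by (intro power_mono) (auto intro: norm_sum)
  also have "\<dots> \<le> (\<Sum>g\<in>?A. 1\<^sup>2) * (\<Sum>g\<in>?A. (norm (lam (m * n div g\<^sup>2)))\<^sup>2)"
    by (rule Cauchy_Schwarz_ineq_sum)
  finally show ?thesis by simp
qed

text \<open>An \<open>l\<close> has at most as many factorizations \<open>m n\<close> as divisors,
  because \<open>m\<close> determines \<open>n\<close>.\<close>

lemma sum_over_products_le:
  fixes h :: "nat \<Rightarrow> real"
  assumes "\<And>l. h l \<ge> 0"
  shows "(\<Sum>(m, n)\<in>{1..X} \<times> {1..X}. h (m * n)) \<le> (\<Sum>l=1..X\<^sup>2. real (card {d. d dvd l}) * h l)"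
proof -
  let ?S = "{1..X} \<times> {1..X}"
  have "(\<Sum>(m, n)\<in>?S. h (m * n)) = (\<Sum>x\<in>?S. h ((\<lambda>(m, n). m * n) x))"
    by (intro sum.cong) auto
  also have "\<dots> = (\<Sum>l=1..X\<^sup>2. of_nat (card {x \<in> ?S. (\<lambda>(m, n). m * n) x = l}) * h l)"
  proof (rule sum_fun_comp)
    show "(\<lambda>(m, n). m * n) ` ?S \<subseteq> {1..X\<^sup>2}"
      by (auto simp: power2_eq_square intro: mult_le_mono)
  qed auto
  also have "\<dots> \<le> (\<Sum>l=1..X\<^sup>2. real (card {d. d dvd l}) * h l)"
  proof (intro sum_mono mult_right_mono)
    fix l assume l: "l \<in> {1..X\<^sup>2}"
    have "card {x \<in> ?S. (\<lambda>(m, n). m * n) x = l} \<le> card {d. d dvd l}"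
    proof (rule card_inj_on_le[of fst])
      show "inj_on fst {x \<in> ?S. (\<lambda>(m, n). m * n) x = l}"
        by (auto simp: inj_on_def)
      show "finite {d. d dvd l}" using l by auto
    qed auto
    then show "real (card {x \<in> ?S. (\<lambda>(m, n). m * n) x = l}) \<le> real (card {d. d dvd l})"
      by simp
  qed (use assms in auto)
  finally show ?thesis .
qed

text \<open>Multiplying out the square by the Hecke relation turns a sum of length \<open>X\<close> into one of
  length \<open>X\<^sup>2\<close> at the cost of divisor functions only. Iterated, this replaces Deligne's bound.\<close>

lemma hecke_square_bound:
  fixes \<delta> :: real
  assumes "\<delta> > 0"
  shows "\<exists>C>0. \<forall>lam X. hecke_multiplicative lam \<longrightarrow>
    (\<Sum>n=1..X. (norm (lam n))\<^sup>2 * real n powr (-1 - 4 * \<delta>))\<^sup>2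
      \<le> C * (\<Sum>l=1..X\<^sup>2. (norm (lam l))\<^sup>2 * real l powr (-1 - \<delta>))"
proof -
  obtain C where C: "C > 0" "\<And>n::nat. n > 0 \<Longrightarrow> real (card {d. d dvd n}) \<le> C * real n powr \<delta>"
    using divisor_bound[OF assms] by blast
  have "(\<Sum>n=1..X. (norm (lam n))\<^sup>2 * real n powr (-1 - 4 * \<delta>))\<^sup>2
      \<le> 2 * C\<^sup>2 * (\<Sum>l=1..X\<^sup>2. (norm (lam l))\<^sup>2 * real l powr (-1 - \<delta>))"
    if hecke: "hecke_multiplicative lam" for lam X
  proof -
    let ?b = "\<lambda>l. (norm (lam l))\<^sup>2 * real l powr (-1 - \<delta>)"
    define h where "h = (\<lambda>l. (norm (lam l))\<^sup>2 * real l powr (-1 - 3 * \<delta>))"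
    have h0: "h l \<ge> 0" for l by (simp add: h_def)
    let ?S = "{1..X} \<times> {1..X}"
    define T where "T = (SIGMA (m, n):?S. {g. g dvd gcd m n})"
    define \<phi> where "\<phi> = (\<lambda>((m, n), g). C * ((norm (lam (m * n div g\<^sup>2)))\<^sup>2 * real (m * n) powr (-1 - 3 * \<delta>)))"
    let ?\<psi> = "\<lambda>y. case y of (d, m, n) \<Rightarrow> C * (1 / (real d)\<^sup>2 * h (m * n))"
    have finT: "finite T" unfolding T_def by (intro finite_SigmaI) auto
    have "(\<Sum>n=1..X. (norm (lam n))\<^sup>2 * real n powr (-1 - 4 * \<delta>))\<^sup>2
      = (\<Sum>(m, n)\<in>?S. (norm (lam m))\<^sup>2 * (norm (lam n))\<^sup>2 * real (m * n) powr (-1 - 4 * \<delta>))"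
      unfolding power2_eq_square[of "sum _ _"] sum_product sum.cartesian_product
      by (intro sum.cong) (auto simp: powr_mult mult_ac)
    \<comment> \<open>The two exponents in the claim differ by \<open>3 \<delta>\<close>. One
      \<open>\<delta>\<close> pays here for the number of divisors \<open>g\<close>, one pays later
      for the number of factorizations of \<open>l\<close>, and the third is given away.\<close>
    also have "\<dots> \<le> (\<Sum>(m, n)\<in>?S. \<Sum>g | g dvd gcd m n.
        C * ((norm (lam (m * n div g\<^sup>2)))\<^sup>2 * real (m * n) powr (-1 - 3 * \<delta>)))"
    proof (intro sum_mono, clarify)
      fix m n assume mn: "m \<in> {1..X}" "n \<in> {1..X}"
      let ?B = "\<Sum>g | g dvd gcd m n. (norm (lam (m * n div g\<^sup>2)))\<^sup>2"
      have g: "gcd m n > 0" using mn by auto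
      have "gcd m n \<le> m * n" using mn
        by (meson atLeastAtMost_iff dvd_imp_le gcd_dvd1 dvd_mult2 mult_pos_pos less_le_trans zero_less_one)
      then have "real (gcd m n) powr \<delta> \<le> real (m * n) powr \<delta>"
        using assms by (intro powr_mono2) (auto simp del: of_nat_mult)
      then have c: "real (card {g. g dvd gcd m n}) \<le> C * real (m * n) powr \<delta>"
        using C(2)[OF g] C(1) by (smt (verit) mult_left_mono)
      have "(norm (lam m))\<^sup>2 * (norm (lam n))\<^sup>2 * real (m * n) powr (-1 - 4 * \<delta>)
         \<le> ((C * real (m * n) powr \<delta>) * ?B) * real (m * n) powr (-1 - 4 * \<delta>)"
        using hecke_mult_norm_sq[OF hecke, of m n] mn c
        by (intro mult_right_mono order_trans[OF hecke_mult_norm_sq[OF hecke]])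
           (auto intro!: sum_nonneg)
      also have "\<dots> = C * (?B * (real (m * n) powr \<delta> * real (m * n) powr (-1 - 4 * \<delta>)))"
        by (simp add: mult_ac)
      also have "\<dots> = C * (?B * real (m * n) powr (-1 - 3 * \<delta>))"
        by (simp add: algebra_simps flip: powr_add)
      also have "\<dots> = (\<Sum>g | g dvd gcd m n.
        C * ((norm (lam (m * n div g\<^sup>2)))\<^sup>2 * real (m * n) powr (-1 - 3 * \<delta>)))"
        by (simp add: sum_distrib_left sum_distrib_right)
      finally show "(norm (lam m))\<^sup>2 * (norm (lam n))\<^sup>2 * real (m * n) powr (-1 - 4 * \<delta>) \<le> \<dots>" .
    qed
    also have "\<dots> = sum \<phi> T"
      unfolding T_def \<phi>_def by (subst sum.Sigma[symmetric]) (auto simp: case_prod_unfold intro!: sum.cong)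
    also have "\<dots> \<le> sum ?\<psi> ({1..X} \<times> ?S)"
    \<comment> \<open>The substitution \<open>m = g m'\<close>, \<open>n = g n'\<close> turns
      \<open>m n / g^2\<close> into \<open>m' n'\<close>, and the weight at \<open>m n\<close>
      supplies a factor at most \<open>1 / g^2\<close>, so that the sum over \<open>g\<close> is
      bounded.\<close>
    proof (rule sum_le_included[where i = "\<lambda>(d :: nat, m :: nat, n :: nat). ((d * m, d * n), d)"])
      show "finite T" by fact
      show "\<forall>y\<in>{1..X} \<times> ?S. 0 \<le> ?\<psi> y"
        using C(1) h0 by auto
      show "\<forall>x\<in>T. \<exists>y\<in>{1..X} \<times> ?S. (case y of (d, m, n) \<Rightarrow> ((d * m, d * n), d)) = x \<and>
         \<phi> x \<le> ?\<psi> y"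
      proof
        fix x assume "x \<in> T"
        then obtain m n g where x: "x = ((m, n), g)" "m \<in> {1..X}" "n \<in> {1..X}" "g dvd gcd m n"
          by (auto simp: T_def)
        then have "g dvd m" "g dvd n" by auto
        then obtain m' n' where m': "m = g * m'" "n = g * n'" by (auto elim!: dvdE)
        with x have pos: "g > 0" "m' > 0" "n' > 0" by (auto intro: Nat.gr0I)
        have le: "g \<le> X" "m' \<le> X" "n' \<le> X"
          using x m' pos by (auto intro: order_trans[rotated])
        have eq: "m * n div g\<^sup>2 = m' * n'"
          using pos by (simp add: m' power2_eq_square)
        have "real (m * n) powr (-1 - 3 * \<delta>) = (real g)\<^sup>2 powr (-1 - 3 * \<delta>) * real (m' * n') powr (-1 - 3 * \<delta>)"
          by (subst powr_mult[symmetric]) (auto simp: m' power2_eq_square mult_ac)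
        also have "(real g)\<^sup>2 powr (-1 - 3 * \<delta>) \<le> (real g)\<^sup>2 powr (-1)"
          using pos assms by (intro powr_mono) (auto simp: one_le_power)
        also have "(real g)\<^sup>2 powr (-1) = 1 / (real g)\<^sup>2"
          using pos by (simp add: powr_minus_divide)
        finally have "real (m * n) powr (-1 - 3 * \<delta>) \<le> 1 / (real g)\<^sup>2 * real (m' * n') powr (-1 - 3 * \<delta>)"
          by (simp add: mult_right_mono)
        then have "C * ((norm (lam (m' * n')))\<^sup>2 * real (m * n) powr (-1 - 3 * \<delta>))
           \<le> C * ((norm (lam (m' * n')))\<^sup>2 * (1 / (real g)\<^sup>2 * real (m' * n') powr (-1 - 3 * \<delta>)))"
          using C(1) by (intro mult_left_mono) auto
        also have "\<dots> = C * (1 / (real g)\<^sup>2 * h (m' * n'))" by (simp add: h_def)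
        finally show "\<exists>y\<in>{1..X} \<times> ?S. (case y of (d, m, n) \<Rightarrow> ((d * m, d * n), d)) = x \<and>
         \<phi> x \<le> ?\<psi> y"
          using pos le x m' eq unfolding \<phi>_def by (intro bexI[of _ "(g, m', n')"]) auto
      qed
    qed auto
    also have "\<dots> = C * ((\<Sum>d=1..X. 1 / (real d)\<^sup>2) * (\<Sum>(m, n)\<in>?S. h (m * n)))"
      unfolding sum_product sum.cartesian_product
      by (subst sum_distrib_left) (auto intro!: sum.cong simp: case_prod_unfold)
    also have "\<dots> \<le> C * (2 * (\<Sum>l=1..X\<^sup>2. real (card {d. d dvd l}) * h l))"
      using C(1) sum_inverse_squares_le[of X] sum_over_products_le[of h X] h0
      by (intro mult_left_mono mult_mono) (auto intro!: sum_nonneg)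
    also have "(\<Sum>l=1..X\<^sup>2. real (card {d. d dvd l}) * h l)
        \<le> (\<Sum>l=1..X\<^sup>2. C * ?b l)"
    proof (intro sum_mono)
      fix l assume "l \<in> {1..X\<^sup>2}"
      then have l: "l > 0" by auto
      have "real (card {d. d dvd l}) * h l \<le> C * real l powr \<delta> * h l"
        using C(2)[OF l] h0 by (intro mult_right_mono) auto
      also have "\<dots> = C * ((norm (lam l))\<^sup>2 * (real l powr \<delta> * real l powr (-1 - 3 * \<delta>)))"
        by (simp add: h_def)
      also have "\<dots> = C * ((norm (lam l))\<^sup>2 * real l powr (-1 - 2 * \<delta>))"
        by (simp add: algebra_simps flip: powr_add)
      also have "\<dots> \<le> C * ?b l"
        using C(1) assms l by (intro mult_left_mono powr_mono) auto
      finally show "real (card {d. d dvd l}) * h l \<le> \<dots>" .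
    qed
    also have "C * (2 * (\<Sum>l=1..X\<^sup>2. C * ?b l))
       = 2 * C\<^sup>2 * (\<Sum>l=1..X\<^sup>2. ?b l)"
      by (simp add: sum_distrib_left power2_eq_square mult_ac)
    finally show ?thesis using C(1) by simp
  qed
  then show ?thesis using C(1) by (intro exI[of _ "2 * C\<^sup>2"]) auto
qed

subsection \<open>Gamma integrals\<close>

lemma nn_integral_Gamma_scaled:
  fixes s c :: real
  assumes "s > 0" "c > 0"
  shows "(\<integral>\<^sup>+y. ennreal (y powr (s - 1) * exp (- c * y)) * indicator {0..} y \<partial>lborel)
    = ennreal (Gamma s / c powr s)"
proof -
  have "ennreal (Gamma s) = (\<integral>\<^sup>+t. ennreal (indicator {0..} t * t powr (s - 1) / exp t) \<partial>lborel)"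
    by (rule Gamma_conv_nn_integral_real) fact
  also have "\<dots> = ennreal \<bar>c\<bar> * (\<integral>\<^sup>+t. ennreal (indicator {0..} (0 + c * t) * (0 + c * t) powr (s - 1) / exp (0 + c * t)) \<partial>lborel)"
    using assms by (intro nn_integral_real_affine) auto
  also have "\<dots> = ennreal c * (\<integral>\<^sup>+t. ennreal (c powr (s - 1)) * (ennreal (t powr (s - 1) * exp (- c * t)) * indicator {0..} t) \<partial>lborel)"
    using assms
    by (intro arg_cong2[of _ _ _ _ "(*)"] nn_integral_cong)
       (auto simp: indicator_def zero_le_mult_iff powr_mult exp_minus field_simps ennreal_mult[symmetric])
  also have "\<dots> = ennreal (c powr s) * (\<integral>\<^sup>+t. ennreal (t powr (s - 1) * exp (- c * t)) * indicator {0..} t \<partial>lborel)"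
  proof -
    have "c * c powr (s - 1) = c powr s" using assms by (simp add: powr_diff)
    then show ?thesis using assms
      by (subst nn_integral_cmult) (auto simp: mult.assoc[symmetric] ennreal_mult[symmetric])
  qed
  finally have *: "ennreal (Gamma s) = \<dots>" .
  have "ennreal (Gamma s / c powr s) = ennreal (1 / c powr s) * ennreal (Gamma s)"
    using assms by (subst ennreal_mult[symmetric]) (auto intro: Gamma_real_nonneg)
  also have "\<dots> = (\<integral>\<^sup>+t. ennreal (t powr (s - 1) * exp (- c * t)) * indicator {0..} t \<partial>lborel)"
    unfolding * using assms by (simp add: mult.assoc[symmetric] ennreal_mult[symmetric])
  finally show ?thesis by simp
qed

text \<open>Where \<open>y > Y\<close> the factor \<open>y / Y\<close> exceeds \<open>1\<close>, so this tail is at most half the integral.\<close>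

lemma nn_integral_Gamma_bounded_ge:
  fixes s c Y :: real
  assumes "s > 0" "c > 0" "Y > 0" "2 * s \<le> c * Y"
  shows "ennreal (Gamma s / c powr s / 2) \<le>
    (\<integral>\<^sup>+y. ennreal (y powr (s - 1) * exp (- c * y)) * indicator {0..Y} y \<partial>lborel)"
proof -
  let ?g = "\<lambda>s y. ennreal (y powr (s - 1) * exp (- c * y))"
  let ?I = "\<integral>\<^sup>+y. ?g s y * indicator {0..Y} y \<partial>lborel"
  have "ennreal (Gamma s / c powr s) = (\<integral>\<^sup>+y. ?g s y * indicator {0..} y \<partial>lborel)"
    using nn_integral_Gamma_scaled[of s c] assms by simp
  also have "\<dots> \<le> (\<integral>\<^sup>+y. ?g s y * indicator {0..Y} y + ennreal (1 / Y) * (?g (s + 1) y * indicator {0..} y) \<partial>lborel)"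
  proof (rule nn_integral_mono)
    fix y :: real
    have "y powr (s - 1) * exp (- c * y) \<le> (1 / Y) * (y powr s * exp (- c * y))" if "y > Y"
    proof -
      have "y powr s = y * y powr (s - 1)" using that assms by (simp add: powr_diff)
      then show ?thesis using that assms by (simp add: field_simps mult_right_mono)
    qed
    then show "?g s y * indicator {0..} y \<le> ?g s y * indicator {0..Y} y + ennreal (1 / Y) * (?g (s + 1) y * indicator {0..} y)"
      using assms by (auto simp: indicator_def ennreal_mult[symmetric] intro!: ennreal_leI)
  qed
  also have "\<dots> = ?I + ennreal (1 / Y) * ennreal (Gamma (s + 1) / c powr (s + 1))"
    using assms nn_integral_Gamma_scaled[of "s + 1" c]
    by (subst nn_integral_add) (auto simp: nn_integral_cmult)
  also have "\<dots> \<le> ?I + ennreal (Gamma s / c powr s / 2)"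
  proof -
    have "Gamma (s + 1) = s * Gamma s" using assms by (intro Gamma_plus1) auto
    then have "(1 / Y) * (Gamma (s + 1) / c powr (s + 1)) = (s / (c * Y)) * (Gamma s / c powr s)"
      using assms by (simp add: powr_add field_simps)
    also have "\<dots> \<le> (1 / 2) * (Gamma s / c powr s)"
      using assms by (intro mult_right_mono) (auto simp: field_simps intro: Gamma_real_nonneg)
    finally show ?thesis using assms
      by (intro add_left_mono) (auto simp: ennreal_mult[symmetric] Gamma_real_nonneg intro!: ennreal_leI)
  qed
  finally have le: "ennreal (Gamma s / c powr s) \<le> ?I + ennreal (Gamma s / c powr s / 2)" .
  have G: "Gamma s / c powr s / 2 \<ge> 0" using assms by (auto intro: Gamma_real_nonneg)
  have "ennreal (Gamma s / c powr s / 2) = ennreal (Gamma s / c powr s) - ennreal (Gamma s / c powr s / 2)"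
    using G by (subst ennreal_minus) auto
  also have "\<dots> \<le> ?I" using le by (simp add: ennreal_minus_le_iff add.commute)
  finally show ?thesis .
qed

text \<open>Below \<open>a\<close> the factor \<open>exp (6 * pi * (a - u))\<close> exceeds \<open>1\<close>; inserting it bounds the missing
  part by \<open>(exp 1 / 4) powr s\<close> times the whole.\<close>

lemma nn_integral_Gamma_tail_ge:
  fixes s a :: real
  assumes "s \<ge> 1 / 2" "a \<le> s / (6 * pi)" "a \<ge> 0"
  shows "ennreal (Gamma s / (2 * pi) powr s / 10) \<le>
    (\<integral>\<^sup>+u. ennreal (u powr (s - 1) * exp (- (2 * pi) * u)) * indicator {a..} u \<partial>lborel)"
proof -
  let ?g = "\<lambda>c u. ennreal (u powr (s - 1) * exp (- c * u))"
  let ?I = "\<integral>\<^sup>+u. ?g (2 * pi) u * indicator {a..} u \<partial>lborel"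
  define G where "G = Gamma s / (2 * pi) powr s"
  have G: "G \<ge> 0" using assms by (auto simp: G_def intro!: divide_nonneg_nonneg Gamma_real_nonneg)
  have "ennreal G = (\<integral>\<^sup>+u. ?g (2 * pi) u * indicator {0..} u \<partial>lborel)"
    using nn_integral_Gamma_scaled[of s "2 * pi"] assms unfolding G_def by simp
  also have "\<dots> \<le> (\<integral>\<^sup>+u. ?g (2 * pi) u * indicator {a..} u + ennreal (exp (6 * pi * a)) * (?g (8 * pi) u * indicator {0..} u) \<partial>lborel)"
  proof (rule nn_integral_mono)
    fix u :: real
    have "u powr (s - 1) * exp (- (2 * pi) * u) \<le> exp (6 * pi * a) * (u powr (s - 1) * exp (- (8 * pi) * u))" if "u < a"
    proof -
      have "exp (- (2 * pi) * u) = exp (6 * pi * u) * exp (- (8 * pi) * u)"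
        by (simp add: exp_add[symmetric])
      also have "\<dots> \<le> exp (6 * pi * a) * exp (- (8 * pi) * u)" using that by (intro mult_right_mono) auto
      finally have "exp (- (2 * pi) * u) * u powr (s - 1) \<le> \<dots> * u powr (s - 1)"
        by (intro mult_right_mono) auto
      then show ?thesis by (simp add: mult_ac)
    qed
    then show "?g (2 * pi) u * indicator {0..} u \<le> ?g (2 * pi) u * indicator {a..} u + ennreal (exp (6 * pi * a)) * (?g (8 * pi) u * indicator {0..} u)"
      using assms by (auto simp: indicator_def ennreal_mult[symmetric] intro!: ennreal_leI)
  qed
  also have "\<dots> = ?I + ennreal (exp (6 * pi * a)) * ennreal (Gamma s / (8 * pi) powr s)"
    using assms nn_integral_Gamma_scaled[of s "8 * pi"]
    by (subst nn_integral_add) (auto simp: nn_integral_cmult)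
  also have "\<dots> \<le> ?I + ennreal (9 / 10 * G)"
  proof -
    have "exp (6 * pi * a) \<le> exp s" using assms by (simp add: field_simps)
    then have "exp (6 * pi * a) * (Gamma s / (8 * pi) powr s) \<le> exp s * (Gamma s / (8 * pi) powr s)"
      using assms by (intro mult_right_mono) (auto intro!: Gamma_real_nonneg divide_nonneg_nonneg)
    also have "\<dots> = exp s / 4 powr s * G"
    proof -
      have "(8 * pi) powr s = 4 powr s * (2 * pi) powr s" by (subst powr_mult[symmetric]) auto
      then show ?thesis by (simp add: G_def)
    qed
    also have "exp s / 4 powr s = (exp 1 / 4) powr s"
      by (simp add: powr_divide exp_powr_real)
    also have "(exp 1 / 4) powr s \<le> (exp 1 / 4 :: real) powr (1 / 2)"
      using assms exp_le by (intro powr_mono') auto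
    \<comment> \<open>By \<open>exp 1 \<le> 3\<close> the base is at most 3/4. The number 81/100 is
      a rational square above it, and \<open>1 - 9/10\<close> is the tenth in the statement.\<close>
    also have "\<dots> \<le> (81 / 100) powr (1 / 2)"
      using exp_le by (intro powr_mono2) auto
    also have "\<dots> = 9 / 10" by (simp add: powr_half_sqrt real_sqrt_divide)
    finally have "exp (6 * pi * a) * (Gamma s / (8 * pi) powr s) \<le> 9 / 10 * G"
      using G by (simp add: mult_right_mono)
    then show ?thesis using assms
      by (intro add_left_mono) (auto simp: ennreal_mult[symmetric] Gamma_real_nonneg intro!: ennreal_leI)
  qed
  finally have le: "ennreal G \<le> ?I + ennreal (9 / 10 * G)" .
  have "ennreal (G / 10) = ennreal G - ennreal (9 / 10 * G)"
    using G by (subst ennreal_minus) auto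
  also have "\<dots> \<le> ?I" using le by (simp add: ennreal_minus_le_iff add.commute)
  finally show ?thesis by (simp add: G_def)
qed

section \<open>Comparison of Gamma values\<close>

lemma Gamma_plus_le:
  fixes x \<delta> :: real
  assumes "x > 0" "0 \<le> \<delta>" "\<delta> \<le> 1"
  shows "Gamma (x + \<delta>) \<le> x powr \<delta> * Gamma x"
proof -
  have G: "Gamma x > 0" "Gamma (x + 1) > 0" "Gamma (x + \<delta>) > 0"
    using assms by (auto intro!: Gamma_real_pos)
  have "(ln \<circ> Gamma) ((1 - \<delta>) *\<^sub>R x + \<delta> *\<^sub>R (x + 1)) \<le> (1 - \<delta>) * (ln \<circ> Gamma) x + \<delta> * (ln \<circ> Gamma) (x + 1)"
    using assms by (intro convex_onD[OF log_convex_Gamma_real]) auto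
  moreover have "(1 - \<delta>) *\<^sub>R x + \<delta> *\<^sub>R (x + 1) = x + \<delta>" by (simp add: algebra_simps)
  moreover have "ln (Gamma (x + 1)) = ln x + ln (Gamma x)"
    using assms G Gamma_plus1[of x] by (subst Gamma_plus1) (auto simp: ln_mult_pos elim: nonpos_Ints_cases)
  ultimately have "ln (Gamma (x + \<delta>)) \<le> ln (Gamma x) + \<delta> * ln x"
    by (simp add: algebra_simps)
  then have "exp (ln (Gamma (x + \<delta>))) \<le> exp (ln (Gamma x) + \<delta> * ln x)" by simp
  then show ?thesis using G assms by (simp add: exp_add powr_def mult_ac)
qed

lemma Gamma_plus_ge:
  fixes x \<delta> :: real
  assumes "x \<ge> 3 / 2" "0 \<le> \<delta>"
  shows "Gamma x \<le> Gamma (x + \<delta>)"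
  using Gamma_real_strict_mono[of x "x + \<delta>"] assms by (cases "\<delta> = 0") auto

lemma Gamma_legendre_duplication_real:
  fixes x :: real
  assumes "x > 0"
  shows "Gamma x * Gamma (x + 1 / 2) = 2 powr (1 - 2 * x) * sqrt pi * Gamma (2 * x)"
proof -
  have "complex_of_real (Gamma x * Gamma (x + 1 / 2)) = of_real (2 powr (1 - 2 * x) * sqrt pi * Gamma (2 * x))"
  proof -
    have "complex_of_real x \<notin> \<int>\<^sub>\<le>\<^sub>0" "complex_of_real x + 1 / 2 \<notin> \<int>\<^sub>\<le>\<^sub>0"
      using assms by (auto elim!: nonpos_Ints_cases simp: complex_eq_iff)
    from Gamma_legendre_duplication[OF this]
    have "of_real (Gamma x) * of_real (Gamma (x + 1 / 2)) = of_real (exp ((1 - 2 * x) * ln 2)) * of_real (sqrt pi) * complex_of_real (Gamma (2 * x))"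
      by (simp add: Gamma_complex_of_real[symmetric] exp_of_real[symmetric] del: exp_of_real)
    then show ?thesis by (simp add: powr_def)
  qed
  then show ?thesis by (simp only: of_real_eq_iff)
qed

text \<open>The left side is the size of an eigenform in mean square,
  \<open>Gamma ((k - 1) / 2)\<close> the weight of its Mellin transform. Duplication writes
  \<open>Gamma k\<close> as a product of values at \<open>s + 1/2\<close> and \<open>s + 1\<close>;
  moving both down to \<open>s\<close> costs \<open>s^(3/2)\<close>, whence the exponent 3/4. The
  power of 2 later turns \<open>4 pi\<close> into \<open>2 pi\<close>.\<close>

lemma sqrt_Gamma_le:
  fixes k :: real
  assumes "k \<ge> 2"
  shows "sqrt (Gamma k) \<le> 2 powr (k / 2) * k powr (3 / 4) * Gamma ((k - 1) / 2)"
proof -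
  define s where "s = (k - 1) / 2"
  have s: "s \<ge> 1 / 2" using assms by (simp add: s_def)
  have Gs: "Gamma s > 0" using s by (intro Gamma_real_pos) auto
  have "Gamma (s + 1 / 2) * Gamma (s + 1 / 2 + 1 / 2) = 2 powr (1 - 2 * (s + 1 / 2)) * sqrt pi * Gamma (2 * (s + 1 / 2))"
    using s by (intro Gamma_legendre_duplication_real) auto
  also have "s + 1 / 2 + 1 / 2 = s + 1" by simp
  also have "2 * (s + 1 / 2) = k" by (simp add: s_def field_simps)
  finally have d: "Gamma k = 2 powr (k - 1) / sqrt pi * (Gamma (s + 1 / 2) * Gamma (s + 1))"
    by (simp add: powr_diff powr_add powr_minus s_def[symmetric] divide_simps mult_ac)
  have "Gamma (s + 1) = s * Gamma s" using s by (intro Gamma_plus1) auto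
  moreover have "Gamma (s + 1 / 2) \<le> s powr (1 / 2) * Gamma s" using s by (intro Gamma_plus_le) auto
  ultimately have "Gamma k \<le> 2 powr (k - 1) / sqrt pi * ((s powr (1 / 2) * Gamma s) * (s * Gamma s))"
    unfolding d using s Gs by (intro mult_left_mono mult_mono) auto
  also have "\<dots> = 2 powr (k - 1) / sqrt pi * s powr (3 / 2) * (Gamma s)\<^sup>2"
  proof -
    have "s powr (3 / 2) = s powr (1 / 2) * s" using s powr_add[of s "1/2" 1] by simp
    then show ?thesis by (simp add: power2_eq_square)
  qed
  also have "\<dots> \<le> 2 powr k * k powr (3 / 2) * (Gamma s)\<^sup>2"
  proof -
    have "2 powr (k - 1) / sqrt pi \<le> 2 powr k / 1"
      using pi_ge_two by (intro frac_le powr_mono) (auto intro: order_trans[of 1 2])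
    moreover have "s powr (3 / 2) \<le> k powr (3 / 2)" using s by (intro powr_mono2) (auto simp: s_def)
    ultimately show ?thesis by (intro mult_right_mono mult_mono) auto
  qed
  also have "\<dots> = (2 powr (k / 2) * k powr (3 / 4) * Gamma s)\<^sup>2"
    using assms by (simp add: power_mult_distrib powr_powr flip: powr_realpow powr_numeral)
  finally have "sqrt (Gamma k) \<le> \<bar>2 powr (k / 2) * k powr (3 / 4) * Gamma s\<bar>"
    by (metis real_sqrt_abs real_sqrt_le_mono)
  then show ?thesis using Gs by (simp add: s_def)
qed

subsection \<open>Absolutely convergent Fourier series\<close>

lemma has_integral_cis_period:
  fixes m :: int and c :: real
  shows "((\<lambda>x. cis (2 * pi * of_int m * x)) has_integral (if m = 0 then 1 else 0)) {c..c + 1}"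
proof (cases "m = 0")
  case True
  then show ?thesis using has_integral_const_real[of "1 :: complex" c "c + 1"] by simp
next
  case False
  define w where "w = \<i> * of_real (2 * pi * of_int m)"
  have w: "w \<noteq> 0" using False by (simp add: w_def)
  have cis: "cis (2 * pi * of_int m * x) = exp (of_real x * w)" for x
    by (simp add: cis_conv_exp w_def mult_ac)
  have "((\<lambda>x. exp (of_real x * w)) has_integral (exp (of_real (c + 1) * w) / w - exp (of_real c * w) / w)) {c..c + 1}"
    using w by (intro fundamental_theorem_of_calculus has_vector_derivative_real_field)
      (auto intro!: derivative_eq_intros)
  moreover have "exp w = 1"
    by (simp add: w_def exp_eq_1)
  then have "exp (of_real (c + 1) * w) = exp (of_real c * w)"
    by (simp add: distrib_right exp_add)
  ultimately show ?thesis using False by (simp add: cis)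
qed

text \<open>The model is the restriction of a cusp form to a horizontal line, where only nonnegative
  frequencies occur. Absolute convergence makes the series uniform, which justifies all termwise
  integration.\<close>

locale abs_fourier =
  fixes c :: "nat \<Rightarrow> complex" and \<phi> :: "real \<Rightarrow> complex"
  assumes summable: "summable (\<lambda>n. norm (c n))"
    and sums: "\<And>x. (\<lambda>n. c n * cis (2 * pi * real n * x)) sums \<phi> x"
begin

lemma uniform: "uniform_limit A (\<lambda>N x. \<Sum>n<N. c n * cis (2 * pi * real n * x)) \<phi> sequentially"
proof -
  have "uniform_limit A (\<lambda>N x. \<Sum>n<N. c n * cis (2 * pi * real n * x)) (\<lambda>x. \<Sum>n. c n * cis (2 * pi * real n * x)) sequentially"
    by (rule Weierstrass_m_test[OF _ summable]) (simp add: norm_mult)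
  moreover have "(\<Sum>n. c n * cis (2 * pi * real n * x)) = \<phi> x" for x
    using sums by (rule sums_unique[symmetric])
  ultimately show ?thesis by simp
qed

lemma continuous: "continuous_on A \<phi>"
  by (rule uniform_limit_theorem[OF _ uniform]) (auto intro!: always_eventually continuous_intros)

text \<open>The coefficient formula and Parseval are both instances: \<open>h\<close> is a character
  in the first, the conjugate of \<open>\<phi>\<close> in the second.\<close>

lemma integral_termwise:
  assumes h: "continuous_on {a..a + 1} h"
    and I: "\<And>n. ((\<lambda>x. cis (2 * pi * real n * x) * h x) has_integral I n) {a..a + 1}"
  shows "\<exists>J. ((\<lambda>x. \<phi> x * h x) has_integral J) {a..a + 1} \<and> (\<lambda>n. c n * I n) sums J"
proof -
  have "bounded (h ` {a..a + 1})"
    using compact_continuous_image[OF h] by (intro compact_imp_bounded) auto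
  then obtain B where B: "\<And>x. x \<in> {a..a + 1} \<Longrightarrow> norm (h x) \<le> B"
    unfolding bounded_iff by blast
  have "uniform_limit {a..a + 1} (\<lambda>N x. \<Sum>n<N. c n * cis (2 * pi * real n * x) * h x)
      (\<lambda>x. \<Sum>n. c n * cis (2 * pi * real n * x) * h x) sequentially"
  proof (rule Weierstrass_m_test)
    show "norm (c n * cis (2 * pi * real n * x) * h x) \<le> norm (c n) * B" if "x \<in> {a..a + 1}" for n x
      using B[OF that] by (auto simp: norm_mult intro!: mult_left_mono)
    show "summable (\<lambda>n. norm (c n) * B)" by (intro summable_mult2 summable)
  qed
  moreover have "(\<Sum>n. c n * cis (2 * pi * real n * x) * h x) = \<phi> x * h x" for x
    by (intro sums_unique[symmetric] sums_mult2 sums)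
  ultimately have "uniform_limit {a..a + 1} (\<lambda>N x. \<Sum>n<N. c n * cis (2 * pi * real n * x) * h x)
      (\<lambda>x. \<phi> x * h x) sequentially" by simp
  then obtain K J where KJ: "\<And>N. ((\<lambda>x. \<Sum>n<N. c n * cis (2 * pi * real n * x) * h x) has_integral K N) {a..a + 1}"
    "((\<lambda>x. \<phi> x * h x) has_integral J) {a..a + 1}" "K \<longlonglongrightarrow> J"
    by (rule uniform_limit_integral) (auto intro!: continuous_intros h)
  have "K N = (\<Sum>n<N. c n * I n)" for N
  proof -
    have "((\<lambda>x. \<Sum>n<N. c n * (cis (2 * pi * real n * x) * h x)) has_integral (\<Sum>n<N. c n * I n)) {a..a + 1}"
      by (intro has_integral_sum has_integral_mult_right I) auto
    with KJ(1)[of N] show ?thesis by (auto simp: mult.assoc dest: has_integral_unique)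
  qed
  then have "K = (\<lambda>N. \<Sum>n<N. c n * I n)" by auto
  with KJ(2,3) show ?thesis by (auto simp: sums_def)
qed

lemma coefficient:
  "((\<lambda>x. \<phi> x * cis (- (2 * pi * real m * x))) has_integral c m) {a..a + 1}"
proof -
  have "((\<lambda>x. cis (2 * pi * real n * x) * cis (- (2 * pi * real m * x))) has_integral (if n = m then 1 else 0)) {a..a + 1}" for n
    using has_integral_cis_period[of "int n - int m" a] by (simp add: cis_mult algebra_simps)
  moreover have "continuous_on {a..a + 1} (\<lambda>x. cis (- (2 * pi * real m * x)))"
    unfolding cis_conv_exp by (intro continuous_intros)
  ultimately obtain J where J: "((\<lambda>x. \<phi> x * cis (- (2 * pi * real m * x))) has_integral J) {a..a + 1}"
    "(\<lambda>n. c n * (if n = m then 1 else 0)) sums J"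
    using integral_termwise[of a "\<lambda>x. cis (- (2 * pi * real m * x))" "\<lambda>n. if n = m then 1 else 0"]
    by blast
  have "(\<lambda>n. c n * (if n = m then 1 else 0)) = (\<lambda>n. if n = m then c n else 0)" by auto
  with J(2) sums_single[of m c] have "J = c m" by (metis sums_unique2)
  with J(1) show ?thesis by simp
qed

lemma parseval:
  shows "((\<lambda>x. (norm (\<phi> x))\<^sup>2) has_integral (\<Sum>n. (norm (c n))\<^sup>2)) {a..a + 1}"
    and "summable (\<lambda>n. (norm (c n))\<^sup>2)"
proof -
  have "((\<lambda>x. cis (2 * pi * real n * x) * cnj (\<phi> x)) has_integral cnj (c n)) {a..a + 1}" for n
    using has_integral_linear[OF coefficient[of n a] bounded_linear_cnj]
    by (simp add: o_def cis_cnj mult.commute)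
  then obtain J where J: "((\<lambda>x. \<phi> x * cnj (\<phi> x)) has_integral J) {a..a + 1}" "(\<lambda>n. c n * cnj (c n)) sums J"
    using integral_termwise[of a "\<lambda>x. cnj (\<phi> x)" "\<lambda>n. cnj (c n)"]
    by (auto intro!: continuous_intros continuous)
  have 1: "((\<lambda>x. (norm (\<phi> x))\<^sup>2) has_integral Re J) {a..a + 1}"
    using has_integral_linear[OF J(1) bounded_linear_Re] by (simp add: o_def flip: complex_norm_square)
  have 2: "(\<lambda>n. (norm (c n))\<^sup>2) sums Re J"
    using sums_Re[OF J(2)] by (simp flip: complex_norm_square)
  from 1 2 show "((\<lambda>x. (norm (\<phi> x))\<^sup>2) has_integral (\<Sum>n. (norm (c n))\<^sup>2)) {a..a + 1}"
    by (metis sums_unique)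
  from 2 show "summable (\<lambda>n. (norm (c n))\<^sup>2)" by (rule sums_summable)
qed

end

lemma abs_fourier_unique:
  assumes "abs_fourier c \<phi>" "abs_fourier d \<phi>"
  shows "c = d"
  using has_integral_unique[OF abs_fourier.coefficient[OF assms(1), of _ 0] abs_fourier.coefficient[OF assms(2), of _ 0]]
  by auto

section \<open>The Dirichlet kernel and its L1 norm\<close>

definition dirichlet_kernel :: "nat \<Rightarrow> real \<Rightarrow> complex" where
  "dirichlet_kernel M x = (\<Sum>n=1..M. cis (- (2 * pi * real n * x)))"

text \<open>Translation by \<open>\<alpha>\<close> only twists the coefficients, so the coefficient
  formula for the translate gives each term.\<close>

lemma (in abs_fourier) partial_sum:
  "((\<lambda>x. \<phi> (\<alpha> + x) * dirichlet_kernel M x) has_integral (\<Sum>n=1..M. c n * cis (2 * pi * real n * \<alpha>))) {a..a + 1}"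
proof -
  interpret shift: abs_fourier "\<lambda>n. c n * cis (2 * pi * real n * \<alpha>)" "\<lambda>x. \<phi> (\<alpha> + x)"
  proof
    show "summable (\<lambda>n. norm (c n * cis (2 * pi * real n * \<alpha>)))"
      using summable by (simp add: norm_mult)
    show "(\<lambda>n. c n * cis (2 * pi * real n * \<alpha>) * cis (2 * pi * real n * x)) sums \<phi> (\<alpha> + x)" for x
      using sums[of "\<alpha> + x"] by (simp add: mult.assoc cis_mult distrib_left)
  qed
  show ?thesis unfolding dirichlet_kernel_def sum_distrib_left
    by (intro has_integral_sum shift.coefficient) auto
qed

text \<open>Taylor's formula gives \<open>\<bar>sin t - t\<bar> \<le> \<bar>t\<bar>^3 / 6\<close>,
  and \<open>\<bar>t\<bar> \<le> 2\<close> makes this at most \<open>2 \<bar>t\<bar> / 3\<close>.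
  Any positive constant in place of 1/3 would serve.\<close>

lemma abs_sin_ge:
  fixes t :: real
  assumes "\<bar>t\<bar> \<le> pi / 2"
  shows "\<bar>t\<bar> / 3 \<le> \<bar>sin t\<bar>"
proof -
  have "\<bar>sin t - (\<Sum>m<3. sin_coeff m * t ^ m)\<bar> \<le> inverse (fact 3) * \<bar>t\<bar> ^ 3"
    by (rule Maclaurin_sin_bound)
  also have "(\<Sum>m<3. sin_coeff m * t ^ m) = t" by (simp add: eval_nat_numeral sin_coeff_def)
  finally have "\<bar>sin t - t\<bar> \<le> \<bar>t\<bar> ^ 3 / 6" by (simp add: fact_numeral)
  then have "\<bar>t\<bar> - \<bar>sin t\<bar> \<le> \<bar>t\<bar> ^ 3 / 6" by linarith
  moreover have "\<bar>t\<bar> ^ 3 \<le> 4 * \<bar>t\<bar>"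
  proof -
    have "\<bar>t\<bar> \<le> 2" using assms pi_half_less_two by linarith
    then have "\<bar>t\<bar> ^ 2 \<le> 2 ^ 2" by (intro power_mono) auto
    then have "\<bar>t\<bar> ^ 2 * \<bar>t\<bar> \<le> 2 ^ 2 * \<bar>t\<bar>" by (intro mult_right_mono) auto
    then show ?thesis by (simp add: eval_nat_numeral)
  qed
  ultimately show ?thesis by linarith
qed

lemma norm_dirichlet_kernel_le1: "norm (dirichlet_kernel M x) \<le> real M"
proof -
  have "norm (dirichlet_kernel M x) \<le> (\<Sum>n=1..M. norm (cis (- (2 * pi * real n * x))))"
    unfolding dirichlet_kernel_def by (rule norm_sum)
  then show ?thesis by simp
qed

lemma norm_dirichlet_kernel_le2:
  assumes "x \<noteq> 0" "\<bar>x\<bar> \<le> 1 / 2"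
  shows "norm (dirichlet_kernel M x) \<le> 3 / (2 * \<bar>x\<bar>)"
proof -
  define w where "w = cis (- (2 * pi * x))"
  have "(norm (1 - w))\<^sup>2 = (1 - cos (2 * (pi * x)))\<^sup>2 + (sin (2 * (pi * x)))\<^sup>2"
    by (simp add: w_def cmod_power2 mult_ac)
  also have "\<dots> = (2 * sin (pi * x))\<^sup>2"
    using sin_cos_squared_add[of "pi * x"] unfolding cos_double_sin sin_double by algebra
  finally have "norm (1 - w) = \<bar>2 * sin (pi * x)\<bar>"
    by (metis norm_ge_zero power2_abs power2_eq_iff_nonneg abs_ge_zero)
  moreover have "\<bar>pi * x\<bar> / 3 \<le> \<bar>sin (pi * x)\<bar>"
    using assms by (intro abs_sin_ge) (auto simp: abs_mult)
  moreover have "2 * \<bar>x\<bar> \<le> \<bar>pi * x\<bar>" using pi_ge_two by (auto simp: abs_mult intro!: mult_right_mono)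
  ultimately have w1: "norm (1 - w) \<ge> 4 * \<bar>x\<bar> / 3" by linarith
  then have "w \<noteq> 1" using assms by auto
  have "dirichlet_kernel M x = (\<Sum>n=1..M. w ^ n)"
    unfolding dirichlet_kernel_def w_def by (intro sum.cong) (auto simp: Complex.DeMoivre mult_ac)
  also have "\<dots> = w * (\<Sum>n<M. w ^ n)"
    by (simp add: sum_distrib_left sum.atLeast_Suc_atMost_Suc_shift atLeast0LessThan flip: sum.atLeast_Suc_lessThan_Suc_shift power_Suc lessThan_atLeast0)
       (metis One_nat_def atLeastLessThanSuc_atLeastAtMost lessThan_atLeast0 sum.shift_bounds_Suc_ivl)
  also have "\<dots> = w * ((1 - w ^ M) / (1 - w))" using \<open>w \<noteq> 1\<close> by (simp add: sum_gp_strict)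
  finally have "norm (dirichlet_kernel M x) = norm (1 - w ^ M) / norm (1 - w)"
    by (simp add: norm_mult norm_divide w_def)
  also have "\<dots> \<le> 2 / (4 * \<bar>x\<bar> / 3)"
  proof (rule frac_le)
    show "norm (1 - w ^ M) \<le> 2"
      using norm_triangle_ineq4[of 1 "w ^ M"] by (simp add: norm_power w_def)
  qed (use assms w1 in auto)
  finally show ?thesis by (simp add: field_simps)
qed

text \<open>The geometric mean of the bounds \<open>M\<close> and
  \<open>3 / (2 \<bar>x\<bar>)\<close> with exponents \<open>\<delta>\<close> and
  \<open>1 - \<delta>\<close> has the integrable singularity
  \<open>\<bar>x\<bar>^(\<delta>-1)\<close>. The interval need not be split at \<open>1 / M\<close>,
  at the price of \<open>M^\<delta>\<close> in place of a logarithm.\<close>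

lemma nn_integral_dirichlet_kernel_le:
  fixes \<delta> :: real
  assumes "0 < \<delta>" "\<delta> < 1"
  shows "(\<integral>\<^sup>+x. ennreal (norm (dirichlet_kernel M x)) * indicator {-(1/2)..1/2} x \<partial>lborel)
    \<le> ennreal (4 / \<delta> * real M powr \<delta>)"
proof -
  define h where "h = (\<lambda>x :: real. ennreal (x powr (\<delta> - 1)) * indicator {0..1/2} x)"
  have h_meas [measurable]: "h \<in> borel_measurable borel" unfolding h_def by measurable
  have "((\<lambda>x. x powr (\<delta> - 1)) has_integral ((1/2) powr (\<delta> - 1 + 1) / (\<delta> - 1 + 1))) {0..1/2}"
    using assms by (intro has_integral_powr_from_0) auto
  then have h_int: "(\<integral>\<^sup>+x. h x \<partial>lborel) = ennreal ((1/2) powr \<delta> / \<delta>)"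
    unfolding h_def by (subst nn_integral_has_integral_lebesgue') auto
  have h_int': "(\<integral>\<^sup>+x. h (- x) \<partial>lborel) = ennreal ((1/2) powr \<delta> / \<delta>)"
    using nn_integral_real_affine[of h "-1" 0] h_int by simp
  have bound: "norm (dirichlet_kernel M x) \<le> 2 * real M powr \<delta> * \<bar>x\<bar> powr (\<delta> - 1)" if "\<bar>x\<bar> \<le> 1/2" "x \<noteq> 0" for x
  proof -
    let ?D = "norm (dirichlet_kernel M x)"
    show ?thesis
    proof (cases "?D = 0")
      case False
      then have pos: "?D > 0" by simp
      have "?D = ?D powr \<delta> * ?D powr (1 - \<delta>)" using pos by (simp flip: powr_add)
      also have "\<dots> \<le> real M powr \<delta> * (3 / (2 * \<bar>x\<bar>)) powr (1 - \<delta>)"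
        using assms that by (intro mult_mono powr_mono2 norm_dirichlet_kernel_le1 norm_dirichlet_kernel_le2) auto
      also have "(3 / (2 * \<bar>x\<bar>)) powr (1 - \<delta>) = (3 / 2) powr (1 - \<delta>) * \<bar>x\<bar> powr (\<delta> - 1)"
      proof -
        have "(3 / (2 * \<bar>x\<bar>)) powr (1 - \<delta>) = ((3 / 2) * (1 / \<bar>x\<bar>)) powr (1 - \<delta>)" by simp
        also have "\<dots> = (3 / 2) powr (1 - \<delta>) * (1 / \<bar>x\<bar>) powr (1 - \<delta>)" by (rule powr_mult)
        also have "(1 / \<bar>x\<bar>) powr (1 - \<delta>) = \<bar>x\<bar> powr (\<delta> - 1)"
          using that by (simp add: powr_divide powr_minus_divide[symmetric])
        finally show ?thesis .
      qed
      also have "(3 / 2 :: real) powr (1 - \<delta>) \<le> 2"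
        using assms powr_mono[of "1 - \<delta>" 1 "3/2 :: real"] by simp
      finally show ?thesis by (simp add: mult_left_mono mult_right_mono mult_ac)
    qed simp
  qed
  have "(\<integral>\<^sup>+x. ennreal (norm (dirichlet_kernel M x)) * indicator {-(1/2)..1/2} x \<partial>lborel)
    \<le> (\<integral>\<^sup>+x. ennreal (2 * real M powr \<delta>) * (h x + h (- x)) \<partial>lborel)"
  proof (rule nn_integral_mono_AE)
    have "AE x in lborel. x \<noteq> (0 :: real)" by (rule AE_lborel_singleton)
    then show "AE x in lborel. ennreal (norm (dirichlet_kernel M x)) * indicator {-(1/2)..1/2} x
       \<le> ennreal (2 * real M powr \<delta>) * (h x + h (- x))"
    proof eventually_elim
      case (elim x)
      then show ?case using bound[of x]
        by (cases "x > 0") (auto simp: h_def indicator_def ennreal_mult[symmetric] intro!: ennreal_leI)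
    qed
  qed
  also have "\<dots> = ennreal (2 * real M powr \<delta>) * (ennreal ((1/2) powr \<delta> / \<delta>) + ennreal ((1/2) powr \<delta> / \<delta>))"
    using h_int h_int' by (simp add: nn_integral_cmult nn_integral_add)
  also have "\<dots> = ennreal (2 * real M powr \<delta> * (2 * ((1/2) powr \<delta> / \<delta>)))"
    using assms by (simp add: ennreal_mult[symmetric] ennreal_plus[symmetric] del: ennreal_plus)
  also have "\<dots> \<le> ennreal (4 / \<delta> * real M powr \<delta>)"
  proof (rule ennreal_leI)
    have "(1/2 :: real) powr \<delta> \<le> 1" using assms by (simp add: powr_le1)
    then have "2 * real M powr \<delta> * (2 * ((1/2) powr \<delta> / \<delta>)) \<le> 2 * real M powr \<delta> * (2 * (1 / \<delta>))"
      using assms by (intro mult_left_mono divide_right_mono) auto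
    then show "2 * real M powr \<delta> * (2 * ((1/2) powr \<delta> / \<delta>)) \<le> 4 / \<delta> * real M powr \<delta>" by (simp add: field_simps)
  qed
  finally show ?thesis .
qed

subsection \<open>A mean value inequality on squares\<close>

lemma borel_measurable_Complex [measurable (raw)]:
  assumes [measurable]: "f \<in> borel_measurable M" "g \<in> borel_measurable M"
  shows "(\<lambda>x. Complex (f x) (g x)) \<in> borel_measurable M"
  unfolding Complex_eq by measurable

lemma continuous_Complex:
  assumes "continuous_on A f" "continuous_on A g"
  shows "continuous_on A (\<lambda>x. Complex (f x) (g x))"
  unfolding Complex_eq using assms by (intro continuous_intros)

lemma ennreal_norm_integral_le:
  fixes f :: "real \<Rightarrow> complex"
  assumes "continuous_on {a..b} f"
  shows "ennreal (norm (integral {a..b} f)) \<le> (\<integral>\<^sup>+x. ennreal (norm (f x)) * indicator {a..b} x \<partial>lborel)"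
proof -
  have i: "(\<lambda>x. norm (f x)) integrable_on {a..b}" "f integrable_on {a..b}"
    using assms by (auto intro!: integrable_continuous_interval continuous_intros)
  then have "norm (integral {a..b} f) \<le> integral {a..b} (\<lambda>x. norm (f x))"
    by (intro integral_norm_bound_integral) auto
  moreover have "(\<integral>\<^sup>+x. ennreal (norm (f x)) * indicator {a..b} x \<partial>lborel) = ennreal (integral {a..b} (\<lambda>x. norm (f x)))"
    using i by (intro nn_integral_has_integral_lebesgue') (auto intro: integrable_integral)
  ultimately show ?thesis by (simp add: ennreal_leI)
qed

lemma contour_integral_linepath_same_Im:
  assumes "Im z = c" "Im z' = c" "Re z = a" "Re z' = b" "a < b"
  shows "contour_integral (linepath z z') f = integral {a..b} (\<lambda>x. f (Complex x c))"
proof -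
  \<comment> \<open>Rotation by \<open>\<i>\<close> reduces the claim to vertical segments.\<close>
  have "\<i> * contour_integral (linepath z z') f = contour_integral (linepath (\<i> * z) (\<i> * z')) (\<lambda>w. f (w / \<i>))"
  proof -
    have "linepath (\<i> * z) (\<i> * z') x / \<i> = linepath z z' x" for x
      by (simp add: linepath_def scaleR_conv_of_real field_simps)
    moreover have "contour_integral (linepath a b) h = (b - a) * integral {0..1} (\<lambda>x. h (linepath a b x))" for a b h
      by (simp add: contour_integral_integral)
    ultimately show ?thesis by (simp add: right_diff_distrib mult.assoc left_diff_distrib)
  qed
  also have "\<dots> = \<i> * integral {a..b} (\<lambda>x. f (Complex (- c) x / \<i>))"
    using assms by (intro contour_integral_linepath_same_Re) auto
  also have "(\<lambda>x. f (Complex (- c) x / \<i>)) = (\<lambda>x. f (Complex x c))"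
    by (intro ext arg_cong[of _ _ f]) (auto simp: complex_eq_iff)
  finally show ?thesis by simp
qed

text \<open>Squares instead of circles: when the four side integrals are averaged over
  \<open>t\<close>, only translations of the line and Tonelli's theorem are involved, and no polar
  coordinates.\<close>

lemma Cauchy_square_sides:
  fixes g :: "complex \<Rightarrow> complex"
  assumes g: "g holomorphic_on cbox (Complex (x - r) (y - r)) (Complex (x + r) (y + r))"
    and t: "0 < t" "t \<le> r"
  shows "2 * pi * \<i> * g (Complex x y) =
      integral {x - t..x + t} (\<lambda>u. g (Complex u (y - t)) / (Complex u (y - t) - Complex x y))
    + \<i> * integral {y - t..y + t} (\<lambda>v. g (Complex (x + t) v) / (Complex (x + t) v - Complex x y))
    - integral {x - t..x + t} (\<lambda>u. g (Complex u (y + t)) / (Complex u (y + t) - Complex x y))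
    - \<i> * integral {y - t..y + t} (\<lambda>v. g (Complex (x - t) v) / (Complex (x - t) v - Complex x y))"
proof -
  let ?S = "cbox (Complex (x - r) (y - r)) (Complex (x + r) (y + r))"
  let ?z = "Complex x y"
  define h where "h = (\<lambda>w. g w / (w - ?z))"
  let ?a1 = "Complex (x - t) (y - t)" and ?a2 = "Complex (x + t) (y - t)"
  let ?a3 = "Complex (x + t) (y + t)" and ?a4 = "Complex (x - t) (y + t)"
  have sub: "path_image (rectpath ?a1 ?a3) \<subseteq> ?S - {?z}"
    using t by (subst path_image_rectpath) (auto simp: in_cbox_complex_iff)
  have "(h has_contour_integral (2 * pi * \<i> * winding_number (rectpath ?a1 ?a3) ?z * g ?z)) (rectpath ?a1 ?a3)"
    unfolding h_def using t sub g
    by (intro Cauchy_integral_formula_convex_simple) (auto simp: interior_cbox in_box_complex_iff convex_box)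
  then have h1: "(h has_contour_integral (2 * pi * \<i> * g ?z)) (rectpath ?a1 ?a3)"
    using t by (subst (asm) winding_number_rectpath) (auto simp: in_box_complex_iff)
  have cont: "continuous_on (?S - {?z}) h"
    unfolding h_def using holomorphic_on_imp_continuous_on[OF g]
    by (auto intro!: continuous_intros elim: continuous_on_subset)
  have seg: "closed_segment ?a1 ?a2 \<subseteq> ?S - {?z}" "closed_segment ?a2 ?a3 \<subseteq> ?S - {?z}"
     "closed_segment ?a3 ?a4 \<subseteq> ?S - {?z}" "closed_segment ?a4 ?a1 \<subseteq> ?S - {?z}"
    using sub by (auto simp: rectpath_def Let_def path_image_join)
  note ci = contour_integrable_continuous_linepath[OF continuous_on_subset[OF cont]]
  have "2 * pi * \<i> * g ?z = contour_integral (rectpath ?a1 ?a3) h"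
    using h1 by (simp add: contour_integral_unique)
  also have "\<dots> = contour_integral (linepath ?a1 ?a2) h + (contour_integral (linepath ?a2 ?a3) h
      + (contour_integral (linepath ?a3 ?a4) h + contour_integral (linepath ?a4 ?a1) h))"
    unfolding rectpath_def Let_def complex.sel using seg
    by (intro contour_integral_join[THEN trans] arg_cong2[of _ _ _ _ "(+)"] refl valid_path_join contour_integrable_joinI ci) auto
  also have "contour_integral (linepath ?a3 ?a4) h = - contour_integral (linepath ?a4 ?a3) h"
    by (intro contour_integral_reverse_linepath continuous_on_subset[OF cont] seg)
  also have "contour_integral (linepath ?a4 ?a1) h = - contour_integral (linepath ?a1 ?a4) h"
    by (intro contour_integral_reverse_linepath continuous_on_subset[OF cont] seg)
  also have "contour_integral (linepath ?a1 ?a2) h = integral {x - t..x + t} (\<lambda>u. h (Complex u (y - t)))"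
    using t by (intro contour_integral_linepath_same_Im) auto
  also have "contour_integral (linepath ?a4 ?a3) h = integral {x - t..x + t} (\<lambda>u. h (Complex u (y + t)))"
    using t by (intro contour_integral_linepath_same_Im) auto
  also have "contour_integral (linepath ?a2 ?a3) h = \<i> * integral {y - t..y + t} (\<lambda>v. h (Complex (x + t) v))"
    using t by (intro contour_integral_linepath_same_Re) auto
  also have "contour_integral (linepath ?a1 ?a4) h = \<i> * integral {y - t..y + t} (\<lambda>v. h (Complex (x - t) v))"
    using t by (intro contour_integral_linepath_same_Re) auto
  finally show ?thesis by (simp add: h_def)
qed

lemma nn_integral_translate_le:
  fixes H :: "real \<Rightarrow> ennreal"
  assumes [measurable]: "H \<in> borel_measurable borel" and "c = 1 \<or> c = -1"
  shows "(\<integral>\<^sup>+t. H (b + c * t) * indicator A t \<partial>lborel) \<le> (\<integral>\<^sup>+v. H v \<partial>lborel)"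
proof -
  have "(\<integral>\<^sup>+t. H (b + c * t) * indicator A t \<partial>lborel) \<le> (\<integral>\<^sup>+t. H (b + c * t) \<partial>lborel)"
    by (intro nn_integral_mono) (auto simp: indicator_def)
  also have "\<dots> = (\<integral>\<^sup>+v. H v \<partial>lborel)"
    using assms(2) by (subst nn_integral_real_affine[of H c b]) auto
  finally show ?thesis .
qed

text \<open>Cauchy's formula on the boundaries of concentric squares, averaged over their size.\<close>

lemma square_mean_value:
  fixes g :: "complex \<Rightarrow> complex"
  assumes g: "g holomorphic_on cbox (Complex (x - r) (y - r)) (Complex (x + r) (y + r))"
    and r: "r > 0"
  shows "ennreal (r\<^sup>2 * norm (g (Complex x y))) \<le>
    4 * (\<integral>\<^sup>+v. \<integral>\<^sup>+u. ennreal (norm (g (Complex u v))) * indicator {x - r..x + r} u * indicator {y - r..y + r} v \<partial>lborel \<partial>lborel)"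
proof -
  let ?S = "cbox (Complex (x - r) (y - r)) (Complex (x + r) (y + r))"
  define k where "k = (\<lambda>w. ennreal (indicat_real ?S w *\<^sub>R norm (g w)))"
  have contg: "continuous_on ?S g" by (rule holomorphic_on_imp_continuous_on[OF g])
  have "(\<lambda>w. indicat_real ?S w *\<^sub>R norm (g w)) \<in> borel_measurable borel"
    by (intro borel_measurable_continuous_on_indicator continuous_intros contg) auto
  then have k_meas [measurable]: "k \<in> borel_measurable borel" unfolding k_def by measurable
  have k_eq: "k (Complex u v) = ennreal (norm (g (Complex u v))) * indicator {x - r..x + r} u * indicator {y - r..y + r} v" for u v
    by (auto simp: k_def indicator_def in_cbox_complex_iff)
  define H where "H = (\<lambda>v. \<integral>\<^sup>+u. k (Complex u v) \<partial>lborel)"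
  define V where "V = (\<lambda>u. \<integral>\<^sup>+v. k (Complex u v) \<partial>lborel)"
  have [measurable]: "H \<in> borel_measurable borel" "V \<in> borel_measurable borel"
    unfolding H_def V_def by measurable
  define A where "A = (\<integral>\<^sup>+v. H v \<partial>lborel)"
  have VA: "(\<integral>\<^sup>+u. V u \<partial>lborel) = A"
    unfolding A_def H_def V_def by (rule lborel_pair.Fubini') measurable
  let ?z = "Complex x y"
  have side: "ennreal (norm (g w / (w - ?z))) \<le> ennreal (2 / r) * k w" if "w \<in> ?S" "norm (w - ?z) \<ge> r / 2" for w
  proof -
    have "norm (g w) / norm (w - ?z) \<le> norm (g w) / (r / 2)"
      using r that by (intro divide_left_mono) (auto intro!: mult_pos_pos)
    then show ?thesis using that r by (auto simp: k_def norm_divide ennreal_mult[symmetric] mult.commute intro!: ennreal_leI)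
  qed
  have cont: "continuous_on {a..b} (\<lambda>u. g (p u) / (p u - ?z))"
    if "continuous_on {a..b} p" "p ` {a..b} \<subseteq> ?S - {?z}" for a b :: real and p
    using that by (intro continuous_intros continuous_on_compose2[OF contg]) auto
  let ?q = "\<lambda>w. g w / (w - ?z)"
  have hor: "ennreal (norm (integral {x - t..x + t} (\<lambda>u. ?q (Complex u (y + s))))) \<le> ennreal (2 / r) * H (y + s)"
    if t: "r / 2 \<le> t" "t \<le> r" and s: "\<bar>s\<bar> = t" for t s
  proof -
    have "ennreal (norm (integral {x - t..x + t} (\<lambda>u. ?q (Complex u (y + s)))))
      \<le> (\<integral>\<^sup>+u. ennreal (norm (?q (Complex u (y + s)))) * indicator {x - t..x + t} u \<partial>lborel)"
      using t r s by (intro ennreal_norm_integral_le cont)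
        (auto simp: in_cbox_complex_iff intro!: continuous_Complex continuous_intros)
    also have "\<dots> \<le> (\<integral>\<^sup>+u. ennreal (2 / r) * k (Complex u (y + s)) \<partial>lborel)"
    proof (rule nn_integral_mono)
      fix u
      have "norm (Complex u (y + s) - ?z) \<ge> r / 2"
        using abs_Im_le_cmod[of "Complex u (y + s) - ?z"] t s by simp
      moreover have "Complex u (y + s) \<in> ?S" if "u \<in> {x - t..x + t}"
        using that t s by (auto simp: in_cbox_complex_iff)
      ultimately show "ennreal (norm (?q (Complex u (y + s)))) * indicator {x - t..x + t} u
          \<le> ennreal (2 / r) * k (Complex u (y + s))"
        using side[of "Complex u (y + s)"] by (auto simp: indicator_def)
    qed
    also have "\<dots> = ennreal (2 / r) * H (y + s)" unfolding H_def by (rule nn_integral_cmult) measurable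
    finally show ?thesis .
  qed
  have ver: "ennreal (norm (integral {y - t..y + t} (\<lambda>v. ?q (Complex (x + s) v)))) \<le> ennreal (2 / r) * V (x + s)"
    if t: "r / 2 \<le> t" "t \<le> r" and s: "\<bar>s\<bar> = t" for t s
  proof -
    have "ennreal (norm (integral {y - t..y + t} (\<lambda>v. ?q (Complex (x + s) v))))
      \<le> (\<integral>\<^sup>+v. ennreal (norm (?q (Complex (x + s) v))) * indicator {y - t..y + t} v \<partial>lborel)"
      using t r s by (intro ennreal_norm_integral_le cont)
        (auto simp: in_cbox_complex_iff intro!: continuous_Complex continuous_intros)
    also have "\<dots> \<le> (\<integral>\<^sup>+v. ennreal (2 / r) * k (Complex (x + s) v) \<partial>lborel)"
    proof (rule nn_integral_mono)
      fix v
      have "norm (Complex (x + s) v - ?z) \<ge> r / 2"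
        using abs_Re_le_cmod[of "Complex (x + s) v - ?z"] t s by simp
      moreover have "Complex (x + s) v \<in> ?S" if "v \<in> {y - t..y + t}"
        using that t s by (auto simp: in_cbox_complex_iff)
      ultimately show "ennreal (norm (?q (Complex (x + s) v))) * indicator {y - t..y + t} v
          \<le> ennreal (2 / r) * k (Complex (x + s) v)"
        using side[of "Complex (x + s) v"] by (auto simp: indicator_def)
    qed
    also have "\<dots> = ennreal (2 / r) * V (x + s)" unfolding V_def by (rule nn_integral_cmult) measurable
    finally show ?thesis .
  qed
  have pt: "ennreal (2 * pi * norm (g ?z)) \<le> ennreal (2 / r) * (H (y + (-1) * t) + V (x + 1 * t) + H (y + 1 * t) + V (x + (-1) * t))"
    if t: "r / 2 \<le> t" "t \<le> r" for t
  proof -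
    let ?h1 = "integral {x - t..x + t} (\<lambda>u. g (Complex u (y - t)) / (Complex u (y - t) - ?z))"
    let ?v1 = "integral {y - t..y + t} (\<lambda>v. g (Complex (x + t) v) / (Complex (x + t) v - ?z))"
    let ?h2 = "integral {x - t..x + t} (\<lambda>u. g (Complex u (y + t)) / (Complex u (y + t) - ?z))"
    let ?v2 = "integral {y - t..y + t} (\<lambda>v. g (Complex (x - t) v) / (Complex (x - t) v - ?z))"
    have "2 * pi * norm (g ?z) = norm (2 * pi * \<i> * g ?z)" by (simp add: norm_mult)
    also have "\<dots> = norm (?h1 + \<i> * ?v1 - ?h2 - \<i> * ?v2)"
      using t r by (subst Cauchy_square_sides[OF g, of t]) auto
    also have "\<dots> \<le> norm ?h1 + norm (\<i> * ?v1) + norm ?h2 + norm (\<i> * ?v2)"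
      by (intro order_trans[OF norm_triangle_ineq4] add_mono order_trans[OF norm_triangle_ineq] order_refl)
    also have "\<dots> = norm ?h1 + norm ?v1 + norm ?h2 + norm ?v2" by (simp add: norm_mult)
    finally have "ennreal (2 * pi * norm (g ?z)) \<le> ennreal (norm ?h1) + ennreal (norm ?v1) + ennreal (norm ?h2) + ennreal (norm ?v2)"
      by (simp add: ennreal_plus[symmetric] ennreal_leI del: ennreal_plus)
    also have "\<dots> \<le> ennreal (2 / r) * H (y + - t) + ennreal (2 / r) * V (x + t) + ennreal (2 / r) * H (y + t) + ennreal (2 / r) * V (x + - t)"
      using hor[of t "-t"] ver[of t t] hor[of t t] ver[of t "-t"] t r by (intro add_mono) auto
    finally show ?thesis by (simp add: distrib_left)
  qed
  \<comment> \<open>For \<open>t\<close> between \<open>r / 2\<close> and \<open>r\<close> the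
    Cauchy kernel is at most \<open>2 / r\<close> on the sides. As \<open>t\<close> varies each side
    sweeps out a part of the large square, so each of the four integrals is at most the full mass
    \<open>A\<close>.\<close>
  have "ennreal (r / 2) * ennreal (2 * pi * norm (g ?z)) = (\<integral>\<^sup>+t. ennreal (2 * pi * norm (g ?z)) * indicator {r/2..r} t \<partial>lborel)"
    using r by (subst nn_integral_cmult_indicator) (auto simp: mult.commute)
  also have "\<dots> \<le> (\<integral>\<^sup>+t. ennreal (2 / r) * (H (y + (-1) * t) * indicator {r/2..r} t + V (x + 1 * t) * indicator {r/2..r} t
      + H (y + 1 * t) * indicator {r/2..r} t + V (x + (-1) * t) * indicator {r/2..r} t) \<partial>lborel)"
    using pt by (intro nn_integral_mono) (auto simp: indicator_def)
  also have "\<dots> = ennreal (2 / r) * ((\<integral>\<^sup>+t. H (y + (-1) * t) * indicator {r/2..r} t \<partial>lborel) + (\<integral>\<^sup>+t. V (x + 1 * t) * indicator {r/2..r} t \<partial>lborel)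
      + (\<integral>\<^sup>+t. H (y + 1 * t) * indicator {r/2..r} t \<partial>lborel) + (\<integral>\<^sup>+t. V (x + (-1) * t) * indicator {r/2..r} t \<partial>lborel))"
    by (subst nn_integral_cmult, measurable) (subst nn_integral_add, measurable, measurable)+
  also have "\<dots> \<le> ennreal (2 / r) * (A + A + A + A)"
    unfolding VA[symmetric] unfolding VA A_def
    by (intro mult_left_mono add_mono nn_integral_translate_le order_trans[OF nn_integral_translate_le[of V]]) (auto simp: VA A_def)
  also have "A + A + A + A = 4 * A"
    by (simp only: numeral_Bit0 numeral_One distrib_right mult_1 add.assoc)
  finally have fin: "ennreal (r / 2) * ennreal (2 * pi * norm (g ?z)) \<le> ennreal (2 / r) * (4 * A)" .
  have "ennreal (r\<^sup>2 * norm (g ?z)) \<le> ennreal (r\<^sup>2 * (pi / 2) * norm (g ?z))"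
    using pi_ge_two by (intro ennreal_leI mult_right_mono) (auto intro: mult_left_mono[of 1 "pi/2", simplified])
  also have "\<dots> = ennreal (r / 2) * (ennreal (r / 2) * ennreal (2 * pi * norm (g ?z)))"
    using r by (simp add: ennreal_mult[symmetric] power2_eq_square)
  also have "\<dots> \<le> ennreal (r / 2) * (ennreal (2 / r) * (4 * A))" by (intro mult_left_mono fin) auto
  also have "\<dots> = 4 * A" using r by (simp add: mult.assoc[symmetric] ennreal_mult[symmetric])
  finally show ?thesis unfolding A_def H_def k_eq .
qed

subsection \<open>Hecke eigenforms\<close>

lemma e_add: "e (z + w) = e z * e w"
  by (simp add: e_def distrib_left exp_add)

lemma e_of_real: "e (of_real x) = cis (2 * pi * x)"
  by (simp add: e_def cis_conv_exp mult_ac)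

lemma e_of_nat_mult: "e (of_nat n * z) = e z ^ n"
  by (simp add: e_def exp_of_nat_mult[symmetric] mult_ac)

lemma e_Complex: "e (of_nat n * Complex x y) = of_real (exp (- (2 * pi * real n * y))) * cis (2 * pi * real n * x)"
  by (simp add: e_def Complex_eq cis_conv_exp exp_of_real[symmetric] exp_add[symmetric] algebra_simps)

text \<open>Convergence at height \<open>y / 2\<close> bounds the terms there, and moving up to
  height \<open>y\<close> multiplies them by the geometric factor \<open>exp (- pi n y)\<close>.
  Thus pointwise convergence of the expansion is enough for absolute convergence.\<close>

lemma abs_fourier_horizontal:
  assumes sums: "\<And>z. z \<in> upper_half_plane \<Longrightarrow> (\<lambda>n. c n * e (of_nat n * z)) sums f z" and "y > 0"
  shows "abs_fourier (\<lambda>n. c n * of_real (exp (- (2 * pi * real n * y)))) (\<lambda>x. f (Complex x y))"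
proof
  show "(\<lambda>n. c n * of_real (exp (- (2 * pi * real n * y))) * cis (2 * pi * real n * x)) sums f (Complex x y)" for x
    using sums[of "Complex x y"] \<open>y > 0\<close> by (simp add: upper_half_plane_def e_Complex mult_ac)
  define t where "t = exp (- (pi * y))"
  have t: "0 < t" "t < 1" using \<open>y > 0\<close> by (auto simp: t_def)
  have "(\<lambda>n. c n * e (of_nat n * Complex 0 (y / 2))) \<longlonglongrightarrow> 0"
    using sums[of "Complex 0 (y / 2)"] \<open>y > 0\<close>
    by (intro summable_LIMSEQ_zero sums_summable) (auto simp: upper_half_plane_def)
  then have "Bseq (\<lambda>n. c n * e (of_nat n * Complex 0 (y / 2)))"
    by (intro convergent_imp_Bseq) (auto simp: convergent_def)
  then obtain B where B: "\<And>n. norm (c n * e (of_nat n * Complex 0 (y / 2))) \<le> B"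
    unfolding Bseq_def by blast
  have e1: "exp (- (2 * pi * real n * (y / 2))) = t ^ n" for n
    by (simp add: t_def exp_of_nat_mult[symmetric] mult_ac)
  have e2: "exp (- (2 * pi * real n * y)) = t ^ n * t ^ n" for n
    by (simp add: t_def exp_of_nat_mult[symmetric] mult_ac flip: exp_add)
  have le: "norm (c n * of_real (exp (- (2 * pi * real n * y)))) \<le> B * t ^ n" for n
  proof -
    have "norm (c n) * t ^ n \<le> B" using B[of n] t unfolding e_Complex e1 by (simp add: norm_mult norm_power)
    then have "norm (c n) * t ^ n * t ^ n \<le> B * t ^ n" using t by (intro mult_right_mono) auto
    then show ?thesis unfolding e2 using t by (simp add: norm_mult norm_power mult_ac)
  qed
  show "summable (\<lambda>n. norm (c n * of_real (exp (- (2 * pi * real n * y)))))"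
  proof (rule summable_comparison_test')
    show "summable (\<lambda>n. B * t ^ n)" using t by (intro summable_mult summable_geometric) auto
    show "norm (norm (c n * of_real (exp (- (2 * pi * real n * y))))) \<le> B * t ^ n" if "n \<ge> 0" for n
      unfolding real_norm_def using le[of n] by (simp only: abs_norm_cancel)
  qed
qed

lemma sum_e_roots_of_unity:
  fixes d m :: nat
  assumes "d > 0"
  shows "(\<Sum>b<d. e (of_nat m * of_nat b / of_nat d)) = (if d dvd m then of_nat d else 0)"
proof -
  define w where "w = e (of_real (real m / real d))"
  have w: "e (of_nat m * of_nat b / of_nat d) = w ^ b" for b
    unfolding w_def e_of_nat_mult[symmetric] by (simp add: mult_ac)
  have wd: "w ^ d = 1"
    using assms unfolding w_def e_of_nat_mult[symmetric]
    by (auto simp: e_def exp_eq_1 intro!: exI[of _ "int m"])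
  have w1: "w = 1 \<longleftrightarrow> d dvd m"
  proof
    assume "w = 1"
    then obtain j :: int where "2 * pi * (real m / real d) = 2 * pi * of_int j"
      unfolding w_def e_def exp_eq_1 by (auto simp: mult_ac)
    then have "real m = of_int j * real d" using assms by (simp add: field_simps)
    then have "int m = j * int d" by (metis of_int_eq_iff of_int_mult of_int_of_nat_eq)
    then show "d dvd m" by (metis dvd_triv_right int_dvd_int_iff)
  next
    assume "d dvd m"
    then obtain j where "m = d * j" by blast
    then have "w = e (of_nat j)" using assms by (simp add: w_def)
    then show "w = 1" by (auto simp: e_def exp_eq_1 intro!: exI[of _ "int j"])
  qed
  show ?thesis
  proof (cases "d dvd m")
    case True
    then show ?thesis using w1 by (simp add: w)
  next
    case False
    then have "w \<noteq> 1" using w1 by simp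
    then have "(\<Sum>b<d. w ^ b) = 0" using wd by (simp add: sum_gp_strict)
    then show ?thesis using False by (simp add: w)
  qed
qed

lemma sums_strict_mono_reindex_multiple:
  fixes F :: "nat \<Rightarrow> 'a :: real_normed_vector"
  assumes "d > 0" "\<And>m. \<not> d dvd m \<Longrightarrow> F m = 0"
  shows "(\<lambda>l. F (d * l)) sums s \<longleftrightarrow> F sums s"
proof (rule sums_mono_reindex)
  show "strict_mono ((*) d)" using assms(1) by (simp add: strict_mono_def)
  show "F n = 0" if "n \<notin> range ((*) d)" for n
    using assms(2)[of n] that by (auto simp: dvd_def)
qed

locale normalized_eigenform =
  fixes k :: nat and f :: "complex \<Rightarrow> complex" and lam :: "nat \<Rightarrow> complex"
  assumes k_pos: "k > 0" and k_even: "even k" and hecke: "hecke_eigenform k f"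
    and expansion: "\<And>z. z \<in> upper_half_plane \<Longrightarrow>
         (\<lambda>m. let n = Suc m in
            lam n * of_real (real n powr ((real k - 1) / 2)) * e (of_nat n * z)) sums f z"
    and lam_1: "lam 1 = 1"
begin

text \<open>Because \<open>0 powr s = 0\<close>, this vanishes at \<open>n = 0\<close> whatever \<open>lam 0\<close> is.\<close>

definition coeff :: "nat \<Rightarrow> complex" where
  "coeff n = lam n * of_real (real n powr ((real k - 1) / 2))"

lemma coeff_0 [simp]: "coeff 0 = 0" and coeff_1 [simp]: "coeff (Suc 0) = 1"
  using lam_1 by (simp_all add: coeff_def)

lemma k_ge_2: "k \<ge> 2"
  using k_pos k_even by (metis dvd_imp_le)

lemma holomorphic: "f holomorphic_on upper_half_plane"
  and modular: "weakly_modular k f"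
  using hecke unfolding hecke_eigenform_def cusp_form_def by auto

lemma sums_coeff:
  assumes "z \<in> upper_half_plane"
  shows "(\<lambda>n. coeff n * e (of_nat n * z)) sums f z"
proof -
  have "(\<lambda>m. coeff (Suc m) * e (of_nat (Suc m) * z)) sums f z"
    using expansion[OF assms] unfolding coeff_def Let_def .
  then show ?thesis by (subst (asm) sums_Suc_iff) simp
qed

lemma fourier:
  assumes "y > 0"
  shows "abs_fourier (\<lambda>n. coeff n * of_real (exp (- (2 * pi * real n * y)))) (\<lambda>x. f (Complex x y))"
  using sums_coeff assms by (rule abs_fourier_horizontal)

text \<open>The sum over \<open>b\<close> is a sum over characters modulo \<open>d\<close> and keeps
  only the frequencies \<open>m = d l\<close>. Each of these becomes the frequency
  \<open>M = g l\<close>, which explains the two reindexings. The operator \<open>T_n\<close> uses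
  the case \<open>g = n / d\<close>.\<close>

lemma hecke_summand_sums:
  assumes "d > 0" "g > 0" "z \<in> upper_half_plane"
  shows "(\<lambda>M. (if g dvd M then of_nat d * coeff (d * (M div g)) else 0) * e (of_nat M * z)) sums
      (\<Sum>b<d. f ((of_nat g * z + of_nat b) / of_nat d))"
proof -
  have in_H: "(of_nat g * z + of_nat b) / of_nat d \<in> upper_half_plane" for b
  proof -
    have "Im ((of_nat g * z + of_nat b) / of_nat d) = real g * Im z / real d"
      by (simp add: Im_divide_of_nat)
    then show ?thesis using assms by (simp add: upper_half_plane_def)
  qed
  have "(\<lambda>m. \<Sum>b<d. coeff m * e (of_nat m * ((of_nat g * z + of_nat b) / of_nat d))) sums
      (\<Sum>b<d. f ((of_nat g * z + of_nat b) / of_nat d))"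
    by (intro sums_sum sums_coeff in_H)
  also have "(\<lambda>m. \<Sum>b<d. coeff m * e (of_nat m * ((of_nat g * z + of_nat b) / of_nat d))) =
      (\<lambda>m. coeff m * e (of_nat m * (of_nat g * z / of_nat d)) * (\<Sum>b<d. e (of_nat m * of_nat b / of_nat d)))"
    by (simp add: sum_distrib_left e_add[symmetric] add_divide_distrib distrib_left mult.assoc)
  also have "\<dots> = (\<lambda>m. coeff m * e (of_nat m * (of_nat g * z / of_nat d)) * (if d dvd m then of_nat d else 0))"
    using assms(1) by (simp add: sum_e_roots_of_unity)
  finally have "(\<lambda>l. coeff (d * l) * e (of_nat (d * l) * (of_nat g * z / of_nat d)) * (if d dvd d * l then of_nat d else 0)) sums
      (\<Sum>b<d. f ((of_nat g * z + of_nat b) / of_nat d))"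
    using assms(1) by (subst sums_strict_mono_reindex_multiple[where F = "\<lambda>m. coeff m * e (of_nat m * (of_nat g * z / of_nat d)) * (if d dvd m then of_nat d else 0)"]) auto
  also have "(\<lambda>l. coeff (d * l) * e (of_nat (d * l) * (of_nat g * z / of_nat d)) * (if d dvd d * l then of_nat d else 0))
     = (\<lambda>l. (if g dvd g * l then of_nat d * coeff (d * (g * l div g)) else 0) * e (of_nat (g * l) * z))"
    using assms(1,2) by (intro ext) (simp add: mult_ac)
  finally show ?thesis
    using assms(2) by (subst (asm) sums_strict_mono_reindex_multiple[where F = "\<lambda>M. (if g dvd M then of_nat d * coeff (d * (M div g)) else 0) * e (of_nat M * z)"]) auto
qed

lemma hecke_operator_sums:
  assumes "n > 0" "z \<in> upper_half_plane"
  shows "(\<lambda>M. (\<Sum>d | d dvd n. if n div d dvd M then of_nat (n div d) ^ (k - 1) * coeff (d * (M div (n div d))) else 0)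
      * e (of_nat M * z)) sums hecke_operator k n f z"
proof -
  let ?c = "\<lambda>M d. if n div d dvd M then of_nat d * coeff (d * (M div (n div d))) else 0"
  have "(\<lambda>M. of_nat n ^ (k - 1) * (\<Sum>d | d dvd n.
      ?c M d * e (of_nat M * z) / of_nat d ^ k)) sums hecke_operator k n f z"
    unfolding hecke_operator_def using assms
    by (intro sums_mult sums_sum sums_divide hecke_summand_sums)
       (auto intro: Nat.gr0I simp: dvd_div_eq_0_iff)
  also have "(\<lambda>M. of_nat n ^ (k - 1) * (\<Sum>d | d dvd n.
      ?c M d * e (of_nat M * z) / of_nat d ^ k))
    = (\<lambda>M. (\<Sum>d | d dvd n. if n div d dvd M then of_nat (n div d) ^ (k - 1) * coeff (d * (M div (n div d))) else 0)
      * e (of_nat M * z))"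
    unfolding sum_distrib_left sum_distrib_right
  proof (intro ext sum.cong refl)
    fix M d assume "d \<in> {d. d dvd n}"
    then have d: "d > 0" "n = d * (n div d)" using assms(1) by (auto intro: Nat.gr0I)
    have "(of_nat n :: complex) = of_nat d * of_nat (n div d)" by (metis d(2) of_nat_mult)
    moreover have "(of_nat d :: complex) ^ k = of_nat d ^ (k - 1) * of_nat d"
      using k_pos by (metis Suc_diff_1 power_Suc2)
    ultimately show "of_nat n ^ (k - 1) * (?c M d * e (of_nat M * z) / of_nat d ^ k)
      = (if n div d dvd M then of_nat (n div d) ^ (k - 1) * coeff (d * (M div (n div d))) else 0) * e (of_nat M * z)"
      using d(1) by (simp add: power_mult_distrib)
  qed
  finally show ?thesis .
qed

text \<open>Comparison of coefficients in \<open>T_n f = \<mu> f\<close>: index 1 identifies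
  \<open>\<mu>\<close> as \<open>coeff n\<close>, because the first coefficient is 1, and index
  \<open>M\<close> is then the Hecke relation.\<close>

lemma coeff_mult:
  assumes "n > 0" "M > 0"
  shows "coeff n * coeff M = (\<Sum>g | g dvd gcd n M. of_nat g ^ (k - 1) * coeff (n * M div g\<^sup>2))"
proof -
  define c where "c = (\<lambda>M. \<Sum>d | d dvd n. if n div d dvd M then of_nat (n div d) ^ (k - 1) * coeff (d * (M div (n div d))) else 0)"
  have "n \<ge> 1" using assms by simp
  with hecke obtain \<mu> where \<mu>: "\<And>z. z \<in> upper_half_plane \<Longrightarrow> hecke_operator k n f z = \<mu> * f z"
    unfolding hecke_eigenform_def by metis
  \<comment> \<open>Both expansions are compared on the single line \<open>Im z = 1\<close>, which
    already determines all coefficients.\<close>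
  have 1: "abs_fourier (\<lambda>M. c M * of_real (exp (- (2 * pi * real M * 1)))) (\<lambda>x. hecke_operator k n f (Complex x 1))"
    using hecke_operator_sums[OF assms(1)] unfolding c_def by (intro abs_fourier_horizontal) auto
  have "(\<lambda>M. \<mu> * coeff M * e (of_nat M * z)) sums hecke_operator k n f z" if "z \<in> upper_half_plane" for z
    unfolding \<mu>[OF that] mult.assoc by (intro sums_mult sums_coeff that)
  then have 2: "abs_fourier (\<lambda>M. \<mu> * coeff M * of_real (exp (- (2 * pi * real M * 1)))) (\<lambda>x. hecke_operator k n f (Complex x 1))"
    by (intro abs_fourier_horizontal) auto
  have c: "c M = \<mu> * coeff M" for M
    using fun_cong[OF abs_fourier_unique[OF 1 2], of M] by simp
  have "c 1 = (\<Sum>d | d dvd n. if d = n then coeff n else 0)"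
    unfolding c_def
  proof (intro sum.cong refl)
    fix d assume "d \<in> {d. d dvd n}"
    then obtain g where g: "n = d * g" by (auto elim: dvdE)
    with assms have "d > 0" "g > 0" by (auto intro: Nat.gr0I)
    with g show "(if n div d dvd 1 then of_nat (n div d) ^ (k - 1) * coeff (d * (1 div (n div d))) else 0)
        = (if d = n then coeff n else 0)" by auto
  qed
  also have "\<dots> = coeff n" using assms by (subst sum.delta) auto
  finally have "\<mu> = coeff n" using c[of 1] by simp
  then have "coeff n * coeff M = c M" using c by simp
  also have "c M = (\<Sum>d\<in>{d. d dvd n \<and> n div d dvd M}. of_nat (n div d) ^ (k - 1) * coeff (d * (M div (n div d))))"
    unfolding c_def using assms by (intro sum.mono_neutral_cong_right) auto
  also have "\<dots> = (\<Sum>g | g dvd gcd n M. of_nat g ^ (k - 1) * coeff (n * M div g\<^sup>2))"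
  proof (rule sum.reindex_bij_witness[where i = "\<lambda>g. n div g" and j = "\<lambda>d. n div d"])
    fix d assume "d \<in> {d. d dvd n \<and> n div d dvd M}"
    then obtain g l where gl: "n = d * g" "g dvd M" "M = g * l" using assms
      by (auto elim!: dvdE)
    have pos: "d > 0" "g > 0" using gl assms by (auto intro: Nat.gr0I)
    show "n div (n div d) = d" "n div d \<in> {g. g dvd gcd n M}"
      using gl pos by simp_all
    show "of_nat (n div d) ^ (k - 1) * coeff (n * M div (n div d)\<^sup>2) = of_nat (n div d) ^ (k - 1) * coeff (d * (M div (n div d)))"
      using gl pos by (simp add: power2_eq_square)
  next
    fix g assume "g \<in> {g. g dvd gcd n M}"
    then obtain d l where gl: "n = g * d" "M = g * l" by (auto elim!: dvdE)
    have pos: "d > 0" "g > 0" using gl assms by (auto intro: Nat.gr0I)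
    show "n div (n div g) = g" "n div g \<in> {d. d dvd n \<and> n div d dvd M}"
      using gl pos by simp_all
  qed
  finally show ?thesis .
qed

text \<open>The factor \<open>g^(k-1)\<close> is exactly what dividing by \<open>n^((k-1)/2)\<close>
  absorbs when \<open>m n\<close> is replaced by \<open>m n / g^2\<close>.\<close>

lemma hecke_multiplicative: "hecke_multiplicative lam"
  unfolding hecke_multiplicative_def
proof (intro allI impI)
  fix m n :: nat assume mn: "m > 0" "n > 0"
  let ?s = "(real k - 1) / 2"
  let ?P = "complex_of_real (real (m * n) powr ?s)"
  have "?P \<noteq> 0" using mn by simp
  have "?P * (lam m * lam n) = coeff m * coeff n"
    by (simp add: coeff_def powr_mult mult_ac)
  also have "\<dots> = (\<Sum>g | g dvd gcd m n. of_nat g ^ (k - 1) * coeff (m * n div g\<^sup>2))"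
    using mn by (rule coeff_mult)
  also have "\<dots> = (\<Sum>g | g dvd gcd m n. ?P * lam (m * n div g\<^sup>2))"
  proof (intro sum.cong refl)
    fix g assume "g \<in> {g. g dvd gcd m n}"
    then have g: "g > 0" "g\<^sup>2 dvd m * n" using mn
      by (auto intro: Nat.gr0I mult_dvd_mono simp: power2_eq_square)
    have "real g ^ (k - 1) = (real g)\<^sup>2 powr ?s"
    proof -
      have "(real g)\<^sup>2 powr ?s = (real g powr 2) powr ?s" using g by simp
      also have "\<dots> = real g powr real (k - 1)" using k_pos by (simp only: powr_powr) (simp add: of_nat_diff diff_divide_distrib right_diff_distrib)
      finally show ?thesis using g by (simp add: powr_realpow)
    qed
    moreover have "real (m * n) = (real g)\<^sup>2 * real (m * n div g\<^sup>2)"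
      by (metis g(2) dvd_mult_div_cancel of_nat_mult of_nat_power)
    ultimately have "real (m * n) powr ?s = real g ^ (k - 1) * real (m * n div g\<^sup>2) powr ?s"
      by (simp add: powr_mult)
    then show "of_nat g ^ (k - 1) * coeff (m * n div g\<^sup>2) = ?P * lam (m * n div g\<^sup>2)"
      by (simp add: coeff_def)
  qed
  also have "\<dots> = ?P * (\<Sum>g | g dvd gcd m n. lam (m * n div g\<^sup>2))" by (simp add: sum_distrib_left)
  finally show "lam m * lam n = (\<Sum>g | g dvd gcd m n. lam (m * n div g\<^sup>2))"
    using \<open>?P \<noteq> 0\<close> by simp
qed

end

subsection \<open>The Rankin--Selberg series\<close>

definition moebius :: "int \<Rightarrow> int \<Rightarrow> int \<Rightarrow> int \<Rightarrow> complex \<Rightarrow> complex" where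
  "moebius a b c d z = (of_int a * z + of_int b) / (of_int c * z + of_int d)"

lemma moebius_denominator_nonzero:
  assumes "a * d - b * c = 1" "Im z > 0"
  shows "of_int c * z + of_int d \<noteq> (0 :: complex)"
proof
  assume *: "of_int c * z + of_int d = 0"
  then have "Im (of_int c * z + of_int d) = 0" by simp
  then have "c = 0" using assms(2) by simp
  with * have "d = 0" by simp
  with \<open>c = 0\<close> assms(1) show False by simp
qed

lemma moebius_diff:
  assumes "a * d - b * c = 1" "Im z > 0" "Im w > 0"
  shows "moebius a b c d z - moebius a b c d w =
    (z - w) / ((of_int c * z + of_int d) * (of_int c * w + of_int d))"
proof -
  note nz = moebius_denominator_nonzero[OF assms(1,2)] moebius_denominator_nonzero[OF assms(1,3)]
  have det: "of_int a * of_int d - of_int b * of_int c = (1 :: complex)"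
    using assms(1) by (metis of_int_1 of_int_diff of_int_mult)
  have "(of_int a * z + of_int b) * (of_int c * w + of_int d) - (of_int a * w + of_int b) * (of_int c * z + of_int d)
      = (of_int a * of_int d - of_int b * of_int c) * (z - w)" by (simp add: algebra_simps)
  with nz show ?thesis unfolding det moebius_def by (simp add: diff_frac_eq)
qed

lemma Im_moebius:
  assumes "a * d - b * c = 1" "Im z > 0"
  shows "Im (moebius a b c d z) = Im z / (norm (of_int c * z + of_int d))\<^sup>2"
proof -
  let ?q = "of_int c * z + of_int d :: complex"
  have det: "real_of_int a * of_int d - of_int b * of_int c = 1"
    using assms(1) by (metis of_int_1 of_int_diff of_int_mult)
  have "Im (moebius a b c d z) = Im ((of_int a * z + of_int b) * cnj ?q) / (norm ?q)\<^sup>2"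
    unfolding moebius_def Im_divide cmod_power2 by (simp add: algebra_simps)
  also have "Im ((of_int a * z + of_int b) * cnj ?q) = (real_of_int a * of_int d - of_int b * of_int c) * Im z"
    by (simp add: algebra_simps)
  finally show ?thesis by (simp add: det)
qed

lemma moebius_upper_half_plane:
  assumes "a * d - b * c = 1" "Im z > 0"
  shows "Im (moebius a b c d z) > 0"
  using assms moebius_denominator_nonzero[OF assms] by (simp add: Im_moebius)

text \<open>Invariance of \<open>\<bar>z - w\<bar>\<^sup>2 / (Im z Im w)\<close>, with denominators cleared.\<close>

lemma norm_moebius_diff:
  assumes "a * d - b * c = 1" "Im z > 0" "Im w > 0"
  shows "(norm (moebius a b c d z - moebius a b c d w))\<^sup>2 * (Im z * Im w) =
    (norm (z - w))\<^sup>2 * (Im (moebius a b c d z) * Im (moebius a b c d w))"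
  using assms by (simp add: moebius_diff Im_moebius norm_divide norm_mult power_divide power_mult_distrib)

text \<open>A Dirichlet approximation \<open>h / q\<close> to \<open>Re z\<close> provides a
  denominator \<open>q z - h\<close> of squared norm at most \<open>5 Im z\<close>, and Bezout
  completes it to a matrix of determinant 1. This replaces the reduction to a fundamental domain,
  with 1/5 in the role of \<open>sqrt 3 / 2\<close>.\<close>

lemma exists_moebius_Im_ge:
  assumes "Im z > 0"
  shows "\<exists>a b c d. a * d - b * c = 1 \<and> Im (moebius a b c d z) \<ge> 1 / 5"
proof (cases "Im z \<ge> 1 / 5")
  case True
  then show ?thesis by (intro exI[of _ 1] exI[of _ 0] exI[of _ 1]) (auto simp: moebius_def)
next
  case False
  define y where "y = Im z"
  have y: "0 < y" "y < 1 / 5" using False assms by (auto simp: y_def)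
  \<comment> \<open>This size balances the two parts of \<open>\<bar>q z - h\<bar>^2\<close>: the
    squares of \<open>1 / N\<close> and of \<open>N y\<close> are both of order
    \<open>y\<close>.\<close>
  define N where "N = nat \<lceil>1 / sqrt y\<rceil>"
  have N: "1 / sqrt y \<le> real N" "real N \<le> 1 / sqrt y + 1"
    unfolding N_def using y by (auto simp: of_nat_ceiling)
  have "0 < 1 / sqrt y" using y by simp
  then have N0: "N > 0" using N(1) by (metis less_le_trans of_nat_0_less_iff)
  obtain h q where hq: "coprime h q" "0 < q" "q \<le> int N" "\<bar>of_int q * Re z - of_int h\<bar> < 1 / real N"
    using Dirichlet_approx_coprime[OF N0] by blast
  obtain u v where uv: "u * h + v * q = 1" using bezout_int[of h q] hq(1) by auto
  then have det: "(-u) * (-h) - (-v) * q = 1" by simp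
  have "(1 / real N)\<^sup>2 \<le> (sqrt y)\<^sup>2"
    using N(1) N0 y by (intro power_mono) (auto simp: field_simps)
  then have 1: "(1 / real N)\<^sup>2 \<le> y" using y by simp
  have "sqrt y \<le> sqrt (1 / 4)" using y by (intro real_sqrt_le_mono) auto
  then have sy: "sqrt y \<le> 1 / 2" by (simp add: real_sqrt_divide)
  have "real N * sqrt y \<le> (1 / sqrt y + 1) * sqrt y" using N(2) y by (intro mult_right_mono) auto
  also have "\<dots> = 1 + sqrt y" using y by (simp add: field_simps)
  also have "\<dots> \<le> 3 / 2" using sy by simp
  finally have "(real N * sqrt y)\<^sup>2 \<le> (3 / 2)\<^sup>2" using y by (intro power_mono) auto
  then have "(real N)\<^sup>2 * (sqrt y)\<^sup>2 \<le> (3 / 2)\<^sup>2" by (simp only: power_mult_distrib)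
  also have "\<dots> \<le> 4" by (simp add: power2_eq_square)
  finally have 2: "(real N)\<^sup>2 * y \<le> 4" using y by simp
  have "(norm (of_int q * z + of_int (-h)))\<^sup>2 = (of_int q * Re z - of_int h)\<^sup>2 + (of_int q * y)\<^sup>2"
    by (simp add: cmod_power2 y_def)
  also have "\<dots> \<le> (1 / real N)\<^sup>2 + (real N * y)\<^sup>2"
  proof (intro add_mono)
    show "(of_int q * Re z - of_int h)\<^sup>2 \<le> (1 / real N)\<^sup>2"
      using hq(4) by (intro abs_le_square_iff[THEN iffD1]) auto
    have "real_of_int q \<le> real N" using hq(3) by (metis of_int_le_iff of_int_of_nat_eq)
    then show "(of_int q * y)\<^sup>2 \<le> (real N * y)\<^sup>2" using hq(2) y by (intro power_mono mult_right_mono) auto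
  qed
  also have "(real N * y)\<^sup>2 = ((real N)\<^sup>2 * y) * y" by (simp add: power2_eq_square)
  also have "(1 / real N)\<^sup>2 + ((real N)\<^sup>2 * y) * y \<le> y + 4 * y"
    using 1 2 y by (intro add_mono mult_right_mono) auto
  finally have le: "(norm (of_int q * z + of_int (-h)))\<^sup>2 \<le> 5 * y" by simp
  have nz: "(norm (of_int q * z + of_int (-h)))\<^sup>2 > 0"
    using moebius_denominator_nonzero[OF det assms] by simp
  have "1 / 5 = y / (5 * y)" using y by simp
  also have "\<dots> \<le> y / (norm (of_int q * z + of_int (-h)))\<^sup>2"
    using le nz y by (intro divide_left_mono) auto
  also have "\<dots> = Im (moebius (-u) (-v) q (-h) z)"
    using Im_moebius[OF det assms] by (simp add: y_def)
  finally show ?thesis using det by blast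
qed

lemma power_exp_le_fact:
  fixes x :: real
  assumes "x \<ge> 0"
  shows "x ^ n * exp (- x) \<le> fact n"
proof -
  have "x ^ n / fact n \<le> exp x"
  proof -
    have "(\<Sum>i\<in>{n}. x ^ i /\<^sub>R fact i) \<le> (\<Sum>i. x ^ i /\<^sub>R fact i)"
      using assms by (intro sum_le_suminf summable_exp_generic) auto
    then show ?thesis by (simp add: exp_def divide_inverse mult.commute)
  qed
  then show ?thesis by (simp add: exp_minus field_simps)
qed

text \<open>The term at \<open>n = 0\<close> vanishes because \<open>0 powr x = 0\<close>.\<close>

definition rankin_selberg :: "(nat \<Rightarrow> complex) \<Rightarrow> real \<Rightarrow> real" where
  "rankin_selberg lam \<delta> = (\<Sum>n. (norm (lam n))\<^sup>2 * real n powr (-1 - \<delta>))"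

context normalized_eigenform begin

text \<open>The square of the invariant function \<open>F\<close>; in this form only integer
  exponents occur.\<close>

definition wnorm :: "complex \<Rightarrow> real" where
  "wnorm z = Im z ^ k * (norm (f z))\<^sup>2"

lemma wnorm_nonneg: "Im z > 0 \<Longrightarrow> wnorm z \<ge> 0"
  by (simp add: wnorm_def)

lemma wnorm_moebius:
  assumes "a * d - b * c = 1" "Im z > 0"
  shows "wnorm (moebius a b c d z) = wnorm z"
proof -
  let ?q = "of_int c * z + of_int d :: complex"
  have "f (moebius a b c d z) = ?q ^ k * f z"
    using modular assms unfolding weakly_modular_def moebius_def upper_half_plane_def by blast
  then show ?thesis
    unfolding wnorm_def Im_moebius[OF assms] using moebius_denominator_nonzero[OF assms]
    by (simp add: norm_mult norm_power power_mult_distrib power_divide mult_ac flip: power_mult)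
qed

lemma wnorm_le_of_high:
  assumes "\<And>z. Im z \<ge> 1 / 5 \<Longrightarrow> wnorm z \<le> M" "Im z > 0"
  shows "wnorm z \<le> M"
  using exists_moebius_Im_ge[OF assms(2)] wnorm_moebius[OF _ assms(2)] assms(1) by metis

lemma norm_coeff: "norm (coeff n) = norm (lam n) * real n powr ((real k - 1) / 2)"
  by (simp add: coeff_def norm_mult)

lemma norm_coeff_sq: "n > 0 \<Longrightarrow> (norm (coeff n))\<^sup>2 = (norm (lam n))\<^sup>2 * real n powr (real k - 1)"
proof -
  have "(real n powr ((real k - 1) / 2))\<^sup>2 = real n powr (real k - 1)"
    by (simp add: power2_eq_square flip: powr_add)
  then show ?thesis by (simp add: norm_coeff power_mult_distrib)
qed

lemma norm_f_le:
  assumes "y > 0" "\<And>X. (\<Sum>n<X. norm (coeff n) * exp (- (2 * pi * real n * y))) \<le> B"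
  shows "norm (f (Complex x y)) \<le> B"
proof (rule LIMSEQ_le_const2)
  let ?S = "\<lambda>X. \<Sum>n<X. coeff n * of_real (exp (- (2 * pi * real n * y))) * cis (2 * pi * real n * x)"
  interpret abs_fourier "\<lambda>n. coeff n * of_real (exp (- (2 * pi * real n * y)))" "\<lambda>x. f (Complex x y)"
    using assms(1) by (rule fourier)
  show "(\<lambda>X. norm (?S X)) \<longlonglongrightarrow> norm (f (Complex x y))"
    using sums[of x] unfolding sums_def by (rule tendsto_norm)
  have "norm (?S X) \<le> B" for X
    using assms(2)[of X] by (intro order_trans[OF norm_sum]) (simp add: norm_mult)
  then show "\<exists>N. \<forall>X\<ge>N. norm (?S X) \<le> B"
    by blast
qed

text \<open>A purely qualitative bound, with no uniformity in \<open>f\<close>. It serves to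
  establish convergence of the Rankin-Selberg series, before the uniform bounds for
  \<open>wnorm\<close> can be stated in terms of that series.\<close>

lemma wnorm_bounded: "\<exists>M. \<forall>z. Im z > 0 \<longrightarrow> wnorm z \<le> M"
proof -
  interpret abs_fourier "\<lambda>n. coeff n * of_real (exp (- (2 * pi * real n * (1 / 10))))" "\<lambda>x. f (Complex x (1 / 10))"
    by (rule fourier) simp
  define S where "S = (\<Sum>n. norm (coeff n * of_real (exp (- (2 * pi * real n * (1 / 10))))))"
  have S: "S \<ge> 0" unfolding S_def by (intro suminf_nonneg summable) auto
  have "wnorm z \<le> S\<^sup>2 * fact k" if "Im z \<ge> 1 / 5" for z
  proof -
    define y where "y = Im z"
    have y: "y \<ge> 1 / 5" using that by (simp add: y_def)
    \<comment> \<open>Half of the height 1/5 is kept for the convergent majorant. The rest gives the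
      decay \<open>exp (- pi y)\<close>, which beats \<open>y^k\<close>; it is available because the
      term at \<open>n = 0\<close> vanishes.\<close>
    have term_le: "norm (coeff n) * exp (- (2 * pi * real n * y)) \<le>
        norm (coeff n * of_real (exp (- (2 * pi * real n * (1 / 10))))) * exp (- (pi * y))" for n
    proof (cases "n = 0")
      case False
      have "pi * y \<le> 2 * pi * real n * (y - 1 / 10)"
      proof -
        have "pi * y \<le> pi * (2 * (y - 1 / 10))" using y by (intro mult_left_mono) auto
        also have "\<dots> \<le> pi * (2 * (y - 1 / 10)) * real n"
          using y False mult_left_mono[of 1 "real n" "pi * (2 * (y - 1 / 10))"] by simp
        finally show ?thesis by (simp add: mult_ac)
      qed
      then have "exp (- (2 * pi * real n * y)) \<le> exp (- (2 * pi * real n * (1 / 10))) * exp (- (pi * y))"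
        by (simp add: algebra_simps flip: exp_add)
      then show ?thesis by (simp add: norm_mult mult.assoc mult_left_mono)
    qed simp
    have "(\<Sum>n<X. norm (coeff n) * exp (- (2 * pi * real n * y))) \<le> S * exp (- (pi * y))" for X
    proof -
      have "(\<Sum>n<X. norm (coeff n) * exp (- (2 * pi * real n * y))) \<le>
          (\<Sum>n<X. norm (coeff n * of_real (exp (- (2 * pi * real n * (1 / 10)))))) * exp (- (pi * y))"
        unfolding sum_distrib_right by (intro sum_mono term_le)
      also have "\<dots> \<le> S * exp (- (pi * y))"
        unfolding S_def by (intro mult_right_mono sum_le_suminf summable) auto
      finally show ?thesis .
    qed
    then have "norm (f (Complex (Re z) y)) \<le> S * exp (- (pi * y))"
      using y by (intro norm_f_le) auto
    then have "(norm (f z))\<^sup>2 \<le> (S * exp (- (pi * y)))\<^sup>2" by (intro power_mono) (auto simp: y_def)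
    also have "\<dots> = S\<^sup>2 * exp (- (2 * pi * y))"
      by (simp add: power_mult_distrib power2_eq_square flip: exp_add)
    finally have "wnorm z \<le> y ^ k * (S\<^sup>2 * exp (- (2 * pi * y)))"
      unfolding wnorm_def using y by (simp add: y_def mult_left_mono)
    also have "\<dots> \<le> (2 * pi * y) ^ k * (S\<^sup>2 * exp (- (2 * pi * y)))"
      using y pi_ge_two by (intro mult_right_mono power_mono) auto
    also have "\<dots> = S\<^sup>2 * ((2 * pi * y) ^ k * exp (- (2 * pi * y)))" by simp
    also have "\<dots> \<le> S\<^sup>2 * fact k" using y by (intro mult_left_mono power_exp_le_fact) auto
    finally show ?thesis .
  qed
  then show ?thesis using wnorm_le_of_high by blast
qed

lemma sum_coeff_sq_le:
  assumes M: "\<And>z. Im z > 0 \<Longrightarrow> wnorm z \<le> M" and y: "y > 0"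
  shows "(\<Sum>n=1..X. (norm (coeff n))\<^sup>2 * exp (- (4 * pi * real n) * y)) \<le> M / y ^ k"
proof -
  interpret abs_fourier "\<lambda>n. coeff n * of_real (exp (- (2 * pi * real n * y)))" "\<lambda>x. f (Complex x y)"
    using y by (rule fourier)
  have t: "(norm (coeff n * of_real (exp (- (2 * pi * real n * y)))))\<^sup>2 = (norm (coeff n))\<^sup>2 * exp (- (4 * pi * real n) * y)" for n
    by (simp add: norm_mult power_mult_distrib power2_eq_square flip: exp_add)
  have "(\<Sum>n=1..X. (norm (coeff n))\<^sup>2 * exp (- (4 * pi * real n) * y)) \<le> (\<Sum>n. (norm (coeff n * of_real (exp (- (2 * pi * real n * y)))))\<^sup>2)"
    unfolding t[symmetric] by (intro sum_le_suminf parseval) auto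
  also have "\<dots> \<le> M / y ^ k"
  proof (rule has_integral_le[OF parseval(1)[of 0]])
    show "((\<lambda>x. M / y ^ k) has_integral M / y ^ k) {0..0 + 1 :: real}"
      using has_integral_const_real[of "M / y ^ k" 0 1] by simp
    show "(norm (f (Complex x y)))\<^sup>2 \<le> M / y ^ k" for x
      using M[of "Complex x y"] y by (simp add: wnorm_def field_simps)
  qed
  finally show ?thesis .
qed

text \<open>Parseval at height \<open>y\<close> is multiplied by \<open>y^(s-1)\<close>, where
  \<open>s = k + \<delta>\<close>, and integrated. The bound \<open>M y^(\<delta>-1)\<close> is
  integrable at 0 but not at infinity, so the integral stops at \<open>y = k\<close>; for every
  \<open>n \<ge> 1\<close> at least half of the Gamma integral lies below that height, which
  accounts for the factor 2.\<close>

lemma rankin_selberg_partial_le: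
  assumes M: "\<And>z. Im z > 0 \<Longrightarrow> wnorm z \<le> M" and \<delta>: "0 < \<delta>" "\<delta> \<le> 1"
  shows "(\<Sum>n<X. (norm (lam n))\<^sup>2 * real n powr (-1 - \<delta>))
    \<le> 2 * real k powr \<delta> / \<delta> * M * (4 * pi) powr (real k + \<delta>) / Gamma (real k + \<delta>)"
proof -
  define s where "s = real k + \<delta>"
  have s: "s > 0" "Gamma s > 0" using \<delta> k_pos by (auto simp: s_def intro!: Gamma_real_pos)
  have M0: "M \<ge> 0" using M[of \<i>] wnorm_nonneg[of \<i>] by simp
  let ?w = "\<lambda>n. Gamma s / (4 * pi * real n) powr s / 2"
  let ?E = "\<lambda>n y. ennreal (y powr (s - 1) * exp (- (4 * pi * real n) * y)) * indicator {0..real k} y" and ?c = "\<lambda>n. ennreal ((norm (coeff n))\<^sup>2)"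
  have "ennreal (\<Sum>n=1..X. (norm (coeff n))\<^sup>2 * ?w n) = (\<Sum>n=1..X. ?c n * ennreal (?w n))"
  proof -
    have "?w n \<ge> 0" for n using s by simp
    then have "?c n * ennreal (?w n) = ennreal ((norm (coeff n))\<^sup>2 * ?w n)" for n
      by (intro ennreal_mult[symmetric]) auto
    moreover have "(norm (coeff n))\<^sup>2 * ?w n \<ge> 0" for n using s by (intro mult_nonneg_nonneg) auto
    ultimately show ?thesis by (simp only: sum_ennreal)
  qed
  also have "\<dots> \<le> (\<Sum>n=1..X. ?c n * (\<integral>\<^sup>+y. ?E n y \<partial>lborel))"
  proof (intro sum_mono mult_left_mono nn_integral_Gamma_bounded_ge)
    fix n assume n: "n \<in> {1..X}"
    have "2 * s \<le> 4 * real k" using \<delta> k_pos by (simp add: s_def)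
    also have "\<dots> \<le> 4 * pi * real n * real k"
    proof -
      have "1 * 1 \<le> pi * real n" using n pi_ge_two by (intro mult_mono) auto
      then have "1 * (4 * real k) \<le> pi * real n * (4 * real k)" by (intro mult_right_mono) auto
      then show ?thesis by (simp add: mult_ac)
    qed
    finally show "2 * s \<le> 4 * pi * real n * real k" .
  qed (use s k_pos in auto)
  also have "\<dots> = (\<Sum>n=1..X. \<integral>\<^sup>+y. ?c n * ?E n y \<partial>lborel)"
    by (intro sum.cong refl nn_integral_cmult[symmetric]) measurable
  also have "\<dots> = (\<integral>\<^sup>+y. (\<Sum>n=1..X. ?c n * ?E n y) \<partial>lborel)"
    by (intro nn_integral_sum[symmetric]) measurable
  also have "\<dots> \<le> (\<integral>\<^sup>+y. ennreal (M * y powr (\<delta> - 1)) * indicator {0..real k} y \<partial>lborel)"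
  proof (intro nn_integral_mono)
    fix y :: real
    show "(\<Sum>n=1..X. ?c n * ?E n y)
      \<le> ennreal (M * y powr (\<delta> - 1)) * indicator {0..real k} y"
    proof (cases "y \<in> {0<..real k}")
      case True
      then have "(\<Sum>n=1..X. ?c n * ?E n y)
        = (\<Sum>n=1..X. ennreal (y powr (s - 1) * ((norm (coeff n))\<^sup>2 * exp (- (4 * pi * real n) * y))))"
        by (intro sum.cong refl) (auto simp: ennreal_mult[symmetric] mult_ac)
      also have "\<dots> = ennreal (y powr (s - 1) * (\<Sum>n=1..X. (norm (coeff n))\<^sup>2 * exp (- (4 * pi * real n) * y)))"
        by (subst sum_ennreal) (auto simp: sum_distrib_left)
      also have "\<dots> \<le> ennreal (y powr (s - 1) * (M / y ^ k))"
        using True by (intro ennreal_leI mult_left_mono sum_coeff_sq_le M) auto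
      also have "y powr (s - 1) * (M / y ^ k) = M * y powr (\<delta> - 1)"
      proof -
        have "y powr (s - 1) = y powr (\<delta> - 1) * y ^ k"
          using True by (simp add: s_def powr_realpow[symmetric] powr_add[symmetric] algebra_simps)
        then show ?thesis using True by simp
      qed
      finally show ?thesis using True by simp
    qed (auto simp: indicator_def)
  qed
  also have "\<dots> = ennreal (M * (real k powr \<delta> / \<delta>))"
  proof (rule nn_integral_has_integral_lebesgue')
    have "((\<lambda>y. y powr (\<delta> - 1)) has_integral (real k powr (\<delta> - 1 + 1) / (\<delta> - 1 + 1))) {0..real k}"
      using \<delta> by (intro has_integral_powr_from_0) auto
    then show "((\<lambda>y. M * y powr (\<delta> - 1)) has_integral (M * (real k powr \<delta> / \<delta>))) {0..real k}"
      by (intro has_integral_mult_right) simp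
  qed (use M0 in auto)
  finally have "(\<Sum>n=1..X. (norm (coeff n))\<^sup>2 * ?w n) \<le> M * (real k powr \<delta> / \<delta>)"
    using M0 \<delta> by (subst (asm) ennreal_le_iff) auto
  moreover have "(norm (coeff n))\<^sup>2 * ?w n = (Gamma s / (4 * pi) powr s / 2) * ((norm (lam n))\<^sup>2 * real n powr (-1 - \<delta>))" if "n \<in> {1..X}" for n
  proof -
    have n: "n > 0" using that by auto
    have "real n powr (-1 - \<delta>) = real n powr (real k - 1) / real n powr s"
      by (simp add: s_def powr_diff[symmetric])
    then show ?thesis unfolding norm_coeff_sq[OF n] by (simp add: powr_mult mult_ac)
  qed
  ultimately have "(Gamma s / (4 * pi) powr s / 2) * (\<Sum>n=1..X. (norm (lam n))\<^sup>2 * real n powr (-1 - \<delta>)) \<le> M * (real k powr \<delta> / \<delta>)"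
    by (simp add: sum_distrib_left)
  then have "(\<Sum>n=1..X. (norm (lam n))\<^sup>2 * real n powr (-1 - \<delta>)) \<le> 2 * real k powr \<delta> / \<delta> * M * (4 * pi) powr s / Gamma s"
    using s \<delta> by (simp add: field_simps)
  moreover have "(\<Sum>n<X. (norm (lam n))\<^sup>2 * real n powr (-1 - \<delta>)) \<le> (\<Sum>n\<in>insert 0 {1..X}. (norm (lam n))\<^sup>2 * real n powr (-1 - \<delta>))"
    by (intro sum_mono2) auto
  ultimately show ?thesis by (simp add: s_def)
qed

lemma rankin_selberg_summable:
  assumes \<delta>: "0 < \<delta>" "\<delta> \<le> 1"
  shows "summable (\<lambda>n. (norm (lam n))\<^sup>2 * real n powr (-1 - \<delta>))"
proof -
  obtain M where M: "\<And>z. Im z > 0 \<Longrightarrow> wnorm z \<le> M" using wnorm_bounded by blast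
  show ?thesis by (rule summableI_nonneg_bounded[OF _ rankin_selberg_partial_le[OF M \<delta>]]) simp
qed

lemma rankin_selberg_le:
  assumes M: "\<And>z. Im z > 0 \<Longrightarrow> wnorm z \<le> M" and \<delta>: "0 < \<delta>" "\<delta> \<le> 1"
  shows "rankin_selberg lam \<delta>
    \<le> 2 * real k powr \<delta> / \<delta> * M * (4 * pi) powr (real k + \<delta>) / Gamma (real k + \<delta>)"
  unfolding rankin_selberg_def
  by (rule suminf_le_const[OF rankin_selberg_summable[OF \<delta>] rankin_selberg_partial_le[OF M \<delta>]])

lemma rankin_selberg_partial_le_sum:
  assumes "0 < \<delta>" "\<delta> \<le> 1" "finite A"
  shows "(\<Sum>n\<in>A. (norm (lam n))\<^sup>2 * real n powr (-1 - \<delta>)) \<le> rankin_selberg lam \<delta>"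
  unfolding rankin_selberg_def using assms by (intro sum_le_suminf rankin_selberg_summable) auto

text \<open>Cauchy-Schwarz at height at least 1/5 with the coefficients weighted by
  \<open>1 / n\<close>. What matters is that the bound is linear in
  \<open>rankin_selberg lam 1\<close>; powers of \<open>k\<close> may be lost.\<close>

lemma wnorm_le_rankin_selberg:
  assumes "Im z > 0"
  shows "wnorm z \<le> 250 * (fact (k + 3) / (4 * pi) ^ (k + 3)) * rankin_selberg lam 1"
proof (rule wnorm_le_of_high[OF _ assms])
  fix z assume "Im z \<ge> 1 / 5"
  define y where "y = Im z"
  have y: "y \<ge> 1 / 5" using \<open>Im z \<ge> 1 / 5\<close> by (simp add: y_def)
  let ?F = "fact (k + 3) / (4 * pi) ^ (k + 3)"
  define B where "B = 250 * ?F * rankin_selberg lam 1"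
  have D0: "rankin_selberg lam 1 \<ge> 0" using rankin_selberg_partial_le_sum[of 1 "{}"] by simp
  have B0: "B \<ge> 0" using D0 unfolding B_def by (intro mult_nonneg_nonneg) auto
  let ?S = "\<lambda>X. \<Sum>n<X. norm (coeff n) * exp (- (2 * pi * real n * y))"
  have "?S X \<le> sqrt (B / y ^ k)" for X
  proof (rule real_le_rsqrt)
    define u where "u = (\<lambda>n. norm (lam n) * real n powr (-1))"
    define v where "v = (\<lambda>n. real n powr ((real k + 1) / 2) * exp (- (2 * pi * real n * y)))"
    have uv: "norm (coeff n) * exp (- (2 * pi * real n * y)) = u n * v n" for n
    proof -
      have "real n powr ((real k - 1) / 2) = real n powr (-1) * real n powr ((real k + 1) / 2)"
        unfolding powr_add[symmetric] by (simp add: field_simps)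
      then show ?thesis by (simp add: norm_coeff u_def v_def)
    qed
    have u2: "(\<Sum>n<X. (u n)\<^sup>2) \<le> rankin_selberg lam 1"
    proof -
      have "(u n)\<^sup>2 = (norm (lam n))\<^sup>2 * real n powr (-1 - 1)" for n
        unfolding u_def power_mult_distrib power2_eq_square[of "_ powr _"] powr_add[symmetric] by simp
      then show ?thesis using rankin_selberg_partial_le_sum[of 1 "{..<X}"] by simp
    qed
    have v2: "y ^ k * (v n)\<^sup>2 \<le> 125 * ?F * (1 / (real n)\<^sup>2)" for n
    proof (cases "n = 0")
      case False
      \<comment> \<open>Writing \<open>y^k n^(k+1)\<close> as a multiple of \<open>t^(k+3)\<close>
        spends two extra powers on the convergent factor \<open>1 / n^2\<close> and leaves
        \<open>1 / y^3\<close>, which is at most 125.\<close>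
      define t where "t = 4 * pi * real n * y"
      have t: "t > 0" using False y by (simp add: t_def)
      have vn: "(v n)\<^sup>2 = real n ^ (k + 1) * exp (- t)"
      proof -
        have "(v n)\<^sup>2 = real n powr (real (k + 1)) * exp (- t)"
        proof -
          have "(real n powr ((real k + 1) / 2))\<^sup>2 = real n powr (real (k + 1))"
            unfolding power2_eq_square powr_add[symmetric] by (simp add: add.commute)
          moreover have "(exp (- (2 * pi * real n * y)))\<^sup>2 = exp (- t)"
            unfolding power2_eq_square exp_add[symmetric] by (simp add: t_def)
          ultimately show ?thesis unfolding v_def by (simp only: power_mult_distrib)
        qed
        then show ?thesis using False powr_realpow[of "real n" "k + 1"] by simp
      qed
      have "y ^ k * (v n)\<^sup>2 = t ^ (k + 3) * exp (- t) / ((4 * pi) ^ (k + 3) * (real n)\<^sup>2 * y ^ 3)"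
        unfolding vn using False y by (simp add: t_def power_mult_distrib power_add field_simps eval_nat_numeral)
      also have "\<dots> \<le> fact (k + 3) / ((4 * pi) ^ (k + 3) * (real n)\<^sup>2 * (1 / 5) ^ 3)"
        using False y t by (intro frac_le power_exp_le_fact mult_left_mono power_mono) auto
      also have "\<dots> = 125 * ?F * (1 / (real n)\<^sup>2)"
        by (simp add: field_simps eval_nat_numeral)
      finally show ?thesis .
    qed (simp add: v_def)
    have "y ^ k * (\<Sum>n<X. (v n)\<^sup>2) \<le> (\<Sum>n\<in>insert 0 {1..X}. 125 * ?F * (1 / (real n)\<^sup>2))"
      unfolding sum_distrib_left
      by (intro order_trans[OF sum_mono sum_mono2] v2) auto
    also have "\<dots> = 125 * ?F * (\<Sum>n=1..X. 1 / (real n)\<^sup>2)"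
      by (simp add: sum_distrib_left)
    also have "\<dots> \<le> 125 * ?F * 2"
      by (intro mult_left_mono sum_inverse_squares_le) auto
    finally have v3: "y ^ k * (\<Sum>n<X. (v n)\<^sup>2) \<le> 250 * ?F" by simp
    have "(?S X)\<^sup>2 = (\<Sum>n<X. u n * v n)\<^sup>2" by (simp add: uv)
    also have "\<dots> \<le> (\<Sum>n<X. (u n)\<^sup>2) * (\<Sum>n<X. (v n)\<^sup>2)" by (rule Cauchy_Schwarz_ineq_sum)
    also have "\<dots> \<le> rankin_selberg lam 1 * (\<Sum>n<X. (v n)\<^sup>2)" by (intro mult_right_mono u2 sum_nonneg) auto
    also have "\<dots> \<le> rankin_selberg lam 1 * (250 * ?F / y ^ k)"
      using v3 y D0 by (intro mult_left_mono) (auto simp: field_simps)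
    also have "\<dots> = B / y ^ k" by (simp add: B_def)
    finally show "(?S X)\<^sup>2 \<le> B / y ^ k" .
  qed
  then have "norm (f (Complex (Re z) y)) \<le> sqrt (B / y ^ k)" using y by (intro norm_f_le) auto
  then have "(norm (f z))\<^sup>2 \<le> (sqrt (B / y ^ k))\<^sup>2" by (intro power_mono) (auto simp: y_def)
  also have "\<dots> = B / y ^ k" using B0 y by simp
  finally show "wnorm z \<le> 250 * ?F * rankin_selberg lam 1"
    using y unfolding wnorm_def B_def[symmetric] by (simp add: y_def field_simps)
qed

lemma rankin_selberg_ge_1: "rankin_selberg lam 1 \<ge> 1"
  using rankin_selberg_partial_le_sum[of 1 "{1}"] lam_1 by simp

text \<open>The two opposite inequalities between \<open>wnorm\<close> and the series are composed.
  The quotient of Gamma values gives \<open>k^4\<close> and \<open>k powr \<delta>\<close> at most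
  \<open>k\<close>. Any fixed power would do, since the iteration below removes it.\<close>

lemma rankin_selberg_le_rankin_selberg_1:
  assumes \<delta>: "0 < \<delta>" "\<delta> \<le> 1"
  shows "rankin_selberg lam \<delta> \<le> 6000 / \<delta> * real k ^ 5 * rankin_selberg lam 1"
proof -
  let ?D = "rankin_selberg lam 1"
  have k2: "real k \<ge> 2" using k_ge_2 by simp
  have D0: "?D \<ge> 0" using rankin_selberg_ge_1 by simp
  have "rankin_selberg lam \<delta> \<le> 2 * real k powr \<delta> / \<delta> * (250 * (fact (k + 3) / (4 * pi) ^ (k + 3)) * ?D) * (4 * pi) powr (real k + \<delta>) / Gamma (real k + \<delta>)"
    by (rule rankin_selberg_le[OF wnorm_le_rankin_selberg \<delta>])
  also have "\<dots> = 500 / \<delta> * ?D * real k powr \<delta> * ((4 * pi) powr (real k + \<delta>) / (4 * pi) ^ (k + 3)) * (fact (k + 3) / Gamma (real k + \<delta>))"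
    by (simp add: field_simps)
  also have "\<dots> \<le> 500 / \<delta> * ?D * real k * 1 * (12 * real k ^ 4)"
  proof (intro mult_mono)
    show "real k powr \<delta> \<le> real k" using \<delta> k2 powr_mono[of \<delta> 1 "real k"] by simp
    have "(4 * pi) powr (real k + \<delta>) \<le> (4 * pi) powr (real (k + 3))"
      using \<delta> pi_ge_two by (intro powr_mono) auto
    also have "\<dots> = (4 * pi) ^ (k + 3)" by (rule powr_realpow) simp
    finally show "(4 * pi) powr (real k + \<delta>) / (4 * pi) ^ (k + 3) \<le> 1" by simp
    have G: "fact (k - 1) \<le> Gamma (real k + \<delta>)"
    proof -
      have "Gamma (real k) = fact (k - 1)"
        using Gamma_fact[of "k - 1", where 'a = real] k_pos by (simp add: of_nat_diff)
      then show ?thesis using Gamma_plus_ge[of "real k" \<delta>] k2 \<delta> by simp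
    qed
    have "fact (k + 3) = (real k + 3) * (real k + 2) * (real k + 1) * real k * fact (k - 1)"
      using k_pos by (simp add: eval_nat_numeral fact_reduce[of k] add_ac)
    then have "fact (k + 3) / Gamma (real k + \<delta>) \<le> (real k + 3) * (real k + 2) * (real k + 1) * real k * fact (k - 1) / fact (k - 1)"
      using G by (simp only:) (intro divide_left_mono mult_nonneg_nonneg mult_pos_pos, auto intro: less_le_trans[OF fact_gt_zero])
    also have "\<dots> = (real k + 3) * (real k + 2) * (real k + 1) * real k" by simp
    also have "\<dots> \<le> (3 * real k) * (2 * real k) * (2 * real k) * real k"
      using k2 by (intro mult_mono) auto
    also have "\<dots> = 12 * real k ^ 4" by (simp add: eval_nat_numeral)
    finally show "fact (k + 3) / Gamma (real k + \<delta>) \<le> 12 * real k ^ 4" .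
    show "0 \<le> fact (k + 3) / Gamma (real k + \<delta>)" using k2 \<delta> by (intro divide_nonneg_nonneg Gamma_real_nonneg) auto
  qed (use \<delta> D0 in auto)
  also have "\<dots> = 6000 / \<delta> * real k ^ 5 * ?D" by (simp add: eval_nat_numeral)
  finally show ?thesis .
qed

end

section \<open>Removal of the powers of k by the Hecke relations\<close>

lemma rankin_selberg_square:
  fixes \<delta> :: real
  assumes \<delta>: "0 < \<delta>" "4 * \<delta> \<le> 1"
  shows "\<exists>C>0. \<forall>k f lam. normalized_eigenform k f lam \<longrightarrow>
    (rankin_selberg lam (4 * \<delta>))\<^sup>2 \<le> C * rankin_selberg lam \<delta>"
proof -
  obtain C where C: "C > 0" "\<And>lam X. hecke_multiplicative lam \<Longrightarrow>
    (\<Sum>n=1..X. (norm (lam n))\<^sup>2 * real n powr (-1 - 4 * \<delta>))\<^sup>2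
      \<le> C * (\<Sum>l=1..X\<^sup>2. (norm (lam l))\<^sup>2 * real l powr (-1 - \<delta>))"
    using hecke_square_bound[OF \<delta>(1)] by blast
  have "(rankin_selberg lam (4 * \<delta>))\<^sup>2 \<le> C * rankin_selberg lam \<delta>" if "normalized_eigenform k f lam" for k f lam
  proof -
    interpret normalized_eigenform k f lam by fact
    let ?g = "\<lambda>n. (norm (lam n))\<^sup>2 * real n powr (-1 - 4 * \<delta>)"
    have D0: "rankin_selberg lam \<delta> \<ge> 0" using rankin_selberg_partial_le_sum[of \<delta> "{}"] \<delta> by simp
    have "rankin_selberg lam (4 * \<delta>) \<le> sqrt (C * rankin_selberg lam \<delta>)"
      unfolding rankin_selberg_def[of lam "4 * \<delta>"]
    proof (rule suminf_le_const)
      show "summable ?g" using \<delta> by (intro rankin_selberg_summable) auto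
      fix X
      have "sum ?g {..<X} \<le> sum ?g (insert 0 {1..X})" by (intro sum_mono2) auto
      also have "\<dots> = sum ?g {1..X}" by simp
      also have "\<dots> \<le> sqrt (C * rankin_selberg lam \<delta>)"
      proof (rule real_le_rsqrt)
        have "(sum ?g {1..X})\<^sup>2 \<le> C * (\<Sum>l=1..X\<^sup>2. (norm (lam l))\<^sup>2 * real l powr (-1 - \<delta>))"
          by (rule C(2)[OF hecke_multiplicative])
        also have "\<dots> \<le> C * rankin_selberg lam \<delta>"
          using C(1) \<delta> by (intro mult_left_mono rankin_selberg_partial_le_sum) auto
        finally show "(sum ?g {1..X})\<^sup>2 \<le> C * rankin_selberg lam \<delta>" .
      qed
      finally show "sum ?g {..<X} \<le> sqrt (C * rankin_selberg lam \<delta>)" .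
    qed
    moreover have "rankin_selberg lam (4 * \<delta>) \<ge> 0" using rankin_selberg_partial_le_sum[of "4 * \<delta>" "{}"] \<delta> by simp
    ultimately have "(rankin_selberg lam (4 * \<delta>))\<^sup>2 \<le> (sqrt (C * rankin_selberg lam \<delta>))\<^sup>2" by (intro power_mono)
    then show ?thesis using C(1) D0 by simp
  qed
  then show ?thesis using C(1) by blast
qed

text \<open>Each use of the squaring inequality halves the exponent of \<open>k\<close>.\<close>

lemma rankin_selberg_bound_halving:
  "\<forall>\<delta>. 0 < \<delta> \<and> \<delta> \<le> 1 \<longrightarrow> (\<exists>C>0. \<forall>k f lam. normalized_eigenform k f lam \<longrightarrow>
    rankin_selberg lam \<delta> \<le> C * real k powr (10 / 2 ^ j))"
proof (induction j)
  case 0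
  obtain C where C: "C > 0" "\<And>k f lam. normalized_eigenform k f lam \<Longrightarrow>
    (rankin_selberg lam 1)\<^sup>2 \<le> C * rankin_selberg lam (1 / 4)"
    using rankin_selberg_square[of "1 / 4"] by auto
  show ?case
  proof (intro allI impI)
    fix \<delta> :: real assume \<delta>: "0 < \<delta> \<and> \<delta> \<le> 1"
    have "rankin_selberg lam \<delta> \<le> (6000 / \<delta> * (C * 24000)) * real k powr (10 / 2 ^ 0)"
      if "normalized_eigenform k f lam" for k f lam
    proof -
      interpret normalized_eigenform k f lam by fact
      let ?D = "rankin_selberg lam 1"
      have D1: "?D \<ge> 1" by (rule rankin_selberg_ge_1)
      \<comment> \<open>The square of \<open>?D\<close> is bounded by a multiple of
        \<open>?D\<close> itself, so one factor cancels. This starts the iteration with a polynomial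
        bound: \<open>k^5\<close> for \<open>?D\<close>, and \<open>k^10\<close> for every
        \<open>\<delta>\<close>.\<close>
      have "?D * ?D \<le> C * rankin_selberg lam (1 / 4)" using C(2)[OF that] by (simp add: power2_eq_square)
      also have "\<dots> \<le> C * (6000 / (1 / 4) * real k ^ 5 * ?D)"
        using C(1) by (intro mult_left_mono rankin_selberg_le_rankin_selberg_1) auto
      also have "\<dots> = (C * 24000 * real k ^ 5) * ?D" by simp
      finally have D: "?D \<le> C * 24000 * real k ^ 5" using D1 by (subst (asm) mult_le_cancel_right) auto
      have "rankin_selberg lam \<delta> \<le> 6000 / \<delta> * real k ^ 5 * ?D"
        using \<delta> by (intro rankin_selberg_le_rankin_selberg_1) auto
      also have "\<dots> \<le> 6000 / \<delta> * real k ^ 5 * (C * 24000 * real k ^ 5)"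
        using \<delta> by (intro mult_left_mono D) auto
      also have "\<dots> = (6000 / \<delta> * (C * 24000)) * real k ^ 10" by (simp add: eval_nat_numeral)
      also have "real k ^ 10 = real k powr (10 / 2 ^ 0)" using k_pos powr_realpow[of "real k" 10] by simp
      finally show ?thesis .
    qed
    then show "\<exists>C>0. \<forall>k f lam. normalized_eigenform k f lam \<longrightarrow> rankin_selberg lam \<delta> \<le> C * real k powr (10 / 2 ^ 0)"
      using \<delta> C(1) by (intro exI[of _ "6000 / \<delta> * (C * 24000)"]) auto
  qed
next
  case (Suc j)
  show ?case
  proof (intro allI impI)
    fix \<delta> :: real assume \<delta>: "0 < \<delta> \<and> \<delta> \<le> 1"
    obtain C1 where C1: "C1 > 0" "\<And>k f lam. normalized_eigenform k f lam \<Longrightarrow>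
      (rankin_selberg lam \<delta>)\<^sup>2 \<le> C1 * rankin_selberg lam (\<delta> / 4)"
      using rankin_selberg_square[of "\<delta> / 4"] \<delta> by auto
    obtain C2 where C2: "C2 > 0" "\<And>k f lam. normalized_eigenform k f lam \<Longrightarrow>
      rankin_selberg lam (\<delta> / 4) \<le> C2 * real k powr (10 / 2 ^ j)"
      using Suc[rule_format, of "\<delta> / 4"] \<delta> by auto
    have "rankin_selberg lam \<delta> \<le> sqrt (C1 * C2) * real k powr (10 / 2 ^ Suc j)"
      if "normalized_eigenform k f lam" for k f lam
    proof -
      have "(rankin_selberg lam \<delta>)\<^sup>2 \<le> C1 * (C2 * real k powr (10 / 2 ^ j))"
        using C1 C2 that by (meson mult_left_mono less_imp_le order_trans)
      also have "real k powr (10 / 2 ^ j) = (real k powr (10 / 2 ^ Suc j))\<^sup>2"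
        unfolding power2_eq_square powr_add[symmetric] by (simp add: field_simps)
      also have "C1 * (C2 * (real k powr (10 / 2 ^ Suc j))\<^sup>2) = (sqrt (C1 * C2) * real k powr (10 / 2 ^ Suc j))\<^sup>2"
        using C1 C2 by (simp add: power_mult_distrib)
      finally show ?thesis by (rule power2_le_imp_le) (use C1 C2 in auto)
    qed
    then show "\<exists>C>0. \<forall>k f lam. normalized_eigenform k f lam \<longrightarrow> rankin_selberg lam \<delta> \<le> C * real k powr (10 / 2 ^ Suc j)"
      using C1 C2 by (intro exI[of _ "sqrt (C1 * C2)"]) auto
  qed
qed

lemma rankin_selberg_bound:
  fixes \<delta> \<epsilon> :: real
  assumes "0 < \<delta>" "\<delta> \<le> 1" "\<epsilon> > 0"
  shows "\<exists>C>0. \<forall>k f lam. normalized_eigenform k f lam \<longrightarrow> rankin_selberg lam \<delta> \<le> C * real k powr \<epsilon>"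
proof -
  obtain j where "10 / \<epsilon> < 2 ^ j" using real_arch_pow[of 2 "10 / \<epsilon>"] by auto
  then have j: "10 / 2 ^ j \<le> \<epsilon>" using assms(3) by (simp add: field_simps)
  obtain C where C: "C > 0" "\<And>k f lam. normalized_eigenform k f lam \<Longrightarrow>
      rankin_selberg lam \<delta> \<le> C * real k powr (10 / 2 ^ j)"
    using rankin_selberg_bound_halving[rule_format, of \<delta> j] assms by auto
  have "rankin_selberg lam \<delta> \<le> C * real k powr \<epsilon>" if "normalized_eigenform k f lam" for k f lam
  proof -
    interpret normalized_eigenform k f lam by fact
    have "real k powr (10 / 2 ^ j) \<le> real k powr \<epsilon>" using j k_pos by (intro powr_mono) auto
    then show ?thesis using C(2)[OF that] C(1) by (meson mult_left_mono less_imp_le order_trans)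
  qed
  then show ?thesis using C(1) by blast
qed

subsection \<open>Local mass of an eigenform\<close>

lemma nn_integral_power_exp_series:
  fixes c :: "nat \<Rightarrow> real" and s :: real
  assumes c: "\<And>n. c n \<ge> 0" "c 0 = 0" and s: "s > 0"
    and summable: "summable (\<lambda>n. c n / real n powr s)"
  shows "(\<integral>\<^sup>+v. (\<Sum>n. ennreal (c n * (v powr (s - 1) * exp (- (4 * pi * real n) * v)))) * indicator {0..} v \<partial>lborel)
    = ennreal (Gamma s / (4 * pi) powr s * (\<Sum>n. c n / real n powr s))"
proof -
  let ?g = "\<lambda>n v. ennreal (v powr (s - 1) * exp (- (4 * pi * real n) * v)) * indicator {0..} v"
  have "(\<integral>\<^sup>+v. (\<Sum>n. ennreal (c n * (v powr (s - 1) * exp (- (4 * pi * real n) * v)))) * indicator {0..} v \<partial>lborel)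
     = (\<integral>\<^sup>+v. (\<Sum>n. ennreal (c n) * ?g n v) \<partial>lborel)"
    using c by (simp add: ennreal_suminf_multc[symmetric] ennreal_mult mult.assoc)
  also have "\<dots> = (\<Sum>n. \<integral>\<^sup>+v. ennreal (c n) * ?g n v \<partial>lborel)"
    by (rule nn_integral_suminf) measurable
  also have "\<dots> = (\<Sum>n. ennreal (Gamma s / (4 * pi) powr s * (c n / real n powr s)))"
  proof (intro suminf_cong)
    fix n
    show "(\<integral>\<^sup>+v. ennreal (c n) * ?g n v \<partial>lborel)
      = ennreal (Gamma s / (4 * pi) powr s * (c n / real n powr s))"
    proof (cases "n = 0")
      case False
      then show ?thesis using nn_integral_Gamma_scaled[of s "4 * pi * real n"] s c(1)[of n]
        by (subst nn_integral_cmult) (auto simp: ennreal_mult[symmetric] powr_mult field_simps Gamma_real_nonneg)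
    qed (simp add: c)
  qed
  also have "\<dots> = ennreal (\<Sum>n. Gamma s / (4 * pi) powr s * (c n / real n powr s))"
    using c s summable by (intro suminf_ennreal2 summable_mult) (auto intro!: mult_nonneg_nonneg divide_nonneg_nonneg Gamma_real_nonneg)
  also have "(\<Sum>n. Gamma s / (4 * pi) powr s * (c n / real n powr s)) = Gamma s / (4 * pi) powr s * (\<Sum>n. c n / real n powr s)"
    by (intro suminf_mult summable)
  finally show ?thesis .
qed

text \<open>Put \<open>v = p (1 + u)\<close>. The exponential \<open>exp (k u)\<close> agrees with
  \<open>(1 + u)^k\<close> up to \<open>exp (2 k u^2)\<close>, and the condition on \<open>r\<close>
  says that \<open>k u^2 \<le> 1/4\<close>, so this is at most
  \<open>exp (1/2) \<le> 2\<close>.\<close>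

lemma power_le_power_mult_exp:
  fixes p v :: real
  assumes "p > 0" "\<bar>v - p\<bar> \<le> r" "2 * sqrt (real k) * r \<le> p" "k > 0"
  shows "p ^ k * exp (real k * (v - p) / p) \<le> 2 * v ^ k"
proof -
  define u where "u = (v - p) / p"
  have k1: "sqrt (real k) \<ge> 1" using assms by simp
  have ur: "\<bar>u\<bar> * (2 * sqrt (real k)) \<le> 1"
  proof -
    have "\<bar>v - p\<bar> * (2 * sqrt (real k)) \<le> r * (2 * sqrt (real k))"
      using assms by (intro mult_right_mono) auto
    also have "\<dots> \<le> p" using assms by (simp add: mult_ac)
    finally show ?thesis using assms by (simp add: u_def abs_divide field_simps)
  qed
  have "\<bar>u\<bar> * 2 \<le> \<bar>u\<bar> * (2 * sqrt (real k))" using k1 by (intro mult_left_mono) auto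
  with ur have u: "\<bar>u\<bar> \<le> 1 / 2" by linarith
  have "(\<bar>u\<bar> * (2 * sqrt (real k)))\<^sup>2 \<le> 1\<^sup>2" using ur by (intro power_mono) auto
  then have ku: "real k * u\<^sup>2 \<le> 1 / 4" by (simp add: power_mult_distrib mult_ac)
  have v: "v = p * (1 + u)" using assms by (simp add: u_def field_simps)
  have u1: "1 + u > 0" using u by linarith
  have "\<bar>ln (1 + u) - u\<bar> \<le> 2 * u\<^sup>2" using u by (rule abs_ln_one_plus_x_minus_x_bound)
  then have "u \<le> ln (1 + u) + 2 * u\<^sup>2" by linarith
  then have "real k * u \<le> real k * (ln (1 + u) + 2 * u\<^sup>2)" by (intro mult_left_mono) auto
  also have "\<dots> \<le> real k * ln (1 + u) + 1 / 2" using ku by (simp add: distrib_left)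
  finally have "exp (real k * u) \<le> exp (real k * ln (1 + u) + 1 / 2)" by simp
  also have "\<dots> = (1 + u) ^ k * exp (1 / 2)"
    using u1 by (simp add: exp_add exp_of_nat_mult)
  also have "\<dots> \<le> (1 + u) ^ k * 2"
  proof -
    have "exp (1 / 2 :: real) ^ 2 \<le> 2 ^ 2"
      using exp_le by (simp flip: exp_of_nat_mult)
    then have "exp (1 / 2 :: real) \<le> 2" by (rule power2_le_imp_le) simp
    then show ?thesis using u1 by (intro mult_left_mono) auto
  qed
  finally have "p ^ k * exp (real k * u) \<le> p ^ k * ((1 + u) ^ k * 2)"
    using assms by (intro mult_left_mono) auto
  then have "p ^ k * exp (real k * u) \<le> 2 * (p * (1 + u)) ^ k" by (simp add: power_mult_distrib mult_ac)
  moreover have "real k * (v - p) / p = real k * u" by (simp add: u_def)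
  ultimately show ?thesis by (simp only: v[symmetric])
qed

context normalized_eigenform begin

text \<open>Extended by 0 below the real axis, where \<open>f\<close> is arbitrary,
  \<open>F^2\<close> is a Borel function on the whole plane and Tonelli's theorem applies.\<close>

definition W :: "complex \<Rightarrow> ennreal" where
  "W w = ennreal (indicator upper_half_plane w * wnorm w)"

lemma W_eq: "Im w > 0 \<Longrightarrow> W w = ennreal (wnorm w)"
  by (simp add: W_def upper_half_plane_def)

lemma open_upper_half_plane: "open upper_half_plane"
  unfolding upper_half_plane_def by (rule open_halfspace_Im_gt)

lemma W_measurable [measurable]: "W \<in> borel_measurable borel"
proof -
  have "(\<lambda>w. indicator upper_half_plane w *\<^sub>R wnorm w) \<in> borel_measurable borel"
    unfolding wnorm_def
    by (intro borel_measurable_continuous_on_indicator continuous_intros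
        holomorphic_on_imp_continuous_on[OF holomorphic] borel_open open_upper_half_plane)
  then show ?thesis unfolding W_def by simp
qed

lemma nn_integral_horizontal:
  assumes v: "v > 0"
  shows "(\<integral>\<^sup>+u. W (Complex u v) * indicator {a..a + 1} u \<partial>lborel)
    = ennreal (v ^ k * (\<Sum>n. (norm (coeff n))\<^sup>2 * exp (- (4 * pi * real n) * v)))"
    "summable (\<lambda>n. (norm (coeff n))\<^sup>2 * exp (- (4 * pi * real n) * v))"
proof -
  interpret abs_fourier "\<lambda>n. coeff n * of_real (exp (- (2 * pi * real n * v)))" "\<lambda>x. f (Complex x v)"
    using v by (rule fourier)
  let ?t = "\<lambda>n. (norm (coeff n))\<^sup>2 * exp (- (4 * pi * real n) * v)"
  have t: "(norm (coeff n * of_real (exp (- (2 * pi * real n * v)))))\<^sup>2 = ?t n" for n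
    by (simp add: norm_mult power_mult_distrib power2_eq_square flip: exp_add)
  show "summable (\<lambda>n. ?t n)"
    using parseval(2) by (simp only: t)
  have "((\<lambda>u. v ^ k * (norm (f (Complex u v)))\<^sup>2) has_integral v ^ k * (\<Sum>n. ?t n)) {a..a + 1}"
    unfolding t[symmetric] by (intro has_integral_mult_right parseval)
  then have "(\<integral>\<^sup>+u. ennreal (v ^ k * (norm (f (Complex u v)))\<^sup>2) * indicator {a..a + 1} u \<partial>lborel)
    = ennreal (v ^ k * (\<Sum>n. ?t n))"
    using v by (intro nn_integral_has_integral_lebesgue') auto
  then show "(\<integral>\<^sup>+u. W (Complex u v) * indicator {a..a + 1} u \<partial>lborel)
    = ennreal (v ^ k * (\<Sum>n. ?t n))"
    using v by (simp add: W_eq wnorm_def)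
qed

text \<open>The interval is covered by unit periods, on each of which Parseval is exact. The lower
  bound 1/5 for \<open>q\<close> makes their number proportional to \<open>q\<close>: it is at most
  \<open>4 q + 1 \<le> 9 q\<close>. Near the real axis this would fail.\<close>

lemma nn_integral_horizontal_le:
  assumes v: "v > 0" and q: "q \<ge> 1 / 5"
  shows "(\<integral>\<^sup>+u. W (Complex u v) * indicator {x - 2 * q..x + 2 * q} u \<partial>lborel)
    \<le> ennreal (9 * q * v ^ k) * (\<Sum>n. ennreal ((norm (coeff n))\<^sup>2 * exp (- (4 * pi * real n) * v)))"
proof -
  define L where "L = nat \<lceil>4 * q\<rceil>"
  let ?a = "x - 2 * q"
  let ?S = "\<Sum>n. (norm (coeff n))\<^sup>2 * exp (- (4 * pi * real n) * v)"
  let ?h = "\<lambda>i u. W (Complex u v) * indicator {?a + real i..?a + real i + 1} u"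
  have S: "?S \<ge> 0" by (intro suminf_nonneg nn_integral_horizontal(2) v) auto
  have L: "4 * q \<le> real L" "real L \<le> 9 * q" using q unfolding L_def by linarith+
  have "(\<integral>\<^sup>+u. W (Complex u v) * indicator {x - 2 * q..x + 2 * q} u \<partial>lborel)
    \<le> (\<integral>\<^sup>+u. (\<Sum>i<L. ?h i u) \<partial>lborel)"
  proof (intro nn_integral_mono)
    fix u
    show "W (Complex u v) * indicator {x - 2 * q..x + 2 * q} u
       \<le> (\<Sum>i<L. ?h i u)"
    proof (cases "u \<in> {x - 2 * q..x + 2 * q}")
      case True
      have "\<exists>i<L. u \<in> {?a + real i..?a + real i + 1}"
      \<comment> \<open>If \<open>4 q\<close> is an integer, the floor of \<open>u - ?a\<close> at
        the right endpoint is \<open>L\<close>, one too large; there the closed last interval is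
        taken instead.\<close>
      proof (cases "u = x + 2 * q")
        case True
        have "L > 0" using L q by (cases L) auto
        then have "real (L - 1) = real L - 1" by simp
        moreover have "real L < 4 * q + 1" using q unfolding L_def by linarith
        ultimately show ?thesis using True L \<open>L > 0\<close> by (intro exI[of _ "L - 1"]) auto
      next
        case False
        define i where "i = nat \<lfloor>u - ?a\<rfloor>"
        have i: "real i \<le> u - ?a" "u - ?a < real i + 1" using \<open>u \<in> _\<close> unfolding i_def by auto
        moreover have "real i < real L" using i L False \<open>u \<in> _\<close> by auto
        ultimately show ?thesis by (intro exI[of _ i]) auto
      qed
      then obtain i where i: "i < L" "u \<in> {?a + real i..?a + real i + 1}" by blast
      have "W (Complex u v) * indicator {x - 2 * q..x + 2 * q} u = ?h i u"
        using True i by simp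
      also have "\<dots> \<le> (\<Sum>i<L. ?h i u)"
        using i by (intro member_le_sum) auto
      finally show ?thesis .
    qed simp
  qed
  also have "\<dots> = (\<Sum>i<L. \<integral>\<^sup>+u. ?h i u \<partial>lborel)"
    by (intro nn_integral_sum) measurable
  also have "\<dots> = ennreal (real L) * ennreal (v ^ k * ?S)"
    using v by (simp add: nn_integral_horizontal(1) ennreal_of_nat_eq_real_of_nat)
  also have "\<dots> \<le> ennreal (9 * q) * ennreal (v ^ k * ?S)"
    using L by (intro mult_right_mono ennreal_leI) auto
  also have "\<dots> = ennreal (9 * q * v ^ k) * ennreal ?S"
    using q v S by (simp add: ennreal_mult[symmetric] mult.assoc)
  also have "ennreal ?S = (\<Sum>n. ennreal ((norm (coeff n))\<^sup>2 * exp (- (4 * pi * real n) * v)))"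
    by (intro suminf_ennreal2[symmetric] nn_integral_horizontal(2) v) auto
  finally show ?thesis .
qed

text \<open>Up to the Euclidean area factor \<open>q^2\<close>, a bound for the mass of
  \<open>F^2\<close> on a box of size \<open>q\<close>. In \<open>720 = 9 * 4 * 20\<close> the 9
  counts periods, the 4 comes from \<open>v \<le> 4 q\<close> and the 20 from
  \<open>1 \<le> 20 v\<close>.\<close>

definition cusp_const :: "real \<Rightarrow> real" where
  "cusp_const \<delta> = 720 * (Gamma (real k + \<delta>) / (4 * pi) powr (real k + \<delta>) * rankin_selberg lam \<delta>)"

lemma cusp_const_nonneg: "0 < \<delta> \<Longrightarrow> \<delta> \<le> 1 \<Longrightarrow> cusp_const \<delta> \<ge> 0"
  unfolding cusp_const_def using rankin_selberg_partial_le_sum[of \<delta> "{}"]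
  by (intro mult_nonneg_nonneg divide_nonneg_nonneg Gamma_real_nonneg) auto

text \<open>On the box one factor \<open>v\<close> is at most \<open>4 q\<close>, and a factor
  \<open>v^\<delta>\<close> may be inserted because \<open>20 v \<ge> 1\<close>. This replaces
  \<open>v^k\<close> by \<open>q v^(s-1)\<close> with \<open>s = k + \<delta>\<close>; extended over
  all \<open>v > 0\<close>, the integral is then a Gamma factor times the series at
  \<open>\<delta>\<close>.\<close>

lemma nn_integral_box_le:
  assumes q: "q \<ge> 1 / 5" and \<delta>: "0 < \<delta>" "\<delta> \<le> 1"
  shows "(\<integral>\<^sup>+v. \<integral>\<^sup>+u. W (Complex u v) * indicator {x - 2 * q..x + 2 * q} u * indicator {q / 4..4 * q} v \<partial>lborel \<partial>lborel)
    \<le> ennreal (q\<^sup>2 * cusp_const \<delta>)"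
proof -
  define s where "s = real k + \<delta>"
  let ?c = "\<lambda>n. (norm (coeff n))\<^sup>2"
  let ?V = "\<lambda>u v. W (Complex u v) * indicator {x - 2 * q..x + 2 * q} u * indicator {q / 4..4 * q} v"
  let ?E = "\<lambda>n v. ennreal (?c n * (v powr (s - 1) * exp (- (4 * pi * real n) * v)))"
  have s: "s > 0" using \<delta> by (simp add: s_def)
  have c: "?c n / real n powr s = (norm (lam n))\<^sup>2 * real n powr (-1 - \<delta>)" for n
  proof (cases "n = 0")
    case False
    have "real n powr (-1 - \<delta>) = real n powr (real k - 1) / real n powr s"
      by (simp add: s_def powr_diff[symmetric])
    then show ?thesis using False by (simp add: norm_coeff_sq)
  qed simp
  have "(\<integral>\<^sup>+v. \<integral>\<^sup>+u. ?V u v \<partial>lborel \<partial>lborel)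
    \<le> (\<integral>\<^sup>+v. ennreal (720 * q\<^sup>2) * ((\<Sum>n. ?E n v) * indicator {0..} v) \<partial>lborel)"
  proof (intro nn_integral_mono)
    fix v :: real
    show "(\<integral>\<^sup>+u. ?V u v \<partial>lborel)
     \<le> ennreal (720 * q\<^sup>2) * ((\<Sum>n. ?E n v) * indicator {0..} v)"
    proof (cases "v \<in> {q / 4..4 * q}")
      case True
      then have v: "v > 0" "1 \<le> 20 * v" using q by auto
      have "9 * q * v ^ k \<le> 720 * q\<^sup>2 * v powr (s - 1)"
      proof -
        have "1 \<le> (20 * v) powr \<delta>" using v \<delta> by (intro ge_one_powr_ge_zero) auto
        also have "\<dots> = 20 powr \<delta> * v powr \<delta>" by (rule powr_mult)
        also have "\<dots> \<le> 20 * v powr \<delta>" using \<delta> powr_mono[of \<delta> 1 "20 :: real"] by (intro mult_right_mono) auto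
        finally have 1: "1 \<le> 20 * v powr \<delta>" .
        have "v ^ k = v * v powr (real k - 1)" using v by (simp add: powr_diff powr_realpow)
        also have "\<dots> \<le> (4 * q) * v powr (real k - 1) * (20 * v powr \<delta>)"
        proof -
          have "v * v powr (real k - 1) * 1 \<le> (4 * q) * v powr (real k - 1) * (20 * v powr \<delta>)"
            using True v q 1 by (intro mult_mono) auto
          then show ?thesis by simp
        qed
        also have "\<dots> = 80 * q * v powr (s - 1)"
          by (simp add: s_def powr_add[symmetric] algebra_simps)
        finally have "9 * q * v ^ k \<le> 9 * q * (80 * q * v powr (s - 1))" using q by (intro mult_left_mono) auto
        then show ?thesis by (simp add: power2_eq_square)
      qed
      then have le: "ennreal (9 * q * v ^ k) \<le> ennreal (720 * q\<^sup>2) * ennreal (v powr (s - 1))"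
        by (simp add: ennreal_mult[symmetric] ennreal_leI)
      have "(\<integral>\<^sup>+u. ?V u v \<partial>lborel)
        \<le> ennreal (9 * q * v ^ k) * (\<Sum>n. ennreal (?c n * exp (- (4 * pi * real n) * v)))"
        using True nn_integral_horizontal_le[OF v(1) q] by simp
      also have "\<dots> \<le> ennreal (720 * q\<^sup>2) * ennreal (v powr (s - 1)) * (\<Sum>n. ennreal (?c n * exp (- (4 * pi * real n) * v)))"
        by (intro mult_right_mono le) simp
      also have "\<dots> = ennreal (720 * q\<^sup>2) * (\<Sum>n. ennreal (v powr (s - 1)) * ennreal (?c n * exp (- (4 * pi * real n) * v)))"
        by (simp add: mult.assoc)
      also have "(\<Sum>n. ennreal (v powr (s - 1)) * ennreal (?c n * exp (- (4 * pi * real n) * v)))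
          = (\<Sum>n. ?E n v)"
        by (intro suminf_cong) (simp add: ennreal_mult[symmetric] mult_ac)
      finally have "(\<integral>\<^sup>+u. ?V u v \<partial>lborel)
        \<le> ennreal (720 * q\<^sup>2) * (\<Sum>n. ?E n v)" .
      moreover have "indicator {0..} v = (1 :: ennreal)" using v(1) by simp
      ultimately show ?thesis by (simp only: mult_1_right)
    qed simp
  qed
  also have "\<dots> = ennreal (720 * q\<^sup>2) * ennreal (Gamma s / (4 * pi) powr s * (\<Sum>n. ?c n / real n powr s))"
  proof (subst nn_integral_cmult)
    have "summable (\<lambda>n. ?c n / real n powr s)" unfolding c by (rule rankin_selberg_summable[OF \<delta>])
    then show "ennreal (720 * q\<^sup>2) * (\<integral>\<^sup>+v. (\<Sum>n. ?E n v) * indicator {0..} v \<partial>lborel)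
      = ennreal (720 * q\<^sup>2) * ennreal (Gamma s / (4 * pi) powr s * (\<Sum>n. ?c n / real n powr s))"
      using s by (subst nn_integral_power_exp_series) auto
  qed measurable
  also have "(\<Sum>n. ?c n / real n powr s) = rankin_selberg lam \<delta>" by (simp only: c rankin_selberg_def)
  also have "ennreal (720 * q\<^sup>2) * ennreal (Gamma s / (4 * pi) powr s * rankin_selberg lam \<delta>)
      = ennreal (720 * q\<^sup>2 * (Gamma s / (4 * pi) powr s * rankin_selberg lam \<delta>))"
    using cusp_const_nonneg[OF \<delta>] by (intro ennreal_mult[symmetric]) (auto simp: cusp_const_def s_def)
  also have "720 * q\<^sup>2 * (Gamma s / (4 * pi) powr s * rankin_selberg lam \<delta>) = q\<^sup>2 * cusp_const \<delta>"
    by (simp add: cusp_const_def s_def)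
  finally show ?thesis .
qed

text \<open>The factor \<open>exp (- i k (w - z) / Im z)\<close> removes the first-order variation of the weight
  \<open>(Im w)\<^sup>k\<close>, so that squares of side as large as \<open>Im z / \<surd>k\<close> are admissible.\<close>

lemma wnorm_mean_value:
  assumes z: "Im z > 0" and r: "r > 0" "2 * sqrt (real k) * r \<le> Im z"
  shows "ennreal (r\<^sup>2 * wnorm z) \<le> 8 * (\<integral>\<^sup>+v. \<integral>\<^sup>+u. W (Complex u v) * indicator {Re z - r..Re z + r} u * indicator {Im z - r..Im z + r} v \<partial>lborel \<partial>lborel)"
proof -
  define p where "p = Im z"
  define g where "g = (\<lambda>w. (f w)\<^sup>2 * exp (- \<i> * of_real (real k / p) * (w - z)))"
  have p: "p > 0" using z by (simp add: p_def)
  have rp: "r < p"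
  proof -
    have "1 < 2 * sqrt (real k)" using k_pos by (simp add: less_le_trans[of 1 "2 * 1"])
    then have "1 * r < 2 * sqrt (real k) * r" using r by (intro mult_strict_right_mono)
    then show ?thesis using r(2) unfolding p_def by linarith
  qed
  have sub: "cbox (Complex (Re z - r) (p - r)) (Complex (Re z + r) (p + r)) \<subseteq> upper_half_plane"
    using rp by (auto simp: in_cbox_complex_iff upper_half_plane_def)
  have hol: "g holomorphic_on cbox (Complex (Re z - r) (p - r)) (Complex (Re z + r) (p + r))"
    unfolding g_def by (intro holomorphic_intros holomorphic_on_subset[OF holomorphic sub])
  have norm_g: "norm (g w) = (norm (f w))\<^sup>2 * exp (real k * (Im w - p) / p)" for w
    by (simp add: g_def norm_mult norm_power p_def)
  have zz: "Complex (Re z) p = z" by (simp add: p_def)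
  let ?V = "\<lambda>u v. W (Complex u v) * indicator {Re z - r..Re z + r} u * indicator {p - r..p + r} v"
  have "ennreal (r\<^sup>2 * wnorm z) = ennreal (p ^ k) * ennreal (r\<^sup>2 * norm (g (Complex (Re z) p)))"
    using p by (simp add: zz norm_g wnorm_def p_def[symmetric] ennreal_mult[symmetric] mult_ac)
  also have "\<dots> \<le> ennreal (p ^ k) * (4 * (\<integral>\<^sup>+v. \<integral>\<^sup>+u. ennreal (norm (g (Complex u v))) * indicator {Re z - r..Re z + r} u * indicator {p - r..p + r} v \<partial>lborel \<partial>lborel))"
    by (intro mult_left_mono square_mean_value hol r) simp
  also have "\<dots> \<le> ennreal (p ^ k) * (4 * (\<integral>\<^sup>+v. \<integral>\<^sup>+u. ennreal (2 / p ^ k) * ?V u v \<partial>lborel \<partial>lborel))"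
  proof (intro mult_left_mono nn_integral_mono)
    fix u v
    show "ennreal (norm (g (Complex u v))) * indicator {Re z - r..Re z + r} u * indicator {p - r..p + r} v
       \<le> ennreal (2 / p ^ k) * ?V u v"
    proof (cases "v \<in> {p - r..p + r}")
      case True
      then have v: "v > 0" "\<bar>v - p\<bar> \<le> r" using rp by auto
      have "p ^ k * exp (real k * (v - p) / p) \<le> 2 * v ^ k"
        using p v r k_pos by (intro power_le_power_mult_exp) (auto simp: p_def)
      then have "exp (real k * (v - p) / p) \<le> 2 / p ^ k * v ^ k" using p by (simp add: field_simps)
      then have "norm (g (Complex u v)) \<le> (norm (f (Complex u v)))\<^sup>2 * (2 / p ^ k * v ^ k)"
        unfolding norm_g by (intro mult_left_mono) auto
      also have "\<dots> = 2 / p ^ k * wnorm (Complex u v)" by (simp add: wnorm_def)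
      finally have "ennreal (norm (g (Complex u v))) \<le> ennreal (2 / p ^ k) * W (Complex u v)"
        using v p by (simp add: W_eq ennreal_mult[symmetric] ennreal_leI wnorm_nonneg)
      then show ?thesis by (simp add: mult.assoc[symmetric] mult_right_mono)
    qed simp
  qed auto
  also have "\<dots> = ennreal (p ^ k) * (4 * (ennreal (2 / p ^ k) * (\<integral>\<^sup>+v. \<integral>\<^sup>+u. ?V u v \<partial>lborel \<partial>lborel)))"
  proof -
    have "(\<integral>\<^sup>+u. ennreal (2 / p ^ k) * ?V u v \<partial>lborel)
      = ennreal (2 / p ^ k) * (\<integral>\<^sup>+u. ?V u v \<partial>lborel)" for v
      by (rule nn_integral_cmult) measurable
    moreover have "(\<lambda>v. \<integral>\<^sup>+u. ?V u v \<partial>lborel) \<in> borel_measurable lborel"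
      by measurable
    ultimately show ?thesis by (simp only: nn_integral_cmult)
  qed
  also have "\<dots> = (ennreal (p ^ k) * ennreal (2 / p ^ k) * 4) * (\<integral>\<^sup>+v. \<integral>\<^sup>+u. ?V u v \<partial>lborel \<partial>lborel)"
    by (simp add: mult_ac)
  also have "ennreal (p ^ k) * ennreal (2 / p ^ k) * 4 = 8"
    using p by (simp add: ennreal_mult[symmetric] flip: ennreal_numeral)
  finally show ?thesis by (simp add: p_def)
qed

end

subsection \<open>Restriction to vertical segments\<close>

lemma moebius_measurable [measurable (raw)]:
  assumes [measurable]: "g \<in> borel_measurable M"
  shows "(\<lambda>t. moebius a b c d (g t)) \<in> borel_measurable M"
  unfolding moebius_def by measurable

text \<open>The segment has bounded hyperbolic length: \<open>(t - Y)^2 \<le> t Y / 2\<close> on it.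
  By invariance \<open>\<bar>z - z0\<bar>^2 \<le> p q / 2\<close> for the images, with
  \<open>p\<close> and \<open>q\<close> their heights. The resulting quadratic inequality in
  \<open>p\<close> factors as \<open>(p - 2 q) (p - q / 2) \<le> 0\<close>, and the bound for the
  real parts follows.\<close>

lemma moebius_vertical_near:
  fixes x :: real
  assumes det: "a * d - b * c = 1" and Y: "Y > 0" "t \<in> {Y..2 * Y}"
  defines "z0 \<equiv> moebius a b c d (Complex x Y)" and "z \<equiv> moebius a b c d (Complex x t)"
  shows "Im z0 / 2 \<le> Im z" "Im z \<le> 2 * Im z0" "\<bar>Re z - Re z0\<bar> \<le> Im z0"
proof -
  have t: "t > 0" using Y by auto
  define p q where "p = Im z" and "q = Im z0"
  have pq: "p > 0" "q > 0" using moebius_upper_half_plane[OF det] Y t by (auto simp: p_def q_def z_def z0_def)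
  have n: "(norm (z - z0))\<^sup>2 = (Re z - Re z0)\<^sup>2 + (p - q)\<^sup>2" by (simp add: cmod_power2 p_def q_def)
  have "(norm (z - z0))\<^sup>2 * (t * Y) = (t - Y)\<^sup>2 * (p * q)"
    using norm_moebius_diff[OF det, of "Complex x t" "Complex x Y"] Y t
    by (simp add: z_def z0_def p_def q_def cmod_power2)
  also have "\<dots> \<le> (t * Y / 2) * (p * q)"
  proof (rule mult_right_mono)
    have "(t - Y)\<^sup>2 \<le> (t - Y) * Y" using Y by (simp add: power2_eq_square mult_left_mono)
    also have "\<dots> \<le> t / 2 * Y" using Y by (intro mult_right_mono) auto
    finally show "(t - Y)\<^sup>2 \<le> t * Y / 2" by simp
  qed (use pq in auto)
  also have "\<dots> = p * q / 2 * (t * Y)" by simp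
  finally have le: "(Re z - Re z0)\<^sup>2 + (p - q)\<^sup>2 \<le> p * q / 2" using Y t unfolding n by simp
  then have "(p - q)\<^sup>2 \<le> p * q / 2" by (smt (verit) zero_le_power2)
  then have prod: "(p - 2 * q) * (p - q / 2) \<le> 0" by (simp add: power2_eq_square algebra_simps)
  have p2: "p \<le> 2 * q" and p1: "q / 2 \<le> p"
    using prod pq by (auto simp: mult_le_0_iff)
  show "Im z0 / 2 \<le> Im z" "Im z \<le> 2 * Im z0" using p1 p2 by (auto simp: p_def q_def)
  have "(Re z - Re z0)\<^sup>2 \<le> p * q / 2" using le by (smt (verit) zero_le_power2)
  also have "\<dots> \<le> (2 * q) * q / 2" using p2 pq by (intro divide_right_mono mult_right_mono) auto
  finally have "(Re z - Re z0)\<^sup>2 \<le> q\<^sup>2" by (simp add: power2_eq_square)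
  then show "\<bar>Re z - Re z0\<bar> \<le> Im z0" using pq abs_le_square_iff[of "Re z - Re z0" q] by (simp add: q_def)
qed

text \<open>Two points of the segment with images in a common small square are themselves close, because
  \<open>\<bar>z - w\<bar>\<^sup>2 / (Im z Im w)\<close> is invariant.\<close>

lemma moebius_vertical_in_square:
  fixes x :: real
  assumes det: "a * d - b * c = 1" and Y: "Y > 0" and r: "r > 0"
  defines "q \<equiv> Im (moebius a b c d (Complex x Y))"
  shows "(\<integral>\<^sup>+t. (if \<bar>u - Re (moebius a b c d (Complex x t))\<bar> \<le> r \<and> \<bar>v - Im (moebius a b c d (Complex x t))\<bar> \<le> r \<and> t \<in> {Y..2 * Y} then 1 else 0) \<partial>lborel)
    \<le> ennreal (24 * Y * r / q)"
proof -
  let ?z = "\<lambda>t. moebius a b c d (Complex x t)"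
  let ?P = "\<lambda>t. \<bar>u - Re (?z t)\<bar> \<le> r \<and> \<bar>v - Im (?z t)\<bar> \<le> r \<and> t \<in> {Y..2 * Y}"
  define A where "A = {t. ?P t}"
  have q: "q > 0" using moebius_upper_half_plane[OF det] Y by (auto simp: q_def)
  \<comment> \<open>The squared distance comes out as at most \<open>128 r^2 Y^2 / q^2\<close>,
    where \<open>128 = 8 * 4 * 4\<close>; this is rounded up to the square
    \<open>144 r^2 Y^2 / q^2\<close>.\<close>
  define h where "h = 12 * Y * r / q"
  have h: "h \<ge> 0" using Y r q by (simp add: h_def)
  have near: "\<bar>s - t\<bar> \<le> h" if "s \<in> A" "t \<in> A" for s t
  proof -
    have st: "s \<in> {Y..2 * Y}" "t \<in> {Y..2 * Y}" using that by (auto simp: A_def)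
    have pos: "s > 0" "t > 0" using st Y by auto
    have im: "q / 2 \<le> Im (?z s)" "q / 2 \<le> Im (?z t)"
      using moebius_vertical_near(1)[OF det Y st(1)] moebius_vertical_near(1)[OF det Y st(2)] by (auto simp: q_def)
    have "(norm (?z s - ?z t))\<^sup>2 \<le> (2 * r)\<^sup>2 + (2 * r)\<^sup>2"
      unfolding cmod_power2 using that r
      by (intro add_mono abs_le_square_iff[THEN iffD1]) (auto simp: A_def)
    then have n: "(norm (?z s - ?z t))\<^sup>2 \<le> 8 * r\<^sup>2" by (simp add: power_mult_distrib)
    have "(s - t)\<^sup>2 * (q / 2 * (q / 2)) \<le> (s - t)\<^sup>2 * (Im (?z s) * Im (?z t))"
      using im q by (intro mult_left_mono mult_mono) auto
    also have "\<dots> = (norm (?z s - ?z t))\<^sup>2 * (s * t)"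
      using norm_moebius_diff[OF det, of "Complex x s" "Complex x t"] pos by (simp add: cmod_power2)
    also have "\<dots> \<le> (8 * r\<^sup>2) * ((2 * Y) * (2 * Y))"
      using n st pos by (intro mult_mono) auto
    finally have "(s - t)\<^sup>2 \<le> 128 * r\<^sup>2 * Y\<^sup>2 / q\<^sup>2"
      using q by (simp add: power2_eq_square field_simps)
    also have "\<dots> \<le> 144 * r\<^sup>2 * Y\<^sup>2 / q\<^sup>2" by (intro divide_right_mono mult_right_mono) auto
    also have "\<dots> = h\<^sup>2" by (simp add: h_def power_divide power_mult_distrib)
    finally show ?thesis using h abs_le_square_iff[of "s - t" h] by simp
  qed
  have "(\<integral>\<^sup>+t. (if ?P t then 1 else 0) \<partial>lborel)
      \<le> ennreal (2 * h)"
  proof (cases "A = {}")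
    case True
    then have "(if ?P t then 1 else 0 :: ennreal) = 0" for t
      unfolding A_def by auto
    then show ?thesis by (simp only:) simp
  next
    case False
    then obtain s where s: "s \<in> A" by blast
    have "(\<integral>\<^sup>+t. (if ?P t then 1 else 0) \<partial>lborel)
      \<le> (\<integral>\<^sup>+t. indicator {s - h..s + h} t \<partial>lborel)"
    proof (intro nn_integral_mono)
      fix t
      show "(if ?P t then 1 else 0) \<le> (indicator {s - h..s + h} t :: ennreal)"
        using near[OF s, of t] by (auto simp: A_def indicator_def)
    qed
    also have "\<dots> = ennreal (2 * h)" using h by simp
    finally show ?thesis .
  qed
  also have "2 * h = 24 * Y * r / q" by (simp add: h_def)
  finally show ?thesis .
qed

context normalized_eigenform begin

lemma vertical_segment_le:
  assumes Y: "Y > 0" and \<delta>: "0 < \<delta>" "\<delta> \<le> 1"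
  shows "(\<integral>\<^sup>+t. W (Complex x t) * ennreal (1 / t) * indicator {Y..2 * Y} t \<partial>lborel)
    \<le> ennreal (768 * sqrt (real k) * cusp_const \<delta>)"
proof -
  let ?T = "\<integral>\<^sup>+t. W (Complex x t) * ennreal (1 / t) * indicator {Y..2 * Y} t \<partial>lborel"
  \<comment> \<open>Only the lower endpoint of the segment is moved up explicitly;
    \<open>moebius_vertical_near\<close> keeps the images of the other points in a box around its
    image.\<close>
  obtain a b c d where det: "a * d - b * c = 1" and high: "Im (moebius a b c d (Complex x Y)) \<ge> 1 / 5"
    using exists_moebius_Im_ge[of "Complex x Y"] Y by auto
  define z where "z = (\<lambda>t. moebius a b c d (Complex x t))"
  define q x0 where "q = Im (z Y)" and "x0 = Re (z Y)"
  have q: "q \<ge> 1 / 5" using high by (simp add: q_def z_def)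
  \<comment> \<open>All images have height at least \<open>q / 2\<close>, so this \<open>r\<close>
    satisfies \<open>2 sqrt k r \<le> Im (z t)\<close> along the whole segment, and it is the
    largest value for which this is guaranteed.\<close>
  define r where "r = q / (4 * sqrt (real k))"
  have sk: "sqrt (real k) \<ge> 1" using k_pos by simp
  have r: "r > 0" "4 * sqrt (real k) * r = q" using q k_pos by (auto simp: r_def)
  have "4 * 1 * r \<le> 4 * sqrt (real k) * r" using r sk by (intro mult_right_mono mult_left_mono) auto
  then have rq: "r \<le> q / 4" using r by simp
  have [measurable]: "z \<in> borel_measurable borel" unfolding z_def by measurable
  have near: "q / 2 \<le> Im (z t)" "Im (z t) \<le> 2 * q" "\<bar>Re (z t) - x0\<bar> \<le> q" if "t \<in> {Y..2 * Y}" for t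
    using moebius_vertical_near[OF det Y that, of x] by (simp_all add: z_def q_def x0_def)
  define B :: "real \<Rightarrow> real \<Rightarrow> real \<Rightarrow> ennreal"
    where "B = (\<lambda>t u v. if \<bar>u - Re (z t)\<bar> \<le> r \<and> \<bar>v - Im (z t)\<bar> \<le> r \<and> t \<in> {Y..2 * Y} then 1 else 0)"
  define V where "V = (\<lambda>u v. W (Complex u v) * indicator {x0 - 2 * q..x0 + 2 * q} u * indicator {q / 4..4 * q} v)"
  let ?I = "\<lambda>t. \<integral>\<^sup>+v. \<integral>\<^sup>+u. V u v * B t u v \<partial>lborel \<partial>lborel"
  have point: "ennreal (r\<^sup>2) * (W (Complex x t) * ennreal (1 / t) * indicator {Y..2 * Y} t)
      \<le> ennreal (8 / Y) * ?I t" for t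
  proof (cases "t \<in> {Y..2 * Y}")
    case True
    have t: "t > 0" using True Y by auto
    have zt: "Im (z t) > 0" unfolding z_def using t by (intro moebius_upper_half_plane[OF det]) auto
    note nt = near[OF True]
    let ?S = "\<lambda>u v. W (Complex u v) * indicator {Re (z t) - r..Re (z t) + r} u * indicator {Im (z t) - r..Im (z t) + r} v"
    have "ennreal (r\<^sup>2) * (W (Complex x t) * ennreal (1 / t)) \<le> ennreal (1 / Y) * ennreal (r\<^sup>2 * wnorm (z t))"
    proof -
      have "wnorm (z t) = wnorm (Complex x t)" unfolding z_def using t by (intro wnorm_moebius[OF det]) auto
      moreover have "r\<^sup>2 * (wnorm (Complex x t) * (1 / t)) \<le> 1 / Y * (r\<^sup>2 * wnorm (Complex x t))"
      proof -
        have "1 / t \<le> 1 / Y" using True Y by (intro divide_left_mono) auto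
        then have "(r\<^sup>2 * wnorm (Complex x t)) * (1 / t) \<le> (r\<^sup>2 * wnorm (Complex x t)) * (1 / Y)"
          using wnorm_nonneg[of "Complex x t"] t by (intro mult_left_mono) auto
        then show ?thesis by (simp add: mult_ac)
      qed
      ultimately show ?thesis using t Y wnorm_nonneg[of "Complex x t"]
        by (simp add: W_eq ennreal_mult[symmetric] ennreal_leI del: times_divide_eq_right times_divide_eq_left)
    qed
    also have "ennreal (r\<^sup>2 * wnorm (z t)) \<le> 8 * (\<integral>\<^sup>+v. \<integral>\<^sup>+u. ?S u v \<partial>lborel \<partial>lborel)"
      using zt r nt by (intro wnorm_mean_value) linarith+
    also have "(\<integral>\<^sup>+v. \<integral>\<^sup>+u. ?S u v \<partial>lborel \<partial>lborel)
       \<le> ?I t"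
    proof (intro nn_integral_mono)
      fix u v
      show "?S u v \<le> V u v * B t u v"
      proof (cases "\<bar>u - Re (z t)\<bar> \<le> r \<and> \<bar>v - Im (z t)\<bar> \<le> r")
        case uv: True
        then have "u \<in> {x0 - 2 * q..x0 + 2 * q}" "v \<in> {q / 4..4 * q}"
          using nt rq q by (auto simp: abs_le_iff)
        then show ?thesis using uv True by (simp add: V_def B_def indicator_def)
      next
        case False
        then have "indicator {Re (z t) - r..Re (z t) + r} u * indicator {Im (z t) - r..Im (z t) + r} v = (0 :: ennreal)"
          by (auto simp: indicator_def abs_le_iff)
        then show ?thesis by (auto simp: mult.assoc)
      qed
    qed
    also have "ennreal (1 / Y) * (8 * ?I t)
       = ennreal (8 / Y) * ?I t"
    proof -
      have "ennreal (1 / Y) * 8 = ennreal (8 / Y)" using Y by (simp add: ennreal_mult[symmetric] flip: ennreal_numeral)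
      then show ?thesis by (simp add: mult.assoc[symmetric])
    qed
    finally show ?thesis using True by (simp add: mult_left_mono)
  qed simp
  have "ennreal (r\<^sup>2) * ?T
    = (\<integral>\<^sup>+t. ennreal (r\<^sup>2) * (W (Complex x t) * ennreal (1 / t) * indicator {Y..2 * Y} t) \<partial>lborel)"
    by (rule nn_integral_cmult[symmetric]) measurable
  also have "\<dots> \<le> (\<integral>\<^sup>+t. ennreal (8 / Y) * ?I t \<partial>lborel)"
    by (intro nn_integral_mono point)
  also have "\<dots> = ennreal (8 / Y) * (\<integral>\<^sup>+t. \<integral>\<^sup>+v. \<integral>\<^sup>+u. V u v * B t u v \<partial>lborel \<partial>lborel \<partial>lborel)"
    unfolding B_def V_def by (rule nn_integral_cmult) measurable
  also have "(\<integral>\<^sup>+t. \<integral>\<^sup>+v. \<integral>\<^sup>+u. V u v * B t u v \<partial>lborel \<partial>lborel \<partial>lborel) = (\<integral>\<^sup>+v. \<integral>\<^sup>+t. \<integral>\<^sup>+u. V u v * B t u v \<partial>lborel \<partial>lborel \<partial>lborel)"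
    unfolding B_def V_def by (rule lborel_pair.Fubini') measurable
  also have "\<dots> = (\<integral>\<^sup>+v. \<integral>\<^sup>+u. \<integral>\<^sup>+t. V u v * B t u v \<partial>lborel \<partial>lborel \<partial>lborel)"
    unfolding B_def V_def by (intro nn_integral_cong lborel_pair.Fubini') measurable
  \<comment> \<open>Here the factor \<open>sqrt k\<close> is gained. The mean value inequality loses
    \<open>1 / r^2\<close>, but a given point lies in the squares of \<open>t\<close> in a set of
    measure at most \<open>24 Y r / q\<close> only, so that just \<open>q / r = 4 sqrt k\<close>
    remains. The constant 768 is \<open>8 * 24 * 4\<close>.\<close>
  also have "\<dots> \<le> (\<integral>\<^sup>+v. \<integral>\<^sup>+u. V u v * ennreal (24 * Y * r / q) \<partial>lborel \<partial>lborel)"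
  proof (intro nn_integral_mono)
    fix u v
    have "(\<integral>\<^sup>+t. V u v * B t u v \<partial>lborel) = V u v * (\<integral>\<^sup>+t. B t u v \<partial>lborel)"
      unfolding B_def by (rule nn_integral_cmult) measurable
    also have "\<dots> \<le> V u v * ennreal (24 * Y * r / q)"
      unfolding B_def z_def q_def by (intro mult_left_mono moebius_vertical_in_square det Y r) auto
    finally show "(\<integral>\<^sup>+t. V u v * B t u v \<partial>lborel) \<le> V u v * ennreal (24 * Y * r / q)" .
  qed
  also have "\<dots> = (\<integral>\<^sup>+v. \<integral>\<^sup>+u. V u v \<partial>lborel \<partial>lborel) * ennreal (24 * Y * r / q)"
  proof -
    have "(\<integral>\<^sup>+u. V u v * ennreal (24 * Y * r / q) \<partial>lborel) = (\<integral>\<^sup>+u. V u v \<partial>lborel) * ennreal (24 * Y * r / q)" for v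
      unfolding V_def by (rule nn_integral_multc) measurable
    moreover have "(\<lambda>v. \<integral>\<^sup>+u. V u v \<partial>lborel) \<in> borel_measurable lborel" unfolding V_def by measurable
    ultimately show ?thesis by (simp only: nn_integral_multc)
  qed
  also have "\<dots> \<le> ennreal (q\<^sup>2 * cusp_const \<delta>) * ennreal (24 * Y * r / q)"
    unfolding V_def by (intro mult_right_mono nn_integral_box_le q \<delta>) auto
  finally have fin: "ennreal (r\<^sup>2) * ?T
     \<le> ennreal (8 / Y) * (ennreal (q\<^sup>2 * cusp_const \<delta>) * ennreal (24 * Y * r / q))"
    by (simp add: mult_left_mono)
  have K: "cusp_const \<delta> \<ge> 0" by (rule cusp_const_nonneg[OF \<delta>])
  have "?T
     = ennreal (1 / r\<^sup>2) * (ennreal (r\<^sup>2) * ?T)"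
    using r by (simp add: mult.assoc[symmetric] ennreal_mult[symmetric])
  also have "\<dots> \<le> ennreal (1 / r\<^sup>2) * (ennreal (8 / Y) * (ennreal (q\<^sup>2 * cusp_const \<delta>) * ennreal (24 * Y * r / q)))"
    by (intro mult_left_mono fin) auto
  also have "\<dots> = ennreal (1 / r\<^sup>2 * (8 / Y * ((q\<^sup>2 * cusp_const \<delta>) * (24 * Y * r / q))))"
  proof -
    have n: "0 \<le> 1 / r\<^sup>2" "0 \<le> 8 / Y" "0 \<le> q\<^sup>2 * cusp_const \<delta>" "0 \<le> 24 * Y * r / q"
      using r q Y K by auto
    from n(3,4) have "0 \<le> (q\<^sup>2 * cusp_const \<delta>) * (24 * Y * r / q)" by (rule mult_nonneg_nonneg)
    moreover from n(2) this have "0 \<le> 8 / Y * ((q\<^sup>2 * cusp_const \<delta>) * (24 * Y * r / q))" by (rule mult_nonneg_nonneg)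
    ultimately show ?thesis using n by (simp only: ennreal_mult)
  qed
  also have "1 / r\<^sup>2 * (8 / Y * ((q\<^sup>2 * cusp_const \<delta>) * (24 * Y * r / q))) = 192 * (q / r) * cusp_const \<delta>"
    using r q Y by (simp add: field_simps power2_eq_square)
  also have "q / r = 4 * sqrt (real k)" using r by (simp add: field_simps)
  finally show ?thesis by (simp add: mult_ac)
qed

end

subsection \<open>Sums with additive twists\<close>

text \<open>Since \<open>G\<close> decreases, the increments of \<open>1 / G\<close> are
  nonnegative: their absolute values telescope and contribute at most \<open>B / G M\<close>. The
  boundary term contributes the other half.\<close>

lemma Abel_summation_bound:
  fixes b :: "nat \<Rightarrow> complex" and G :: "nat \<Rightarrow> real"
  assumes pos: "\<And>n. n \<in> {1..M} \<Longrightarrow> G n > 0"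
    and mono: "\<And>n. 1 \<le> n \<Longrightarrow> Suc n \<le> M \<Longrightarrow> G (Suc n) \<le> G n"
    and bound: "\<And>m. m \<in> {1..M} \<Longrightarrow> norm (\<Sum>n=1..m. b n * of_real (G n)) \<le> B"
    and M: "M \<ge> 1"
  shows "norm (\<Sum>n=1..M. b n) \<le> 2 * B / G M"
proof -
  define U where "U = (\<lambda>m. \<Sum>n=1..m. b n * of_real (G n))"
  have B: "B \<ge> 0" using bound[of 1] M by (auto intro: order_trans[OF norm_ge_zero])
  have "norm ((\<Sum>n=1..m. b n) - U m / of_real (G m)) \<le> B * (1 / G m - 1 / G 1)" if "1 \<le> m" "m \<le> M" for m
    using that
  proof (induction m rule: dec_induct)
    case base
    have "G 1 \<noteq> 0" using pos[of 1] M by auto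
    then show ?case by (simp add: U_def)
  next
    case (step m)
    have G: "G m > 0" "G (Suc m) > 0" "G (Suc m) \<le> G m" using pos[of m] pos[of "Suc m"] mono[of m] step by auto
    have U: "U (Suc m) = U m + b (Suc m) * of_real (G (Suc m))" by (simp add: U_def)
    have "(\<Sum>n=1..Suc m. b n) - U (Suc m) / of_real (G (Suc m))
        = ((\<Sum>n=1..m. b n) - U m / of_real (G m)) + U m * of_real (1 / G m - 1 / G (Suc m))"
      using G unfolding U by (simp add: add_divide_distrib right_diff_distrib)
    also have "norm \<dots> \<le> B * (1 / G m - 1 / G 1) + B * (1 / G (Suc m) - 1 / G m)"
    proof (intro order_trans[OF norm_triangle_ineq] add_mono)
      show "norm ((\<Sum>n=1..m. b n) - U m / of_real (G m)) \<le> B * (1 / G m - 1 / G 1)" using step by auto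
      have "norm (complex_of_real (1 / G m - 1 / G (Suc m))) = 1 / G (Suc m) - 1 / G m"
        using G unfolding norm_of_real by (simp add: field_simps)
      moreover have "norm (U m) \<le> B" using bound[of m] step unfolding U_def by auto
      moreover have "0 \<le> 1 / G (Suc m) - 1 / G m" using G by (simp add: field_simps)
      ultimately show "norm (U m * of_real (1 / G m - 1 / G (Suc m))) \<le> B * (1 / G (Suc m) - 1 / G m)"
        unfolding norm_mult by (simp only: mult_right_mono)
    qed
    finally show ?case by (simp add: algebra_simps)
  qed
  from this[of M] have 1: "norm ((\<Sum>n=1..M. b n) - U M / of_real (G M)) \<le> B * (1 / G M - 1 / G 1)" using M by simp
  have G: "G M > 0" "G 1 > 0" using pos M by auto
  have 2: "norm (\<Sum>n=1..M. b n) \<le> norm ((\<Sum>n=1..M. b n) - U M / of_real (G M)) + norm (U M / of_real (G M))"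
    using norm_triangle_ineq[of "(\<Sum>n=1..M. b n) - U M / of_real (G M)" "U M / of_real (G M)"] by simp
  have 3: "norm (U M / of_real (G M)) \<le> B / G M"
    using bound[of M] M G by (simp add: norm_divide U_def divide_right_mono)
  have "B * (1 / G M - 1 / G 1) \<le> B / G M" using B G by (simp add: right_diff_distrib)
  with 1 2 3 show ?thesis by simp
qed

text \<open>The bounds on the blocks from \<open>2^i Y\<close> to \<open>2^(i+1) Y\<close> form a
  geometric series of ratio \<open>1 / sqrt 2\<close>, whose sum is less than 4.\<close>

lemma nn_integral_dyadic_le:
  fixes h :: "real \<Rightarrow> ennreal"
  assumes [measurable]: "h \<in> borel_measurable borel" and Y: "Y > 0" and b: "b \<ge> 0"
    and le: "\<And>y. y > 0 \<Longrightarrow> (\<integral>\<^sup>+t. h t * indicator {y..2 * y} t \<partial>lborel) \<le> ennreal (b / sqrt y)"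
  shows "(\<integral>\<^sup>+t. h t * indicator {Y..} t \<partial>lborel) \<le> ennreal (4 * b / sqrt Y)"
proof -
  let ?h = "\<lambda>i t. h t * indicator {2 ^ i * Y..2 * (2 ^ i * Y)} t"
  have "(\<integral>\<^sup>+t. h t * indicator {Y..} t \<partial>lborel) \<le> (\<integral>\<^sup>+t. (\<Sum>i. ?h i t) \<partial>lborel)"
  proof (intro nn_integral_mono)
    fix t
    show "h t * indicator {Y..} t \<le> (\<Sum>i. ?h i t)"
    proof (cases "t \<ge> Y")
      case True
      define j where "j = (LEAST j. t \<le> 2 * (2 ^ j * Y))"
      have "\<exists>j. t \<le> 2 * (2 ^ j * Y)"
      proof -
        obtain j where "t / Y < 2 ^ j" using real_arch_pow[of 2 "t / Y"] by auto
        then have "t < 2 ^ j * Y" using Y by (simp add: field_simps)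
        then show ?thesis using Y by (intro exI[of _ j]) (auto intro: less_imp_le[OF less_le_trans])
      qed
      then have j: "t \<le> 2 * (2 ^ j * Y)" unfolding j_def by (rule LeastI_ex)
      have j2: "2 ^ j * Y \<le> t"
      proof (cases j)
        case (Suc i)
        then have "\<not> t \<le> 2 * (2 ^ i * Y)" using not_less_Least[of i "\<lambda>j. t \<le> 2 * (2 ^ j * Y)"] by (simp add: j_def)
        then show ?thesis using Suc by simp
      qed (use True in simp)
      have "h t * indicator {Y..} t = (\<Sum>i\<in>{j}. ?h i t)"
        using True j j2 by simp
      also have "\<dots> \<le> (\<Sum>i. ?h i t)"
        by (intro sum_le_suminf) auto
      finally show ?thesis .
    qed simp
  qed
  also have "\<dots> = (\<Sum>i. \<integral>\<^sup>+t. ?h i t \<partial>lborel)"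
    by (rule nn_integral_suminf) measurable
  also have "\<dots> \<le> (\<Sum>i. ennreal (b / sqrt Y * (1 / sqrt 2) ^ i))"
  proof (intro suminf_le)
    fix i
    have "b / sqrt (2 ^ i * Y) = b / sqrt Y * (1 / sqrt 2) ^ i"
      by (simp add: real_sqrt_mult real_sqrt_power power_divide)
    then show "(\<integral>\<^sup>+t. ?h i t \<partial>lborel) \<le> ennreal (b / sqrt Y * (1 / sqrt 2) ^ i)"
      using le[of "2 ^ i * Y"] Y by simp
  qed auto
  also have "\<dots> = ennreal (\<Sum>i. b / sqrt Y * (1 / sqrt 2) ^ i)"
    using b Y by (intro suminf_ennreal2 summable_mult summable_geometric) auto
  also have "(\<Sum>i. b / sqrt Y * (1 / sqrt 2) ^ i) = b / sqrt Y * (1 / (1 - 1 / sqrt 2))"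
    by (subst suminf_mult) (auto intro!: summable_geometric simp: suminf_geometric)
  also have "\<dots> \<le> b / sqrt Y * 4"
  proof (intro mult_left_mono)
    have "sqrt 2 \<ge> sqrt ((4 / 3)\<^sup>2)" by (intro real_sqrt_le_mono) (simp add: power2_eq_square)
    then have "sqrt 2 \<ge> 4 / 3" by simp
    then have "1 / sqrt 2 \<le> 3 / 4" by (simp add: field_simps)
    then show "1 / (1 - 1 / sqrt 2) \<le> 4" by (simp add: field_simps)
  qed (use b Y in auto)
  finally show ?thesis by (simp add: ennreal_leI mult_ac)
qed

lemma nn_integral_inverse_dyadic_le:
  assumes "Y > (0 :: real)"
  shows "(\<integral>\<^sup>+t. ennreal (1 / t) * indicator {Y..2 * Y} t \<partial>lborel) \<le> 1"
proof -
  have "(\<integral>\<^sup>+t. ennreal (1 / t) * indicator {Y..2 * Y} t \<partial>lborel) \<le> (\<integral>\<^sup>+t. ennreal (1 / Y) * indicator {Y..2 * Y} t \<partial>lborel)"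
    using assms by (intro nn_integral_mono) (auto simp: indicator_def intro!: ennreal_leI divide_left_mono)
  also have "\<dots> = 1" using assms by (simp add: nn_integral_cmult ennreal_mult[symmetric] ennreal_1[symmetric] del: ennreal_1)
  finally show ?thesis .
qed

context normalized_eigenform begin

lemma rankin_selberg_ge: "0 < \<delta> \<Longrightarrow> \<delta> \<le> 1 \<Longrightarrow> rankin_selberg lam \<delta> \<ge> 1"
  using rankin_selberg_partial_le_sum[of \<delta> "{1}"] lam_1 by simp

lemma cusp_const_pos: "0 < \<delta> \<Longrightarrow> \<delta> \<le> 1 \<Longrightarrow> cusp_const \<delta> > 0"
  unfolding cusp_const_def using rankin_selberg_ge[of \<delta>]
  by (intro mult_pos_pos divide_pos_pos Gamma_real_pos) auto

text \<open>A bound for the L2 norm of \<open>F\<close> with respect to \<open>dt / t\<close> on any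
  vertical segment whose endpoints have heights in the ratio 2.\<close>

definition vert_const :: "real \<Rightarrow> real" where
  "vert_const \<delta> = sqrt (768 * sqrt (real k) * cusp_const \<delta>)"

text \<open>The indicator makes \<open>\<bar>f\<bar>\<close> measurable, as nothing is known about \<open>f\<close> off the upper half plane.\<close>

definition absf :: "complex \<Rightarrow> ennreal" where
  "absf w = ennreal (norm (indicator upper_half_plane w *\<^sub>R f w))"

lemma absf_measurable [measurable]: "absf \<in> borel_measurable borel"
proof -
  have "(\<lambda>w. indicator upper_half_plane w *\<^sub>R f w) \<in> borel_measurable borel"
    by (intro borel_measurable_continuous_on_indicator holomorphic_on_imp_continuous_on[OF holomorphic]
        borel_open open_upper_half_plane)
  then show ?thesis unfolding absf_def by measurable
qed

lemma absf_eq: "Im w > 0 \<Longrightarrow> absf w = ennreal (norm (f w))"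
  by (simp add: absf_def upper_half_plane_def)

text \<open>The integrand is \<open>F t^(-3/2)\<close>. On a dyadic block Cauchy-Schwarz is applied
  as the inequality between arithmetic and geometric means with a parameter \<open>\<theta>\<close>;
  taking for \<open>\<theta>^2\<close> the bound for the mass of \<open>F^2\<close> makes both
  halves equal. The remaining \<open>t^(-1/2)\<close> makes the blocks summable.\<close>

lemma vertical_line_le:
  assumes Y: "Y > 0" and \<delta>: "0 < \<delta>" "\<delta> \<le> 1"
  shows "(\<integral>\<^sup>+t. ennreal (t powr ((real k - 1) / 2 - 1)) * absf (Complex x t) * indicator {Y..} t \<partial>lborel)
    \<le> ennreal (4 * vert_const \<delta> / sqrt Y)"
proof (rule nn_integral_dyadic_le)
  define \<theta> where "\<theta> = vert_const \<delta>"
  have \<theta>: "\<theta> > 0" using cusp_const_pos[OF \<delta>] k_pos by (simp add: \<theta>_def vert_const_def)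
  have \<theta>2: "\<theta>\<^sup>2 = 768 * sqrt (real k) * cusp_const \<delta>" using cusp_const_nonneg[OF \<delta>] by (simp add: \<theta>_def vert_const_def)
  show "vert_const \<delta> \<ge> 0" using \<theta> by (simp add: \<theta>_def)
  fix y :: real assume y: "y > 0"
  let ?U = "\<lambda>t. ennreal (1 / t) * indicator {y..2 * y} t" and ?V = "\<lambda>t. W (Complex x t) * ennreal (1 / t) * indicator {y..2 * y} t"
  let ?X = "\<lambda>t. ennreal (t powr ((real k - 1) / 2 - 1)) * absf (Complex x t) * indicator {y..2 * y} t" and ?c = "ennreal (1 / (2 * sqrt y))"
  have pt: "?X t
     \<le> ?c * (ennreal \<theta> * ?U t + ennreal (1 / \<theta>) * ?V t)" for t
  proof (cases "t \<in> {y..2 * y}")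
    case True
    then have t: "t > 0" "y \<le> t" using y by auto
    let ?w = "wnorm (Complex x t)"
    have w: "?w \<ge> 0" using t by (intro wnorm_nonneg) simp
    have "sqrt ?w = t powr (real k / 2) * norm (f (Complex x t))"
    proof (rule real_sqrt_unique)
      have "(t powr (real k / 2))\<^sup>2 = t ^ k"
        unfolding power2_eq_square powr_add[symmetric] using t by (simp add: powr_realpow)
      then show "(t powr (real k / 2) * norm (f (Complex x t)))\<^sup>2 = ?w"
        by (simp add: wnorm_def power_mult_distrib)
    qed auto
    moreover have "t powr ((real k - 1) / 2 - 1) = t powr (real k / 2) * (1 / (t * sqrt t))"
    proof -
      have "t powr ((real k - 1) / 2 - 1) = t powr (real k / 2) * t powr (- (1 + 1 / 2))"
        unfolding powr_add[symmetric] by (simp add: field_simps)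
      also have "t powr (- (1 + 1 / 2)) = 1 / (t * sqrt t)"
      proof -
        have "t powr (1 + 1 / 2) = t * sqrt t" unfolding powr_add using t by (simp add: powr_half_sqrt)
        then show ?thesis by (simp only: powr_minus_divide)
      qed
      finally show ?thesis .
    qed
    ultimately have "t powr ((real k - 1) / 2 - 1) * norm (f (Complex x t)) = sqrt ?w * (1 / (t * sqrt t))"
      by simp
    also have "\<dots> \<le> ((\<theta> + 1 / \<theta> * ?w) / 2) * (1 / (t * sqrt y))"
    proof (intro mult_mono divide_left_mono mult_left_mono real_sqrt_le_mono)
      have "0 \<le> (\<theta> - sqrt ?w)\<^sup>2" by simp
      also have "\<dots> = \<theta>\<^sup>2 + ?w - 2 * \<theta> * sqrt ?w" using w by (simp add: power2_diff)
      finally have "\<theta> * (2 * sqrt ?w) \<le> \<theta> * (\<theta> + 1 / \<theta> * ?w)" using \<theta> by (simp add: algebra_simps power2_eq_square)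
      then show "sqrt ?w \<le> (\<theta> + 1 / \<theta> * ?w) / 2" using \<theta> by simp
    qed (use t y w \<theta> in auto)
    also have "\<dots> = 1 / (2 * sqrt y) * (\<theta> * (1 / t) + 1 / \<theta> * (?w * (1 / t)))"
      by (simp add: add_divide_distrib distrib_left mult_ac)
    finally have "ennreal (t powr ((real k - 1) / 2 - 1) * norm (f (Complex x t)))
       \<le> ennreal (1 / (2 * sqrt y) * (\<theta> * (1 / t) + 1 / \<theta> * (?w * (1 / t))))" by (rule ennreal_leI)
    also have "\<dots> = ?c * (ennreal \<theta> * ennreal (1 / t) + ennreal (1 / \<theta>) * (ennreal ?w * ennreal (1 / t)))"
      using \<theta> t y w by (simp add: ennreal_mult ennreal_plus del: times_divide_eq_right times_divide_eq_left mult_1 mult_1_right)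
    finally show ?thesis using True t by (simp add: absf_eq W_eq ennreal_mult)
  qed simp
  have "(\<integral>\<^sup>+t. ?X t \<partial>lborel)
     \<le> (\<integral>\<^sup>+t. ?c * (ennreal \<theta> * ?U t + ennreal (1 / \<theta>) * ?V t) \<partial>lborel)"
    by (intro nn_integral_mono pt)
  also have "\<dots> = ?c * (\<integral>\<^sup>+t. ennreal \<theta> * ?U t + ennreal (1 / \<theta>) * ?V t \<partial>lborel)"
    by (rule nn_integral_cmult) measurable
  also have "(\<integral>\<^sup>+t. ennreal \<theta> * ?U t + ennreal (1 / \<theta>) * ?V t \<partial>lborel)
     = (\<integral>\<^sup>+t. ennreal \<theta> * ?U t \<partial>lborel) + (\<integral>\<^sup>+t. ennreal (1 / \<theta>) * ?V t \<partial>lborel)"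
    by (rule nn_integral_add) measurable
  also have "(\<integral>\<^sup>+t. ennreal \<theta> * ?U t \<partial>lborel) = ennreal \<theta> * (\<integral>\<^sup>+t. ?U t \<partial>lborel)"
    by (rule nn_integral_cmult) measurable
  also have "(\<integral>\<^sup>+t. ennreal (1 / \<theta>) * ?V t \<partial>lborel) = ennreal (1 / \<theta>) * (\<integral>\<^sup>+t. ?V t \<partial>lborel)"
    by (rule nn_integral_cmult) measurable
  also have "?c * (ennreal \<theta> * (\<integral>\<^sup>+t. ?U t \<partial>lborel) + ennreal (1 / \<theta>) * (\<integral>\<^sup>+t. ?V t \<partial>lborel))
     \<le> ?c * (ennreal \<theta> * ennreal 1 + ennreal (1 / \<theta>) * ennreal (\<theta>\<^sup>2))"
    unfolding \<theta>2 using nn_integral_inverse_dyadic_le[OF y]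
    by (intro mult_left_mono add_mono vertical_segment_le y \<delta>) auto
  also have "\<dots> = ennreal (1 / (2 * sqrt y) * (\<theta> * 1 + 1 / \<theta> * \<theta>\<^sup>2))"
    using \<theta> y by (simp add: ennreal_mult ennreal_plus del: times_divide_eq_right times_divide_eq_left mult_1 mult_1_right)
  also have "1 / (2 * sqrt y) * (\<theta> * 1 + 1 / \<theta> * \<theta>\<^sup>2) = vert_const \<delta> / sqrt y"
    using \<theta> by (simp add: power2_eq_square \<theta>_def[symmetric] field_simps)
  finally show "(\<integral>\<^sup>+t. ?X t \<partial>lborel) \<le> ennreal (vert_const \<delta> / sqrt y)" .
qed (use Y in measurable)

end

text \<open>The upper incomplete Gamma function at \<open>2 pi a\<close>, divided by
  \<open>(2 pi)^s\<close>. At \<open>a = n Y\<close> it is the weight that \<open>lam n\<close>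
  receives from the Mellin integral cut off at \<open>Y\<close>.\<close>

definition gamma_tail :: "real \<Rightarrow> real \<Rightarrow> real" where
  "gamma_tail s a = (\<integral>u. indicator {a..} u *\<^sub>R (u powr (s - 1) * exp (- (2 * pi) * u)) \<partial>lborel)"

lemma integrable_power_exp:
  fixes s a c :: real
  assumes "s > 0" "a \<ge> 0" "c > 0"
  shows "integrable lborel (\<lambda>u. indicator {a..} u *\<^sub>R (u powr (s - 1) * exp (- c * u)))"
proof (rule integrableI_bounded)
  have "(\<integral>\<^sup>+u. ennreal (norm (indicator {a..} u *\<^sub>R (u powr (s - 1) * exp (- c * u)))) \<partial>lborel)
     \<le> (\<integral>\<^sup>+u. ennreal (u powr (s - 1) * exp (- c * u)) * indicator {0..} u \<partial>lborel)"
    using assms by (intro nn_integral_mono) (auto simp: indicator_def)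
  also have "\<dots> = ennreal (Gamma s / c powr s)" using assms by (intro nn_integral_Gamma_scaled)
  finally show "(\<integral>\<^sup>+u. ennreal (norm (indicator {a..} u *\<^sub>R (u powr (s - 1) * exp (- c * u)))) \<partial>lborel) < \<infinity>"
    by (rule le_less_trans) simp
qed measurable

lemma gamma_tail_scaled:
  assumes "s > 0" "n > 0" "Y > 0"
  shows "gamma_tail s (n * Y) = n powr s * (\<integral>y. indicator {Y..} y *\<^sub>R (y powr (s - 1) * exp (- (2 * pi * n) * y)) \<partial>lborel)"
proof -
  have "gamma_tail s (n * Y) = \<bar>n\<bar> *\<^sub>R (\<integral>y. indicator {n * Y..} (0 + n * y) *\<^sub>R ((0 + n * y) powr (s - 1) * exp (- (2 * pi) * (0 + n * y))) \<partial>lborel)"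
    unfolding gamma_tail_def using assms by (intro lborel_integral_real_affine) auto
  also have "(\<lambda>y. indicat_real {n * Y..} (0 + n * y) *\<^sub>R ((0 + n * y) powr (s - 1) * exp (- (2 * pi) * (0 + n * y))))
      = (\<lambda>y. n powr (s - 1) * (indicator {Y..} y *\<^sub>R (y powr (s - 1) * exp (- (2 * pi * n) * y))))"
    using assms by (auto simp: fun_eq_iff indicator_def powr_mult mult_ac)
  also have "\<bar>n\<bar> *\<^sub>R (\<integral>y. n powr (s - 1) * (indicator {Y..} y *\<^sub>R (y powr (s - 1) * exp (- (2 * pi * n) * y))) \<partial>lborel)
     = (n * n powr (s - 1)) * (\<integral>y. indicator {Y..} y *\<^sub>R (y powr (s - 1) * exp (- (2 * pi * n) * y)) \<partial>lborel)"
    using assms by simp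
  also have "n * n powr (s - 1) = n powr s" using assms by (simp add: powr_diff)
  finally show ?thesis .
qed

lemma gamma_tail_antimono:
  assumes "s > 0" "0 \<le> a" "a \<le> b"
  shows "gamma_tail s b \<le> gamma_tail s a"
  unfolding gamma_tail_def using assms
  by (intro integral_mono integrable_power_exp) (auto simp: indicator_def)

lemma gamma_tail_ge:
  assumes "s \<ge> 1 / 2" "0 \<le> a" "a \<le> s / (6 * pi)"
  shows "Gamma s / (2 * pi) powr s / 10 \<le> gamma_tail s a"
proof -
  have "ennreal (Gamma s / (2 * pi) powr s / 10) \<le>
    (\<integral>\<^sup>+u. ennreal (u powr (s - 1) * exp (- (2 * pi) * u)) * indicator {a..} u \<partial>lborel)"
    using assms by (intro nn_integral_Gamma_tail_ge)
  also have "\<dots> = (\<integral>\<^sup>+u. ennreal (indicator {a..} u *\<^sub>R (u powr (s - 1) * exp (- (2 * pi) * u))) \<partial>lborel)"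
    by (intro nn_integral_cong) (auto simp: indicator_def)
  also have "\<dots> = ennreal (gamma_tail s a)"
    unfolding gamma_tail_def using assms by (intro nn_integral_eq_integral integrable_power_exp) auto
  finally show ?thesis
    by (subst (asm) ennreal_le_iff) (auto simp: gamma_tail_def intro!: integral_nonneg)
qed

context normalized_eigenform begin

lemma continuous_dirichlet_kernel: "continuous_on A (dirichlet_kernel M)"
  unfolding dirichlet_kernel_def cis_conv_exp by (intro continuous_intros)

lemma norm_horizontal_partial_sum_le:
  assumes "y > 0"
  shows "ennreal (norm (\<Sum>n=1..M. coeff n * of_real (exp (- (2 * pi * real n * y))) * cis (2 * pi * real n * \<alpha>)))
    \<le> (\<integral>\<^sup>+x. absf (Complex (\<alpha> + x) y) * (ennreal (norm (dirichlet_kernel M x)) * indicator {-(1/2)..1/2} x) \<partial>lborel)"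
proof -
  interpret abs_fourier "\<lambda>n. coeff n * of_real (exp (- (2 * pi * real n * y)))" "\<lambda>x. f (Complex x y)"
    using assms by (rule fourier)
  let ?S = "\<Sum>n=1..M. coeff n * of_real (exp (- (2 * pi * real n * y))) * cis (2 * pi * real n * \<alpha>)"
  have "((\<lambda>x. f (Complex (\<alpha> + x) y) * dirichlet_kernel M x) has_integral ?S) {-(1/2)..-(1/2) + 1}"
    by (rule partial_sum)
  then have "?S = integral {-(1/2)..1/2} (\<lambda>x. f (Complex (\<alpha> + x) y) * dirichlet_kernel M x)"
    by (simp add: integral_unique)
  moreover have "continuous_on {-(1/2)..1/2} (\<lambda>x. f (Complex (\<alpha> + x) y) * dirichlet_kernel M x)"
    by (intro continuous_intros continuous_dirichlet_kernel continuous_on_compose2[OF continuous[of UNIV]]) auto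
  ultimately have "ennreal (norm ?S) \<le> (\<integral>\<^sup>+x. ennreal (norm (f (Complex (\<alpha> + x) y) * dirichlet_kernel M x)) * indicator {-(1/2)..1/2} x \<partial>lborel)"
    by (simp only: ennreal_norm_integral_le)
  also have "\<dots> = (\<integral>\<^sup>+x. absf (Complex (\<alpha> + x) y) * (ennreal (norm (dirichlet_kernel M x)) * indicator {-(1/2)..1/2} x) \<partial>lborel)"
    using assms by (intro nn_integral_cong) (simp add: absf_eq norm_mult ennreal_mult mult.assoc)
  finally show ?thesis .
qed

text \<open>On each horizontal line the partial sum of length \<open>M\<close> is an integral of
  \<open>f\<close> against the Dirichlet kernel. After taking absolute values the integral over
  \<open>y\<close> is done first: its bound on the vertical line over \<open>\<alpha> + x\<close> is
  uniform in \<open>x\<close>, so the L1 norm of the kernel factors out. This makes the estimate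
  uniform in \<open>\<alpha>\<close>.\<close>

lemma weighted_sum_le:
  assumes Y: "Y > 0" and \<delta>: "0 < \<delta>" "\<delta> \<le> 1" and \<eta>: "0 < \<eta>" "\<eta> < 1"
  shows "norm (\<Sum>n=1..M. lam n * cis (2 * pi * real n * \<alpha>) * of_real (gamma_tail ((real k - 1) / 2) (real n * Y)))
    \<le> 4 / \<eta> * real M powr \<eta> * (4 * vert_const \<delta> / sqrt Y)"
proof -
  define s where "s = (real k - 1) / 2"
  let ?D = "\<lambda>x. ennreal (norm (dirichlet_kernel M x)) * indicator {-(1/2)..1/2} x"
  let ?H = "\<lambda>x y. ennreal (y powr (s - 1)) * absf (Complex (\<alpha> + x) y) * indicator {Y..} y"
  let ?K = "4 * vert_const \<delta> / sqrt Y"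
  let ?B = "4 / \<eta> * real M powr \<eta>"
  have s: "s > 0" using k_ge_2 by (simp add: s_def)
  define \<phi> where "\<phi> = (\<lambda>n y. indicator {Y..} y *\<^sub>R (y powr (s - 1) * exp (- (2 * pi * real n) * y)))"
  have int_\<phi>: "integrable lborel (\<phi> n)" if "n > 0" for n
    unfolding \<phi>_def using s Y that by (intro integrable_power_exp) auto
  let ?c = "\<lambda>n. coeff n * cis (2 * pi * real n * \<alpha>)"
  have int_c: "integrable lborel (\<lambda>y. ?c n * of_real (\<phi> n y))" if "n \<in> {1..M}" for n
    using int_\<phi>[of n] that by (intro integrable_mult_right integrable_of_real) auto
  have "(\<Sum>n=1..M. lam n * cis (2 * pi * real n * \<alpha>) * of_real (gamma_tail s (real n * Y)))
      = (\<Sum>n=1..M. \<integral>y. ?c n * of_real (\<phi> n y) \<partial>lborel)"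
  proof (intro sum.cong refl)
    fix n assume n: "n \<in> {1..M}"
    have "of_real (gamma_tail s (real n * Y)) = of_real (real n powr s) * complex_of_real (\<integral>y. \<phi> n y \<partial>lborel)"
      using gamma_tail_scaled[of s "real n" Y] s Y n by (simp add: \<phi>_def)
    then show "lam n * cis (2 * pi * real n * \<alpha>) * of_real (gamma_tail s (real n * Y)) = (\<integral>y. ?c n * of_real (\<phi> n y) \<partial>lborel)"
      using int_\<phi>[of n] n by (simp add: coeff_def s_def integral_of_real)
  qed
  also have "\<dots> = (\<integral>y. (\<Sum>n=1..M. ?c n * of_real (\<phi> n y)) \<partial>lborel)"
    by (rule Bochner_Integration.integral_sum[symmetric]) (rule int_c)
  finally have eq: "(\<Sum>n=1..M. lam n * cis (2 * pi * real n * \<alpha>) * of_real (gamma_tail s (real n * Y))) = \<dots>" .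
  have "ennreal (norm (\<integral>y. (\<Sum>n=1..M. ?c n * of_real (\<phi> n y)) \<partial>lborel)) \<le> (\<integral>\<^sup>+y. ennreal (norm (\<Sum>n=1..M. ?c n * of_real (\<phi> n y))) \<partial>lborel)"
    by (intro integral_norm_bound_ennreal Bochner_Integration.integrable_sum int_c)
  also have "\<dots> \<le> (\<integral>\<^sup>+y. \<integral>\<^sup>+x. ?H x y * ?D x \<partial>lborel \<partial>lborel)"
  proof (intro nn_integral_mono)
    fix y :: real
    show "ennreal (norm (\<Sum>n=1..M. ?c n * of_real (\<phi> n y))) \<le> (\<integral>\<^sup>+x. ?H x y * ?D x \<partial>lborel)"
    proof (cases "y \<ge> Y")
      case True
      then have y: "y > 0" using Y by simp
      have "(\<Sum>n=1..M. ?c n * of_real (\<phi> n y)) = of_real (y powr (s - 1)) * (\<Sum>n=1..M. coeff n * of_real (exp (- (2 * pi * real n * y))) * cis (2 * pi * real n * \<alpha>))"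
        using True unfolding sum_distrib_left by (intro sum.cong) (auto simp: \<phi>_def mult_ac)
      then have "ennreal (norm (\<Sum>n=1..M. ?c n * of_real (\<phi> n y))) = ennreal (y powr (s - 1)) * ennreal (norm (\<Sum>n=1..M. coeff n * of_real (exp (- (2 * pi * real n * y))) * cis (2 * pi * real n * \<alpha>)))"
        by (simp add: norm_mult ennreal_mult)
      also have "\<dots> \<le> ennreal (y powr (s - 1)) * (\<integral>\<^sup>+x. absf (Complex (\<alpha> + x) y) * ?D x \<partial>lborel)"
        by (intro mult_left_mono norm_horizontal_partial_sum_le y) simp
      also have "\<dots> = (\<integral>\<^sup>+x. ennreal (y powr (s - 1)) * (absf (Complex (\<alpha> + x) y) * ?D x) \<partial>lborel)"
        unfolding dirichlet_kernel_def cis_conv_exp by (rule nn_integral_cmult[symmetric]) measurable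
      finally show ?thesis using True by (simp add: mult.assoc)
    next
      case False
      then have "\<phi> n y = 0" for n by (simp add: \<phi>_def)
      then show ?thesis by simp
    qed
  qed
  also have "\<dots> = (\<integral>\<^sup>+x. \<integral>\<^sup>+y. ?H x y * ?D x \<partial>lborel \<partial>lborel)"
    unfolding dirichlet_kernel_def cis_conv_exp by (rule lborel_pair.Fubini') measurable
  also have "\<dots> \<le> (\<integral>\<^sup>+x. ennreal ?K * ?D x \<partial>lborel)"
  proof (intro nn_integral_mono)
    fix x
    have "(\<integral>\<^sup>+y. ?H x y * ?D x \<partial>lborel)
       = (\<integral>\<^sup>+y. ?H x y \<partial>lborel) * ?D x"
      by (rule nn_integral_multc) measurable
    also have "\<dots> \<le> ennreal ?K * ?D x"
      unfolding s_def by (intro mult_right_mono vertical_line_le Y \<delta>) simp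
    finally show "(\<integral>\<^sup>+y. ?H x y * ?D x \<partial>lborel) \<le> \<dots>" .
  qed
  also have "\<dots> = ennreal ?K * (\<integral>\<^sup>+x. ennreal (norm (dirichlet_kernel M x)) * indicator {-(1/2)..1/2} x \<partial>lborel)"
    unfolding dirichlet_kernel_def cis_conv_exp by (rule nn_integral_cmult) measurable
  also have "\<dots> \<le> ennreal ?K * ennreal ?B"
    by (intro mult_left_mono nn_integral_dirichlet_kernel_le \<eta>) simp
  also have "\<dots> = ennreal (?B * ?K)"
    using \<eta> Y by (subst ennreal_mult[symmetric]) (auto simp: vert_const_def cusp_const_nonneg \<delta> mult_ac)
  finally have "ennreal (norm (\<integral>y. (\<Sum>n=1..M. ?c n * of_real (\<phi> n y)) \<partial>lborel)) \<le> ennreal (?B * ?K)" .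
  moreover have "0 \<le> ?B * ?K"
    using \<eta> Y cusp_const_nonneg[OF \<delta>] by (auto simp: vert_const_def)
  ultimately show ?thesis using eq unfolding s_def by (simp only: ennreal_le_iff)
qed

text \<open>The exponent of \<open>k\<close> is 1/4 from the square root of \<open>sqrt k\<close>,
  3/4 from \<open>sqrt_Gamma_le\<close>, and \<open>\<delta>\<close> as half of the sum of two
  losses, one in the series and one in \<open>Gamma (k + \<delta>)\<close>. The Gamma factor is put
  in the form in which it cancels against the Mellin weight.\<close>

lemma vert_const_le:
  assumes \<delta>: "0 < \<delta>" "\<delta> \<le> 1" and C: "rankin_selberg lam \<delta> \<le> C * real k powr \<delta>" "C > 0"
  shows "vert_const \<delta> \<le> 744 * sqrt C * real k powr (1 + \<delta>) * Gamma ((real k - 1) / 2) / (2 * pi) powr (real k / 2)"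
proof -
  have k2: "real k \<ge> 2" using k_ge_2 by simp
  have G: "Gamma (real k) > 0" using k2 by (intro Gamma_real_pos) auto
  have Gs: "Gamma ((real k - 1) / 2) > 0" using k2 by (intro Gamma_real_pos) auto
  let ?R = "C * ((real k powr \<delta>)\<^sup>2 * (Gamma (real k) / (4 * pi) powr real k))"
  have "cusp_const \<delta> \<le> 720 * (real k powr \<delta> * Gamma (real k) / (4 * pi) powr real k * (C * real k powr \<delta>))"
    unfolding cusp_const_def
  proof (intro mult_left_mono mult_mono frac_le)
    show "Gamma (real k + \<delta>) \<le> real k powr \<delta> * Gamma (real k)" using k2 \<delta> by (intro Gamma_plus_le) auto
    show "(4 * pi) powr real k \<le> (4 * pi) powr (real k + \<delta>)" using \<delta> pi_ge_two by (intro powr_mono) auto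
    show "0 \<le> rankin_selberg lam \<delta>" using rankin_selberg_ge[OF \<delta>] by simp
  qed (use C G in auto)
  also have "\<dots> = 720 * C * (real k powr \<delta>)\<^sup>2 * (Gamma (real k) / (4 * pi) powr real k)"
    by (simp add: power2_eq_square)
  finally have "768 * sqrt (real k) * cusp_const \<delta> \<le> 768 * sqrt (real k) * (720 * C * (real k powr \<delta>)\<^sup>2 * (Gamma (real k) / (4 * pi) powr real k))"
    by (intro mult_left_mono) auto
  also have "\<dots> = 552960 * (sqrt (real k) * ?R)" by simp
  \<comment> \<open>The number \<open>552960 = 768 * 720\<close> is rounded up to a square.\<close>
  also have "\<dots> \<le> 744\<^sup>2 * (sqrt (real k) * ?R)"
    using C G by (intro mult_right_mono) (auto intro!: mult_nonneg_nonneg)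
  finally have "vert_const \<delta> \<le> sqrt (744\<^sup>2 * (sqrt (real k) * ?R))"
    unfolding vert_const_def by (rule real_sqrt_le_mono)
  also have "\<dots> = 744 * (sqrt (sqrt (real k)) * (sqrt C * (real k powr \<delta> * (sqrt (Gamma (real k)) / sqrt ((4 * pi) powr real k)))))"
    by (simp add: real_sqrt_mult real_sqrt_divide)
  also have "sqrt (sqrt (real k)) = real k powr (1 / 4)" by (simp add: powr_half_sqrt[symmetric] powr_powr)
  also have "sqrt ((4 * pi) powr real k) = 2 powr (real k / 2) * (2 * pi) powr (real k / 2)"
  proof -
    have "sqrt ((4 * pi) powr real k) = (4 * pi) powr (real k / 2)" by (simp add: powr_half_sqrt[symmetric] powr_powr)
    also have "\<dots> = 2 powr (real k / 2) * (2 * pi) powr (real k / 2)" by (subst powr_mult[symmetric]) auto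
    finally show ?thesis .
  qed
  also have "744 * (real k powr (1 / 4) * (sqrt C * (real k powr \<delta> * (sqrt (Gamma (real k)) / (2 powr (real k / 2) * (2 * pi) powr (real k / 2))))))
    \<le> 744 * (real k powr (1 / 4) * (sqrt C * (real k powr \<delta> * ((2 powr (real k / 2) * real k powr (3 / 4) * Gamma ((real k - 1) / 2)) / (2 powr (real k / 2) * (2 * pi) powr (real k / 2))))))"
    using C sqrt_Gamma_le[OF k2] by (intro mult_left_mono divide_right_mono) auto
  also have "\<dots> = 744 * sqrt C * (real k powr (1 / 4) * real k powr (3 / 4) * real k powr \<delta>) * Gamma ((real k - 1) / 2) / (2 * pi) powr (real k / 2)"
    by simp
  also have "real k powr (1 / 4) * real k powr (3 / 4) * real k powr \<delta> = real k powr (1 + \<delta>)"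
    unfolding powr_add[symmetric] by simp
  finally show ?thesis .
qed

lemma twisted_sum_le:
  assumes \<delta>: "0 < \<delta>" "\<delta> < 1" and C: "rankin_selberg lam \<delta> \<le> C * real k powr \<delta>" "C > 0" and M: "M \<ge> 1"
  shows "norm (\<Sum>n=1..M. lam n * cis (2 * pi * real n * \<alpha>))
    \<le> 2500000 * sqrt C / \<delta> * real M powr (1 / 2 + \<delta>) * real k powr (1 / 2 + \<delta>)"
proof -
  define s where "s = (real k - 1) / 2"
  have k2: "real k \<ge> 2" using k_ge_2 by simp
  have s: "s \<ge> 1 / 2" "s \<ge> real k / 4" using k2 by (auto simp: s_def)
  have Gs: "Gamma s > 0" using s by (intro Gamma_real_pos) auto
  \<comment> \<open>The largest cutoff for which \<open>gamma_tail_ge\<close> applies to every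
    \<open>n \<le> M\<close>, so that all weights keep at least a tenth of the complete Gamma
    integral. The same \<open>Y\<close> serves all the shorter partial sums that Abel summation
    requires.\<close>
  define Y where "Y = s / (6 * pi * real M)"
  have Y: "Y > 0" using s M by (simp add: Y_def)
  have MY: "real n * Y \<le> s / (6 * pi)" if "n \<le> M" for n
    using that s M by (simp add: Y_def field_simps mult_left_mono)
  define B where "B = 4 / \<delta> * real M powr \<delta> * (4 * vert_const \<delta> / sqrt Y)"
  define g where "g = Gamma s / (2 * pi) powr s / 10"
  have g: "g > 0" using Gs by (simp add: g_def)
  have ge: "gamma_tail s (real n * Y) \<ge> g" if "n \<le> M" for n
    unfolding g_def using s Y MY[OF that] by (intro gamma_tail_ge) auto
  have vc: "vert_const \<delta> \<ge> 0" using \<delta> by (simp add: vert_const_def cusp_const_nonneg)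
  have B: "B \<ge> 0" using \<delta> Y vc by (simp add: B_def)
  have "norm (\<Sum>n=1..M. lam n * cis (2 * pi * real n * \<alpha>)) \<le> 2 * B / gamma_tail s (real M * Y)"
  proof (rule Abel_summation_bound)
    show "gamma_tail s (real n * Y) > 0" if "n \<in> {1..M}" for n using ge[of n] g that by auto
    show "gamma_tail s (real (Suc n) * Y) \<le> gamma_tail s (real n * Y)" for n
      using s Y by (intro gamma_tail_antimono) auto
    show "norm (\<Sum>n=1..m. lam n * cis (2 * pi * real n * \<alpha>) * of_real (gamma_tail s (real n * Y))) \<le> B" if "m \<in> {1..M}" for m
    proof -
      have "norm (\<Sum>n=1..m. lam n * cis (2 * pi * real n * \<alpha>) * of_real (gamma_tail s (real n * Y)))
        \<le> 4 / \<delta> * real m powr \<delta> * (4 * vert_const \<delta> / sqrt Y)"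
        unfolding s_def using \<delta> by (intro weighted_sum_le Y) auto
      also have "\<dots> \<le> B" unfolding B_def using \<delta> that vc Y
        by (intro mult_right_mono mult_left_mono powr_mono2) auto
      finally show ?thesis .
    qed
  qed (use M in auto)
  also have "\<dots> \<le> 2 * B / g" using B g ge[of M] by (intro divide_left_mono mult_pos_pos) auto
  also have "\<dots> = 320 / \<delta> * real M powr \<delta> * (vert_const \<delta> * (2 * pi) powr s / Gamma s) * (1 / sqrt Y)"
    using Gs by (simp add: B_def g_def mult_ac)
  \<comment> \<open>The Gamma factor in \<open>vert_const\<close> cancels the Mellin weight in
    \<open>g\<close> and leaves \<open>k^(1+\<delta>)\<close>; the cutoff contributes
    \<open>(M / k)^(1/2)\<close>. For its constant, \<open>s \<ge> k / 4\<close> gives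
    \<open>1 / Y \<le> 24 pi M / k\<close>, and \<open>24 pi \<le> 81\<close>.\<close>
  also have "\<dots> \<le> 320 / \<delta> * real M powr \<delta> * (744 * sqrt C * real k powr (1 + \<delta>)) * (9 * (real M powr (1 / 2) * real k powr (- (1 / 2))))"
  proof (intro mult_mono)
    have "vert_const \<delta> * (2 * pi) powr s / Gamma s \<le> (744 * sqrt C * real k powr (1 + \<delta>) * Gamma s / (2 * pi) powr (real k / 2)) * (2 * pi) powr s / Gamma s"
      using vert_const_le[of \<delta> C] \<delta> C Gs unfolding s_def[symmetric]
      by (intro divide_right_mono mult_right_mono) auto
    also have "\<dots> = (744 * sqrt C * real k powr (1 + \<delta>)) * ((2 * pi) powr s / (2 * pi) powr (real k / 2))"
      using Gs by simp
    also have "\<dots> \<le> (744 * sqrt C * real k powr (1 + \<delta>)) * 1"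
    proof (rule mult_left_mono)
      have "(2 * pi) powr s \<le> (2 * pi) powr (real k / 2)" using pi_ge_two by (intro powr_mono) (auto simp: s_def)
      then show "(2 * pi) powr s / (2 * pi) powr (real k / 2) \<le> 1" by simp
    qed (use C in auto)
    finally show "vert_const \<delta> * (2 * pi) powr s / Gamma s \<le> 744 * sqrt C * real k powr (1 + \<delta>)" by simp
    have "1 / Y = 6 * pi * real M / s" by (simp add: Y_def)
    also have "\<dots> \<le> 6 * pi * real M / (real k / 4)" using s k2 by (intro divide_left_mono) auto
    also have "\<dots> = 24 * pi * (real M / real k)" by simp
    also have "\<dots> \<le> 9\<^sup>2 * (real M / real k)"
    proof (rule mult_right_mono)
      show "24 * pi \<le> 9\<^sup>2" using pi_approx by simp
    qed auto
    finally have "sqrt (1 / Y) \<le> sqrt (9\<^sup>2 * (real M / real k))" by (rule real_sqrt_le_mono)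
    also have "\<dots> = 9 * (real M powr (1 / 2) * real k powr (- (1 / 2)))"
      unfolding real_sqrt_mult real_sqrt_divide powr_minus_divide by (simp add: powr_half_sqrt)
    finally show "1 / sqrt Y \<le> 9 * (real M powr (1 / 2) * real k powr (- (1 / 2)))" by (simp add: real_sqrt_divide)
  qed (use \<delta> Gs vc C Y in auto)
  also have "\<dots> = 2142720 * (sqrt C / \<delta>) * (real M powr \<delta> * real M powr (1 / 2)) * (real k powr (1 + \<delta>) * real k powr (- (1 / 2)))"
    by simp
  also have "\<dots> \<le> 2500000 * (sqrt C / \<delta>) * (real M powr \<delta> * real M powr (1 / 2)) * (real k powr (1 + \<delta>) * real k powr (- (1 / 2)))"
    using C \<delta> by (intro mult_right_mono) auto
  also have "\<dots> = 2500000 * sqrt C / \<delta> * real M powr (1 / 2 + \<delta>) * real k powr (1 / 2 + \<delta>)"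
    unfolding powr_add[symmetric] by (simp add: add_ac)
  finally show ?thesis .
qed

end

theorem theorem1p1:
  fixes \<epsilon> :: real
  assumes "\<epsilon> > 0"
  shows "\<exists>C :: real.
    \<forall>(k :: nat) (f :: complex \<Rightarrow> complex) (lam :: nat \<Rightarrow> complex).
      k > 0 \<longrightarrow> even k \<longrightarrow> hecke_eigenform k f \<longrightarrow>
      (\<forall>z\<in>upper_half_plane.
         (\<lambda>m. let n = Suc m in
            lam n * of_real (real n powr ((real k - 1) / 2)) * e (of_nat n * z)) sums f z) \<longrightarrow>
      lam 1 = 1 \<longrightarrow>
      (\<forall>(\<alpha> :: real) (N :: real). N \<ge> 1 \<longrightarrow>
         norm (\<Sum>n | 1 \<le> n \<and> real n \<le> N. lam n * e (of_real (\<alpha> * real n)))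
           \<le> C * N powr (1/2 + \<epsilon>) * eigenform_conductor k powr (1/4 + \<epsilon>))"
proof -
  \<comment> \<open>A single \<open>\<delta>\<close> serves as the parameter of the Rankin-Selberg
    series, as the exponent of \<open>k\<close> in its bound and as the exponent lost in the
    Dirichlet kernel. The cap keeps it below 1, as these bounds require.\<close>
  define \<delta> where "\<delta> = min \<epsilon> (1 / 2)"
  have \<delta>: "0 < \<delta>" "\<delta> < 1" "\<delta> \<le> \<epsilon>" using assms by (auto simp: \<delta>_def)
  obtain C where C: "C > 0" "\<And>k f lam. normalized_eigenform k f lam \<Longrightarrow> rankin_selberg lam \<delta> \<le> C * real k powr \<delta>"
    using rankin_selberg_bound[of \<delta> \<delta>] \<delta> by auto
  define K where "K = 2500000 * sqrt C / \<delta>"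
  have K: "K \<ge> 0" using C \<delta> by (simp add: K_def)
  have bound: "norm (\<Sum>n | 1 \<le> n \<and> real n \<le> N. lam n * e (of_real (\<alpha> * real n)))
      \<le> (K * 4 powr (1/4 + \<epsilon>)) * N powr (1/2 + \<epsilon>) * eigenform_conductor k powr (1/4 + \<epsilon>)"
    if "normalized_eigenform k f lam" and N: "N \<ge> 1" for k f lam and \<alpha> N :: real
  proof -
    interpret normalized_eigenform k f lam by fact
    define M where "M = nat \<lfloor>N\<rfloor>"
    have M: "M \<ge> 1" "real M \<le> N" using N by (auto simp: M_def le_nat_iff le_floor_iff)
    have set_eq: "{n. 1 \<le> n \<and> real n \<le> N} = {1..M}"
      unfolding M_def using N by (auto simp: le_nat_iff le_floor_iff)
    have "norm (\<Sum>n | 1 \<le> n \<and> real n \<le> N. lam n * e (of_real (\<alpha> * real n))) = norm (\<Sum>n=1..M. lam n * cis (2 * pi * real n * \<alpha>))"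
      unfolding set_eq by (simp only: e_of_real mult_ac)
    also have "\<dots> \<le> K * real M powr (1 / 2 + \<delta>) * real k powr (1 / 2 + \<delta>)"
      unfolding K_def by (intro twisted_sum_le \<delta> C(1) C(2)[OF that(1)] M)
    also have "\<dots> \<le> K * N powr (1/2 + \<epsilon>) * (4 powr (1/4 + \<epsilon>) * eigenform_conductor k powr (1/4 + \<epsilon>))"
    proof (intro mult_mono)
      have "real M powr (1 / 2 + \<delta>) \<le> N powr (1 / 2 + \<delta>)" using M \<delta> by (intro powr_mono2) auto
      also have "\<dots> \<le> N powr (1/2 + \<epsilon>)" using N \<delta> by (intro powr_mono) auto
      finally show "real M powr (1 / 2 + \<delta>) \<le> N powr (1/2 + \<epsilon>)" .
      have "real k powr (1 / 2 + \<delta>) \<le> real k powr (2 * (1/4 + \<epsilon>))"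
        using k_pos \<delta> by (intro powr_mono) auto
      also have "\<dots> = (real k powr 2) powr (1/4 + \<epsilon>)" by (rule powr_powr[symmetric])
      also have "real k powr 2 = real k ^ 2" using k_pos by simp
      also have "(real k ^ 2) powr (1/4 + \<epsilon>) \<le> (4 * eigenform_conductor k) powr (1/4 + \<epsilon>)"
        using eigenform_conductor_bounds(1)[of k] k_pos assms by (intro powr_mono2) auto
      also have "\<dots> = 4 powr (1/4 + \<epsilon>) * eigenform_conductor k powr (1/4 + \<epsilon>)" by (rule powr_mult)
      finally show "real k powr (1 / 2 + \<delta>) \<le> 4 powr (1/4 + \<epsilon>) * eigenform_conductor k powr (1/4 + \<epsilon>)" .
    qed (use K in auto)
    finally show ?thesis by (simp only: mult_ac)
  qed
  show ?thesis
  proof (intro exI[of _ "K * 4 powr (1/4 + \<epsilon>)"] allI impI)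
    fix k f lam and \<alpha> N :: real
    assume "k > 0" "even k" "hecke_eigenform k f"
      and "\<forall>z\<in>upper_half_plane. (\<lambda>m. let n = Suc m in
            lam n * of_real (real n powr ((real k - 1) / 2)) * e (of_nat n * z)) sums f z"
      and "lam 1 = 1" and N: "N \<ge> 1"
    then have "normalized_eigenform k f lam" by (intro normalized_eigenform.intro) blast+
    from bound[OF this N]
    show "norm (\<Sum>n | 1 \<le> n \<and> real n \<le> N. lam n * e (of_real (\<alpha> * real n)))
      \<le> K * 4 powr (1/4 + \<epsilon>) * N powr (1/2 + \<epsilon>) * eigenform_conductor k powr (1/4 + \<epsilon>)" .
  qed
qed

end
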